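(* Let $\Sigma=(X,\sigma)$ be a topological dynamical system, with $X$ a non-empty compact Hausdorff space and $\sigma$ a homeomorphism of $X$. The following are equivalent: (1) the maps $I\mapsto\mathcal H(I)$ and $S\mapsto\mathcal K(S)$ are mutually inverse bijections between the set of closed ideals of $\ell^1(\Sigma)$ and the set of $\sigma$-invariant closed subsets of $X$; (2) every closed ideal of $\ell^1(\Sigma)$ is well behaved; (3) every closed ideal of $\ell^1(\Sigma)$ is self-adjoint; (4) every primitive ideal of $\ell^1(\Sigma)$ is well behaved; (5) every closed ideal of $\ell^1(\Sigma)$ is the intersection of well behaved primitive ideals; (6) every closed ideal of $\ell^1(\Sigma)$ is the intersection of primitive ideals; (7) $\Sigma$ is free. In that case, if $I$ is a closed ideal of $\ell^1(\Sigma)$, and $S\subset X$ is such that $h(E(I))=\overline{\bigcup_{x\in S}\mathbb Z\cdot x}$, then $I=\bigcap_{x\in S}P_x$, which establishes $I$ explicitly as an intersection as in part (5).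
   Context: $C(X)$ is the algebra of continuous complex functions on $X$ with supremum norm, and $\alpha(f)=f\circ\sigma^{-1}$ for $f\in C(X)$. $\ell^1(\Sigma)$ is the set of maps $a:\mathbb Z\to C(X)$ with $\|a\|=\sum_n\|a(n)\|<\infty$, with product $(aa')(n)=\sum_{k\in\mathbb Z}a(k)\,\alpha^k(a'(n-k))$ and involution $a^*(n)=\overline{\alpha^n(a(-n))}$; it is a unital Banach $*$-algebra with isometric involution. Let $\delta$ be the element with value $1$ at $1$ and $0$ elsewhere, and identify $C(X)$ with the elements supported at $0$. Each $a\in\ell^1(\Sigma)$ is uniquely a norm convergent sum $a=\sum_n a_n\delta^n$ with $a_n=a(n)\in C(X)$. Ideals are two-sided; an empty intersection of ideals is $\ell^1(\Sigma)$. A subset $S\subset X$ is $\sigma$-invariant if $\sigma(S)=S$; $\mathbb Z\cdot x$ is the orbit of $x$. $\Sigma$ is free if $\sigma$ has no periodic points. $E:\ell^1(\Sigma)\to C(X)$ is $E(a)=a_0$. An ideal $I$ of $\ell^1(\Sigma)$ is well behaved if $E(I)\subset I$. For an ideal $J$ of $C(X)$, $h(J)=\{x\in X: f(x)=0\ \forall f\in J\}$. For an ideal $I$ of $\ell^1(\Sigma)$, $\mathcal H(I)=\{x\in X: a_n(x)=0\text{ for all }a=\sum_n a_n\delta^n\in I\text{ and all }n\in\mathbb Z\}$. For $S\subset X$, $\mathcal K(S)=\{a=\sum_n a_n\delta^n\in\ell^1(\Sigma): a_n|_S=0\ \forall n\in\mathbb Z\}$, with $\mathcal K(\emptyset)=\ell^1(\Sigma)$.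 A primitive ideal of $\ell^1(\Sigma)$ is the kernel of a topologically irreducible unital involutive representation of $\ell^1(\Sigma)$ on a Hilbert space. For an aperiodic point $x$, $P_x=\ker\pi_x$, where $\pi_x$ is the involutive representation on a Hilbert space with orthonormal basis $(e_k)_{k\in\mathbb Z}$ given by $\pi_x(\delta)e_k=e_{k+1}$, $\pi_x(f)e_k=f(\sigma^kx)e_k$ $(f\in C(X))$. *)

theory Defs
  imports "HOL-Analysis.Analysis"
begin

section \<open>The algebra \<open>C(X)\<close>\<close>

text \<open>On a compact space every continuous function is bounded, so the library type
  \<^typ>\<open>'x \<Rightarrow>\<^sub>C complex\<close> with its supremum norm is the Banach space \<open>C(X)\<close>.  The library states
  completeness for metric domains only; compact Hausdorff spaces need the topological case.\<close>

instance bcontfun :: (topological_space, complete_space) complete_space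
proof
  fix f :: "nat \<Rightarrow> ('a, 'b) bcontfun"
  assume "Cauchy f"
  have "uniformly_Cauchy_on UNIV (\<lambda>n. apply_bcontfun (f n))"
  proof (rule uniformly_Cauchy_onI)
    fix e :: real assume "0 < e"
    then obtain M where "\<forall>m\<ge>M. \<forall>n\<ge>M. dist (f m) (f n) < e"
      using \<open>Cauchy f\<close> unfolding Cauchy_def by blast
    then show "\<exists>M. \<forall>x\<in>UNIV. \<forall>m\<ge>M. \<forall>n\<ge>M. dist (f m x) (f n x) < e"
      by (auto intro!: exI[of _ M] dist_fun_lt_imp_dist_val_lt)
  qed
  then have "uniformly_convergent_on UNIV (\<lambda>n. apply_bcontfun (f n))"
    by (rule Cauchy_uniformly_convergent)
  then obtain g where "uniform_limit UNIV f g sequentially"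
    unfolding uniformly_convergent_on_def ..
  then obtain l where "f \<longlonglongrightarrow> l"
    using uniform_limit_bcontfunE[OF _ sequentially_bot] by blast
  then show "convergent f" by (rule convergentI)
qed

instance bcontfun :: (topological_space, banach) banach ..

definition bc_mult ::
  "('x::topological_space \<Rightarrow>\<^sub>C complex) \<Rightarrow> ('x \<Rightarrow>\<^sub>C complex) \<Rightarrow> ('x \<Rightarrow>\<^sub>C complex)"
  where "bc_mult f g = Bcontfun (\<lambda>x. f x * g x)"

definition bc_cnj :: "('x::topological_space \<Rightarrow>\<^sub>C complex) \<Rightarrow> ('x \<Rightarrow>\<^sub>C complex)"
  where "bc_cnj f = Bcontfun (\<lambda>x. cnj (f x))"

lemma bc_mult_apply [simp]: "bc_mult f g x = f x * g x"
proof -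
  have "(\<lambda>x. f x * g x) \<in> bcontfun"
    by (rule bcontfun_normI[where b = "norm f * norm g"])
      (simp_all add: continuous_on_mult norm_mult mult_mono norm_bounded)
  then show ?thesis by (simp add: bc_mult_def Bcontfun_inverse)
qed

lemma bc_cnj_apply [simp]: "bc_cnj f x = cnj (f x)"
proof -
  have "(\<lambda>x. cnj (f x)) \<in> bcontfun"
    by (rule bcontfun_normI[where b = "norm f"]) (simp_all add: continuous_on_cnj norm_bounded)
  then show ?thesis by (simp add: bc_cnj_def Bcontfun_inverse)
qed

lemma norm_bc_mult_le: "norm (bc_mult f g) \<le> norm f * norm g"
  by (rule norm_bound) (simp add: norm_mult mult_mono norm_bounded)

lemma norm_bc_mult_const [simp]: "norm (bc_mult (const_bcontfun c) f) = cmod c * norm f"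
proof (rule antisym)
  show "norm (bc_mult (const_bcontfun c) f) \<le> cmod c * norm f"
    by (rule norm_bound) (simp add: norm_mult mult_left_mono norm_bounded)
  show "cmod c * norm f \<le> norm (bc_mult (const_bcontfun c) f)"
  proof (cases "c = 0")
    case False
    have "norm f \<le> norm (bc_mult (const_bcontfun c) f) / cmod c"
    proof (rule norm_bound)
      fix x
      have "cmod c * cmod (f x) \<le> norm (bc_mult (const_bcontfun c) f)"
        using norm_bounded[of "bc_mult (const_bcontfun c) f" x] by (simp add: norm_mult)
      then show "norm (f x) \<le> norm (bc_mult (const_bcontfun c) f) / cmod c"
        using False by (simp add: field_simps)
    qed
    then show ?thesis using False by (simp add: field_simps)
  qed simp
qed

lemma norm_bc_cnj [simp]: "norm (bc_cnj f) = norm f"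
proof -
  have le: "norm (bc_cnj g) \<le> norm g" for g :: "'a \<Rightarrow>\<^sub>C complex"
    by (rule norm_bound) (simp add: norm_bounded)
  have "bc_cnj (bc_cnj f) = f" by (rule bcontfun_eqI) simp
  then show ?thesis using le[of f] le[of "bc_cnj f"] by simp
qed


section \<open>The dynamics\<close>

definition int_iter :: "('x \<Rightarrow> 'x) \<Rightarrow> int \<Rightarrow> 'x \<Rightarrow> 'x"
  where "int_iter \<sigma> k = (if 0 \<le> k then \<sigma> ^^ nat k else inv \<sigma> ^^ nat (- k))"

definition int_orbit :: "('x \<Rightarrow> 'x) \<Rightarrow> 'x \<Rightarrow> 'x set"
  where "int_orbit \<sigma> x = range (\<lambda>k. int_iter \<sigma> k x)"

definition free_system :: "('x \<Rightarrow> 'x) \<Rightarrow> bool"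
  where "free_system \<sigma> \<longleftrightarrow> (\<nexists>x. \<exists>n>0. (\<sigma> ^^ n) x = x)"

text \<open>The automorphism \<open>\<alpha>\<^sup>k\<close> of \<open>C(X)\<close>, that is \<open>f \<mapsto> f \<circ> \<sigma>\<^sup>-\<^sup>k\<close>.\<close>

definition alpha_pow ::
  "('x \<Rightarrow> 'x) \<Rightarrow> int \<Rightarrow> ('x::topological_space \<Rightarrow>\<^sub>C complex) \<Rightarrow> ('x \<Rightarrow>\<^sub>C complex)"
  where "alpha_pow \<sigma> k f = Bcontfun (\<lambda>x. f (int_iter \<sigma> (- k) x))"

lemma continuous_on_funpow:
  fixes f :: "'x::topological_space \<Rightarrow> 'x"
  assumes "continuous_on UNIV f"
  shows "continuous_on UNIV (f ^^ n)"
proof (induction n)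
  case (Suc n)
  then show ?case
    using continuous_on_compose2[OF assms Suc] by (simp add: o_def)
qed (simp add: id_def)

lemma continuous_on_int_iter:
  assumes "homeomorphism UNIV UNIV \<sigma> (inv \<sigma>)"
  shows "continuous_on UNIV (int_iter \<sigma> k)"
  using assms by (auto simp: int_iter_def homeomorphism_def intro!: continuous_on_funpow)

lemma alpha_pow_apply:
  assumes "homeomorphism UNIV UNIV \<sigma> (inv \<sigma>)"
  shows "alpha_pow \<sigma> k f x = f (int_iter \<sigma> (- k) x)"
proof -
  have "continuous_on UNIV (\<lambda>x. f (int_iter \<sigma> (- k) x))"
    using continuous_on_compose2[OF continuous_on_apply_bcontfun[of UNIV f]
        continuous_on_int_iter[OF assms, of "- k"]] by simp
  then have "(\<lambda>x. f (int_iter \<sigma> (- k) x)) \<in> bcontfun"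
    by (rule bcontfun_normI[where b = "norm f"]) (rule norm_bounded)
  then show ?thesis by (simp add: alpha_pow_def Bcontfun_inverse)
qed

lemma norm_alpha_pow_le:
  assumes "homeomorphism UNIV UNIV \<sigma> (inv \<sigma>)"
  shows "norm (alpha_pow \<sigma> k f) \<le> norm f"
  by (rule norm_bound) (simp add: alpha_pow_apply[OF assms] norm_bounded)


section \<open>The Banach algebra \<open>\<ell>\<^sup>1(\<Sigma>)\<close>\<close>

typedef (overloaded) 'x ell1 =
  "{a :: int \<Rightarrow> ('x::topological_space \<Rightarrow>\<^sub>C complex). (\<lambda>n. norm (a n)) summable_on UNIV}"
  morphisms ell1_coeff Abs_ell1
  by (rule exI[of _ "\<lambda>_. 0"]) simp

setup_lifting type_definition_ell1

lemma ell1_eqI: "(\<And>n. ell1_coeff a n = ell1_coeff b n) \<Longrightarrow> a = b"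
  by (metis ell1_coeff_inject ext)

lemma ell1_coeff_summable: "(\<lambda>n. norm (ell1_coeff a n)) summable_on UNIV"
  using ell1_coeff[of a] by simp

instantiation ell1 :: (topological_space) real_vector
begin

lift_definition zero_ell1 :: "'a ell1" is "\<lambda>_. 0" by simp

lift_definition plus_ell1 :: "'a ell1 \<Rightarrow> 'a ell1 \<Rightarrow> 'a ell1" is "\<lambda>a b n. a n + b n"
proof -
  fix a b :: "int \<Rightarrow> ('a \<Rightarrow>\<^sub>C complex)"
  assume "(\<lambda>n. norm (a n)) summable_on UNIV" "(\<lambda>n. norm (b n)) summable_on UNIV"
  then have "(\<lambda>n. norm (a n) + norm (b n)) summable_on UNIV" by (rule summable_on_add)
  then show "(\<lambda>n. norm (a n + b n)) summable_on UNIV"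
    by (rule Infinite_Sum.abs_summable_on_comparison_test') (rule norm_triangle_ineq)
qed

lift_definition uminus_ell1 :: "'a ell1 \<Rightarrow> 'a ell1" is "\<lambda>a n. - a n" by simp

lift_definition minus_ell1 :: "'a ell1 \<Rightarrow> 'a ell1 \<Rightarrow> 'a ell1" is "\<lambda>a b n. a n - b n"
proof -
  fix a b :: "int \<Rightarrow> ('a \<Rightarrow>\<^sub>C complex)"
  assume "(\<lambda>n. norm (a n)) summable_on UNIV" "(\<lambda>n. norm (b n)) summable_on UNIV"
  then have "(\<lambda>n. norm (a n) + norm (b n)) summable_on UNIV" by (rule summable_on_add)
  then show "(\<lambda>n. norm (a n - b n)) summable_on UNIV"
    by (rule Infinite_Sum.abs_summable_on_comparison_test') (rule norm_triangle_ineq4)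
qed

lift_definition scaleR_ell1 :: "real \<Rightarrow> 'a ell1 \<Rightarrow> 'a ell1" is "\<lambda>r a n. r *\<^sub>R a n"
  by (auto intro: summable_on_cmult_right)

instance
  by standard (transfer; simp add: algebra_simps fun_eq_iff)+

end

instantiation ell1 :: (topological_space) real_normed_vector
begin

definition norm_ell1 :: "'a ell1 \<Rightarrow> real"
  where "norm_ell1 a = (\<Sum>\<^sub>\<infinity>n. norm (ell1_coeff a n))"

definition dist_ell1 :: "'a ell1 \<Rightarrow> 'a ell1 \<Rightarrow> real"
  where "dist_ell1 a b = norm (a - b)"

definition sgn_ell1 :: "'a ell1 \<Rightarrow> 'a ell1"
  where "sgn_ell1 a = a /\<^sub>R norm a"

definition uniformity_ell1 :: "('a ell1 \<times> 'a ell1) filter"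
  where "uniformity_ell1 = (INF e\<in>{0 <..}. principal {(a, b). dist a b < e})"

definition open_ell1 :: "'a ell1 set \<Rightarrow> bool"
  where "open_ell1 U \<longleftrightarrow> (\<forall>a\<in>U. eventually (\<lambda>(a', b). a' = a \<longrightarrow> b \<in> U) uniformity)"

instance
proof
  fix r :: real and a b :: "'a ell1"
  show "(norm a = 0) = (a = 0)"
  proof
    assume "norm a = 0"
    then have "\<forall>n\<in>UNIV. norm (ell1_coeff a n) = 0"
      using nonneg_infsum_le_0D[OF _ ell1_coeff_summable[of a]] by (simp add: norm_ell1_def)
    then show "a = 0" by (intro ell1_eqI) (simp add: zero_ell1.rep_eq)
  qed (simp add: norm_ell1_def zero_ell1.rep_eq)
  have "norm (a + b) \<le> (\<Sum>\<^sub>\<infinity>n. norm (ell1_coeff a n) + norm (ell1_coeff b n))"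
    unfolding norm_ell1_def
    by (rule infsum_mono[OF ell1_coeff_summable summable_on_add[OF ell1_coeff_summable ell1_coeff_summable]])
      (simp add: plus_ell1.rep_eq norm_triangle_ineq)
  also have "\<dots> = norm a + norm b"
    unfolding norm_ell1_def by (rule infsum_add[OF ell1_coeff_summable ell1_coeff_summable])
  finally show "norm (a + b) \<le> norm a + norm b" .
  show "norm (r *\<^sub>R a) = \<bar>r\<bar> * norm a"
    by (simp add: norm_ell1_def scaleR_ell1.rep_eq infsum_cmult_right')
qed (auto simp: dist_ell1_def sgn_ell1_def uniformity_ell1_def open_ell1_def)

end

text \<open>The complex scalar multiplication; \<^const>\<open>scaleR\<close> is its restriction to the reals.\<close>

lift_definition ell1_scaleC :: "complex \<Rightarrow> 'x::topological_space ell1 \<Rightarrow> 'x ell1"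
  is "\<lambda>c a n. bc_mult (const_bcontfun c) (a n)"
  by (auto intro: summable_on_cmult_right)

text \<open>The element \<open>f \<delta>\<^sup>n\<close>.\<close>

lift_definition ell1_single :: "int \<Rightarrow> ('x::topological_space \<Rightarrow>\<^sub>C complex) \<Rightarrow> 'x ell1"
  is "\<lambda>n f m. if m = n then f else 0"
proof -
  fix n :: int and f :: "'x \<Rightarrow>\<^sub>C complex"
  have "(\<lambda>m. norm (if m = n then f else 0)) summable_on {n}" by simp
  then show "(\<lambda>m. norm (if m = n then f else 0)) summable_on UNIV"
    by (subst summable_on_cong_neutral[of "{n}" UNIV]) auto
qed

definition ell1_of_C :: "('x::topological_space \<Rightarrow>\<^sub>C complex) \<Rightarrow> 'x ell1"
  where "ell1_of_C f = ell1_single 0 f"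

definition ell1_one :: "'x::topological_space ell1"
  where "ell1_one = ell1_of_C (const_bcontfun 1)"

definition ell1_delta :: "'x::topological_space ell1"
  where "ell1_delta = ell1_single 1 (const_bcontfun 1)"

definition ell1_mult ::
  "('x \<Rightarrow> 'x) \<Rightarrow> 'x::topological_space ell1 \<Rightarrow> 'x ell1 \<Rightarrow> 'x ell1"
  where "ell1_mult \<sigma> a b =
    Abs_ell1 (\<lambda>n. \<Sum>\<^sub>\<infinity>k. bc_mult (ell1_coeff a k) (alpha_pow \<sigma> k (ell1_coeff b (n - k))))"

definition ell1_star :: "('x \<Rightarrow> 'x) \<Rightarrow> 'x::topological_space ell1 \<Rightarrow> 'x ell1"
  where "ell1_star \<sigma> a = Abs_ell1 (\<lambda>n. bc_cnj (alpha_pow \<sigma> n (ell1_coeff a (- n))))"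

text \<open>For a homeomorphism \<open>\<sigma>\<close> the defining families of product and involution are in \<open>\<ell>\<^sup>1\<close>, and
  the sums in the product converge absolutely in \<open>C(X)\<close>.\<close>

lemma ell1_mult_terms:
  assumes "homeomorphism UNIV UNIV \<sigma> (inv \<sigma>)"
  shows "(\<lambda>(n, k). norm (bc_mult (ell1_coeff a k) (alpha_pow \<sigma> k (ell1_coeff b (n - k))))) summable_on UNIV"
proof -
  have sig: "(\<lambda>(k, m). norm (ell1_coeff a k) * norm (ell1_coeff b m)) summable_on (UNIV \<times> UNIV)"
  proof (rule summable_on_SigmaI[where g = "\<lambda>k. norm (ell1_coeff a k) * norm b"])
    fix k
    have "((\<lambda>m. norm (ell1_coeff b m)) has_sum norm b) UNIV"
      unfolding norm_ell1_def using ell1_coeff_summable by (rule has_sum_infsum)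
    from has_sum_cmult_right[OF this, of "norm (ell1_coeff a k)"]
    show "((\<lambda>m. case (k, m) of (k, m) \<Rightarrow> norm (ell1_coeff a k) * norm (ell1_coeff b m))
      has_sum norm (ell1_coeff a k) * norm b) UNIV" by simp
    show "(\<lambda>k. norm (ell1_coeff a k) * norm b) summable_on UNIV"
      using ell1_coeff_summable by (rule summable_on_cmult_left)
  qed simp
  have "bij_betw (\<lambda>(n, k). (k, n - k)) UNIV (UNIV :: (int \<times> int) set)"
    by (rule bij_betwI[where g = "\<lambda>(k, m). (k + m, k)"]) auto
  from summable_on_reindex_bij_betw[OF this, of "\<lambda>(k, m). norm (ell1_coeff a k) * norm (ell1_coeff b m)"] sig
  have "(\<lambda>(n, k). norm (ell1_coeff a k) * norm (ell1_coeff b (n - k))) summable_on UNIV"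
    by (simp add: case_prod_unfold)
  then have sum: "(\<lambda>p. norm (ell1_coeff a (snd p)) * norm (ell1_coeff b (fst p - snd p)))
      summable_on UNIV"
    by (simp add: case_prod_unfold)
  have "norm (bc_mult (ell1_coeff a (snd p)) (alpha_pow \<sigma> (snd p) (ell1_coeff b (fst p - snd p))))
      \<le> norm (ell1_coeff a (snd p)) * norm (ell1_coeff b (fst p - snd p))" for p
    using order_trans[OF norm_bc_mult_le mult_left_mono[OF norm_alpha_pow_le[OF assms] norm_ge_zero]] .
  with sum show ?thesis
    unfolding case_prod_unfold by (rule Infinite_Sum.abs_summable_on_comparison_test')
qed

lemma ell1_mult_sum:
  assumes "homeomorphism UNIV UNIV \<sigma> (inv \<sigma>)"
  shows "((\<lambda>k. bc_mult (ell1_coeff a k) (alpha_pow \<sigma> k (ell1_coeff b (n - k))))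
    has_sum ell1_coeff (ell1_mult \<sigma> a b) n) UNIV"
proof -
  define t where "t n k = bc_mult (ell1_coeff a k) (alpha_pow \<sigma> k (ell1_coeff b (n - k)))" for n k
  have all: "(\<lambda>p. norm (case p of (n, k) \<Rightarrow> t n k)) summable_on (UNIV \<times> UNIV)"
    using ell1_mult_terms[OF assms, of a b] by (simp add: case_prod_unfold t_def)
  have row: "(\<lambda>k. norm (t n k)) summable_on UNIV" for n
    using all unfolding Infinite_Sum.abs_summable_on_Sigma_iff by simp
  have tot: "(\<lambda>n. norm (\<Sum>\<^sub>\<infinity>k. norm (t n k))) summable_on UNIV"
    using all unfolding Infinite_Sum.abs_summable_on_Sigma_iff by simp
  have "(\<lambda>n. norm (\<Sum>\<^sub>\<infinity>k. t n k)) summable_on UNIV"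
    by (rule Infinite_Sum.abs_summable_on_comparison_test'[OF tot])
      (use norm_infsum_bound[OF row] in \<open>simp add: infsum_nonneg\<close>)
  then have "ell1_coeff (ell1_mult \<sigma> a b) n = (\<Sum>\<^sub>\<infinity>k. t n k)"
    by (simp add: ell1_mult_def Abs_ell1_inverse t_def)
  moreover have "t n summable_on UNIV"
    using row by (rule abs_summable_summable)
  ultimately show ?thesis
    using has_sum_infsum[of "t n" UNIV] unfolding t_def by simp
qed

lemma coeff_ell1_star:
  assumes "homeomorphism UNIV UNIV \<sigma> (inv \<sigma>)"
  shows "ell1_coeff (ell1_star \<sigma> a) n = bc_cnj (alpha_pow \<sigma> n (ell1_coeff a (- n)))"
proof -
  have "bij (uminus :: int \<Rightarrow> int)" by (rule bij_uminus)
  from summable_on_reindex_bij_betw[OF this, of "\<lambda>n. norm (ell1_coeff a n)"] ell1_coeff_summable[of a]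
  have "(\<lambda>n. norm (ell1_coeff a (- n))) summable_on UNIV" by simp
  then have "(\<lambda>n. norm (bc_cnj (alpha_pow \<sigma> n (ell1_coeff a (- n))))) summable_on UNIV"
    by (rule Infinite_Sum.abs_summable_on_comparison_test') (simp add: norm_alpha_pow_le[OF assms])
  then show ?thesis by (simp add: ell1_star_def Abs_ell1_inverse)
qed


section \<open>Ideals, hulls and kernels\<close>

definition ell1_ideal :: "('x \<Rightarrow> 'x) \<Rightarrow> 'x::topological_space ell1 set \<Rightarrow> bool"
  where "ell1_ideal \<sigma> I \<longleftrightarrow>
    0 \<in> I \<and> (\<forall>a\<in>I. \<forall>b\<in>I. a + b \<in> I) \<and> (\<forall>c. \<forall>a\<in>I. ell1_scaleC c a \<in> I) \<and>
    (\<forall>a\<in>I. \<forall>b. ell1_mult \<sigma> b a \<in> I \<and> ell1_mult \<sigma> a b \<in> I)"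

definition closed_ideal :: "('x \<Rightarrow> 'x) \<Rightarrow> 'x::topological_space ell1 set \<Rightarrow> bool"
  where "closed_ideal \<sigma> I \<longleftrightarrow> ell1_ideal \<sigma> I \<and> closed I"

definition self_adjoint_ideal :: "('x \<Rightarrow> 'x) \<Rightarrow> 'x::topological_space ell1 set \<Rightarrow> bool"
  where "self_adjoint_ideal \<sigma> I \<longleftrightarrow> ell1_star \<sigma> ` I = I"

definition ell1_E :: "'x::topological_space ell1 \<Rightarrow> ('x \<Rightarrow>\<^sub>C complex)"
  where "ell1_E a = ell1_coeff a 0"

definition well_behaved :: "'x::topological_space ell1 set \<Rightarrow> bool"
  where "well_behaved I \<longleftrightarrow> ell1_of_C ` ell1_E ` I \<subseteq> I"

definition C_hull :: "('x::topological_space \<Rightarrow>\<^sub>C complex) set \<Rightarrow> 'x set"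
  where "C_hull J = {x. \<forall>f\<in>J. f x = 0}"

definition ell1_hull :: "'x::topological_space ell1 set \<Rightarrow> 'x set"
  where "ell1_hull I = {x. \<forall>a\<in>I. \<forall>n. ell1_coeff a n x = 0}"

definition ell1_kernel :: "'x set \<Rightarrow> 'x::topological_space ell1 set"
  where "ell1_kernel S = {a. \<forall>n. \<forall>x\<in>S. ell1_coeff a n x = 0}"

definition invariant_closed :: "('x \<Rightarrow> 'x) \<Rightarrow> 'x::topological_space set \<Rightarrow> bool"
  where "invariant_closed \<sigma> S \<longleftrightarrow> closed S \<and> \<sigma> ` S = S"


section \<open>Hilbert spaces and representations\<close>

text \<open>Complex Hilbert spaces with explicit carriers, so that statements can quantify over all
  Hilbert spaces with carrier in a given type.  Inner products are linear in the first argument.\<close>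

record 'h hspace =
  hcarrier :: "'h set"
  hzero :: 'h
  hadd :: "'h \<Rightarrow> 'h \<Rightarrow> 'h"
  hscale :: "complex \<Rightarrow> 'h \<Rightarrow> 'h"
  hinner :: "'h \<Rightarrow> 'h \<Rightarrow> complex"

definition hnorm :: "'h hspace \<Rightarrow> 'h \<Rightarrow> real"
  where "hnorm H v = sqrt (Re (hinner H v v))"

definition hdist :: "'h hspace \<Rightarrow> 'h \<Rightarrow> 'h \<Rightarrow> real"
  where "hdist H v w = hnorm H (hadd H v (hscale H (- 1) w))"

locale complex_hilbert_space =
  fixes H :: "'h hspace"
  assumes zero_closed [simp]: "hzero H \<in> hcarrier H"
    and add_closed [simp]: "\<lbrakk>v \<in> hcarrier H; w \<in> hcarrier H\<rbrakk> \<Longrightarrow> hadd H v w \<in> hcarrier H"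
    and scale_closed [simp]: "v \<in> hcarrier H \<Longrightarrow> hscale H c v \<in> hcarrier H"
    and add_assoc: "\<lbrakk>u \<in> hcarrier H; v \<in> hcarrier H; w \<in> hcarrier H\<rbrakk>
      \<Longrightarrow> hadd H (hadd H u v) w = hadd H u (hadd H v w)"
    and add_commute: "\<lbrakk>v \<in> hcarrier H; w \<in> hcarrier H\<rbrakk> \<Longrightarrow> hadd H v w = hadd H w v"
    and add_zero: "v \<in> hcarrier H \<Longrightarrow> hadd H v (hzero H) = v"
    and add_neg: "v \<in> hcarrier H \<Longrightarrow> hadd H v (hscale H (- 1) v) = hzero H"
    and scale_add_right: "\<lbrakk>v \<in> hcarrier H; w \<in> hcarrier H\<rbrakk>
      \<Longrightarrow> hscale H c (hadd H v w) = hadd H (hscale H c v) (hscale H c w)"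
    and scale_add_left: "v \<in> hcarrier H
      \<Longrightarrow> hscale H (c + d) v = hadd H (hscale H c v) (hscale H d v)"
    and scale_scale: "v \<in> hcarrier H \<Longrightarrow> hscale H c (hscale H d v) = hscale H (c * d) v"
    and scale_one: "v \<in> hcarrier H \<Longrightarrow> hscale H 1 v = v"
    and inner_add_left: "\<lbrakk>u \<in> hcarrier H; v \<in> hcarrier H; w \<in> hcarrier H\<rbrakk>
      \<Longrightarrow> hinner H (hadd H u v) w = hinner H u w + hinner H v w"
    and inner_scale_left: "\<lbrakk>v \<in> hcarrier H; w \<in> hcarrier H\<rbrakk>
      \<Longrightarrow> hinner H (hscale H c v) w = c * hinner H v w"
    and inner_cnj: "\<lbrakk>v \<in> hcarrier H; w \<in> hcarrier H\<rbrakk> \<Longrightarrow> hinner H v w = cnj (hinner H w v)"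
    and inner_nonneg: "v \<in> hcarrier H \<Longrightarrow> 0 \<le> Re (hinner H v v)"
    and inner_definite: "\<lbrakk>v \<in> hcarrier H; hinner H v v = 0\<rbrakk> \<Longrightarrow> v = hzero H"
    and complete: "\<lbrakk>\<forall>n. s n \<in> hcarrier H;
        \<forall>e>0. \<exists>N::nat. \<forall>m\<ge>N. \<forall>n\<ge>N. hdist H (s m) (s n) < e\<rbrakk>
      \<Longrightarrow> \<exists>v\<in>hcarrier H. (\<lambda>n. hdist H (s n) v) \<longlonglongrightarrow> 0"

definition bounded_operator :: "'h hspace \<Rightarrow> ('h \<Rightarrow> 'h) \<Rightarrow> bool"
  where "bounded_operator H T \<longleftrightarrow>
    (\<forall>v\<in>hcarrier H. T v \<in> hcarrier H) \<and>
    (\<forall>v\<in>hcarrier H. \<forall>w\<in>hcarrier H. T (hadd H v w) = hadd H (T v) (T w)) \<and>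
    (\<forall>c. \<forall>v\<in>hcarrier H. T (hscale H c v) = hscale H c (T v)) \<and>
    (\<exists>C. \<forall>v\<in>hcarrier H. hnorm H (T v) \<le> C * hnorm H v)"

definition closed_subspace :: "'h hspace \<Rightarrow> 'h set \<Rightarrow> bool"
  where "closed_subspace H M \<longleftrightarrow>
    M \<subseteq> hcarrier H \<and> hzero H \<in> M \<and>
    (\<forall>v\<in>M. \<forall>w\<in>M. hadd H v w \<in> M) \<and> (\<forall>c. \<forall>v\<in>M. hscale H c v \<in> M) \<and>
    (\<forall>s. \<forall>v\<in>hcarrier H.
      (\<forall>n::nat. s n \<in> M) \<and> (\<lambda>n. hdist H (s n) v) \<longlonglongrightarrow> 0 \<longrightarrow> v \<in> M)"

text \<open>Unital involutive representations of \<open>\<ell>\<^sup>1(\<Sigma>)\<close>; operators matter on the carrier only.\<close>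

definition unital_star_rep ::
  "('x \<Rightarrow> 'x) \<Rightarrow> 'h hspace \<Rightarrow> ('x::topological_space ell1 \<Rightarrow> 'h \<Rightarrow> 'h) \<Rightarrow> bool"
  where "unital_star_rep \<sigma> H \<pi> \<longleftrightarrow>
    complex_hilbert_space H \<and>
    (\<forall>a. bounded_operator H (\<pi> a)) \<and>
    (\<forall>a b. \<forall>v\<in>hcarrier H. \<pi> (a + b) v = hadd H (\<pi> a v) (\<pi> b v)) \<and>
    (\<forall>c a. \<forall>v\<in>hcarrier H. \<pi> (ell1_scaleC c a) v = hscale H c (\<pi> a v)) \<and>
    (\<forall>a b. \<forall>v\<in>hcarrier H. \<pi> (ell1_mult \<sigma> a b) v = \<pi> a (\<pi> b v)) \<and>
    (\<forall>a. \<forall>v\<in>hcarrier H. \<forall>w\<in>hcarrier H.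
      hinner H (\<pi> a v) w = hinner H v (\<pi> (ell1_star \<sigma> a) w)) \<and>
    (\<forall>v\<in>hcarrier H. \<pi> ell1_one v = v)"

definition top_irreducible :: "'h hspace \<Rightarrow> ('a \<Rightarrow> 'h \<Rightarrow> 'h) \<Rightarrow> bool"
  where "top_irreducible H \<pi> \<longleftrightarrow>
    hcarrier H \<noteq> {hzero H} \<and>
    (\<forall>M. closed_subspace H M \<and> (\<forall>a. \<forall>v\<in>M. \<pi> a v \<in> M) \<longrightarrow>
      M = {hzero H} \<or> M = hcarrier H)"

definition rep_kernel :: "'h hspace \<Rightarrow> ('a \<Rightarrow> 'h \<Rightarrow> 'h) \<Rightarrow> 'a set"
  where "rep_kernel H \<pi> = {a. \<forall>v\<in>hcarrier H. \<pi> a v = hzero H}"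

text \<open>HOL cannot quantify over the type of the Hilbert space.  Carriers in
  \<^typ>\<open>nat \<Rightarrow> 'x ell1\<close> suffice: by the lemma \<open>primitive_idealI\<close> below, the kernel of a topologically
  irreducible representation on a Hilbert space with carrier in any type is primitive in the
  sense of this definition.\<close>

definition primitive_ideal :: "('x \<Rightarrow> 'x) \<Rightarrow> 'x::topological_space ell1 set \<Rightarrow> bool"
  where "primitive_ideal \<sigma> P \<longleftrightarrow>
    (\<exists>(H :: (nat \<Rightarrow> 'x ell1) hspace) \<pi>.
      unital_star_rep \<sigma> H \<pi> \<and> top_irreducible H \<pi> \<and> P = rep_kernel H \<pi>)"

context complex_hilbert_space
begin

lemma inner_add_right:
  "\<lbrakk>u \<in> hcarrier H; v \<in> hcarrier H; w \<in> hcarrier H\<rbrakk>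
    \<Longrightarrow> hinner H w (hadd H u v) = hinner H w u + hinner H w v"
  using inner_cnj[of w "hadd H u v"] inner_cnj[of w u] inner_cnj[of w v]
  by (simp add: inner_add_left)

lemma inner_scale_right:
  "\<lbrakk>v \<in> hcarrier H; w \<in> hcarrier H\<rbrakk> \<Longrightarrow> hinner H w (hscale H c v) = cnj c * hinner H w v"
  using inner_cnj[of w "hscale H c v"] inner_cnj[of w v] by (simp add: inner_scale_left)

lemma Re_inner_commute:
  "\<lbrakk>v \<in> hcarrier H; w \<in> hcarrier H\<rbrakk> \<Longrightarrow> Re (hinner H v w) = Re (hinner H w v)"
  using arg_cong[OF inner_cnj[of v w], of Re] by simp

lemma hdist_nonneg: "\<lbrakk>v \<in> hcarrier H; w \<in> hcarrier H\<rbrakk> \<Longrightarrow> 0 \<le> hdist H v w"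
  by (simp add: hdist_def hnorm_def inner_nonneg)

lemma hdist_sq:
  assumes "v \<in> hcarrier H" "w \<in> hcarrier H"
  shows "(hdist H v w)\<^sup>2 = Re (hinner H v v) + Re (hinner H w w) - 2 * Re (hinner H v w)"
proof -
  have "(hdist H v w)\<^sup>2 = Re (hinner H (hadd H v (hscale H (- 1) w)) (hadd H v (hscale H (- 1) w)))"
    using assms by (simp add: hdist_def hnorm_def inner_nonneg)
  then show ?thesis
    using Re_inner_commute[OF assms]
    by (simp add: assms inner_add_left inner_add_right inner_scale_left inner_scale_right)
qed

lemma hdist_commute:
  assumes "v \<in> hcarrier H" "w \<in> hcarrier H"
  shows "hdist H v w = hdist H w v"
proof (rule power2_eq_imp_eq)
  show "(hdist H v w)\<^sup>2 = (hdist H w v)\<^sup>2"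
    using Re_inner_commute[OF assms] by (simp add: hdist_sq assms)
qed (simp_all add: hdist_nonneg assms)

lemma hdist_sq_triangle:
  assumes "u \<in> hcarrier H" "v \<in> hcarrier H" "w \<in> hcarrier H"
  shows "(hdist H u w)\<^sup>2 \<le> 2 * (hdist H u v)\<^sup>2 + 2 * (hdist H v w)\<^sup>2"
proof -
  let ?z = "hadd H (hadd H u (hscale H (- 2) v)) w"
  have "0 \<le> Re (hinner H ?z ?z)" using assms by (intro inner_nonneg) simp
  then show ?thesis
    using Re_inner_commute[OF assms(1,2)] Re_inner_commute[OF assms(1,3)]
      Re_inner_commute[OF assms(2,3)]
    by (simp add: assms hdist_sq inner_add_left inner_add_right inner_scale_left inner_scale_right)
qed

lemma hdist_sq_add:
  assumes "u \<in> hcarrier H" "u' \<in> hcarrier H" "w \<in> hcarrier H" "w' \<in> hcarrier H"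
  shows "(hdist H (hadd H u u') (hadd H w w'))\<^sup>2 \<le> 2 * (hdist H u w)\<^sup>2 + 2 * (hdist H u' w')\<^sup>2"
proof -
  let ?z = "hadd H (hadd H u (hscale H (- 1) w)) (hadd H w' (hscale H (- 1) u'))"
  have "0 \<le> Re (hinner H ?z ?z)" using assms by (intro inner_nonneg) simp
  then show ?thesis
    using Re_inner_commute[OF assms(1,2)] Re_inner_commute[OF assms(1,3)]
      Re_inner_commute[OF assms(1,4)] Re_inner_commute[OF assms(2,3)]
      Re_inner_commute[OF assms(2,4)] Re_inner_commute[OF assms(3,4)]
    by (simp add: assms hdist_sq inner_add_left inner_add_right inner_scale_left inner_scale_right)
qed

lemma hdist_self: "v \<in> hcarrier H \<Longrightarrow> hdist H v v = 0"
  using hdist_sq[of v v] by simp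

lemma hdist_eq_0D:
  assumes "v \<in> hcarrier H" "w \<in> hcarrier H" "hdist H v w = 0"
  shows "v = w"
proof -
  let ?d = "hadd H v (hscale H (- 1) w)"
  have "Re (hinner H ?d ?d) = 0" using assms by (simp add: hdist_def hnorm_def)
  moreover have "Im (hinner H ?d ?d) = Im (cnj (hinner H ?d ?d))"
    by (rule arg_cong[OF inner_cnj]) (use assms in simp_all)
  ultimately have "?d = hzero H"
    using assms by (intro inner_definite) (auto simp: complex_eq_iff)
  have "v = hadd H v (hadd H (hscale H (- 1) w) w)"
    using assms add_commute[of "hscale H (- 1) w" w] by (simp add: add_neg add_zero)
  also have "\<dots> = hadd H ?d w" using assms by (simp add: add_assoc)
  also have "\<dots> = w" using assms \<open>?d = hzero H\<close> add_commute[of "hzero H" w] by (simp add: add_zero)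
  finally show ?thesis .
qed

lemma tendsto_hdist_sq:
  assumes "\<And>n. s n \<in> hcarrier H" "v \<in> hcarrier H"
  shows "(\<lambda>n. hdist H (s n) v) \<longlonglongrightarrow> 0 \<longleftrightarrow> (\<lambda>n. (hdist H (s n) v)\<^sup>2) \<longlonglongrightarrow> 0"
proof
  assume "(\<lambda>n. (hdist H (s n) v)\<^sup>2) \<longlonglongrightarrow> 0"
  from tendsto_real_sqrt[OF this] show "(\<lambda>n. hdist H (s n) v) \<longlonglongrightarrow> 0"
    using assms by (simp add: hdist_nonneg)
next
  assume "(\<lambda>n. hdist H (s n) v) \<longlonglongrightarrow> 0"
  from tendsto_power[OF this, of 2] show "(\<lambda>n. (hdist H (s n) v)\<^sup>2) \<longlonglongrightarrow> 0" by simp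
qed

end

definition htransport :: "('h \<Rightarrow> 'k) \<Rightarrow> 'h hspace \<Rightarrow> 'k hspace"
  where "htransport f H = (let g = inv_into (hcarrier H) f in
    \<lparr>hcarrier = f ` hcarrier H, hzero = f (hzero H),
     hadd = \<lambda>v w. f (hadd H (g v) (g w)), hscale = \<lambda>c v. f (hscale H c (g v)),
     hinner = \<lambda>v w. hinner H (g v) (g w)\<rparr>)"

lemma htransport_sel:
  assumes "inj_on f (hcarrier H)"
  shows "hcarrier (htransport f H) = f ` hcarrier H"
    and "hzero (htransport f H) = f (hzero H)"
    and "\<lbrakk>v \<in> hcarrier H; w \<in> hcarrier H\<rbrakk> \<Longrightarrow> hadd (htransport f H) (f v) (f w) = f (hadd H v w)"
    and "v \<in> hcarrier H \<Longrightarrow> hscale (htransport f H) c (f v) = f (hscale H c v)"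
    and "\<lbrakk>v \<in> hcarrier H; w \<in> hcarrier H\<rbrakk> \<Longrightarrow> hinner (htransport f H) (f v) (f w) = hinner H v w"
  using assms by (simp_all add: htransport_def Let_def)

lemma htransport_metric:
  assumes "inj_on f (hcarrier H)" "complex_hilbert_space H"
  shows "v \<in> hcarrier H \<Longrightarrow> hnorm (htransport f H) (f v) = hnorm H v"
    and "\<lbrakk>v \<in> hcarrier H; w \<in> hcarrier H\<rbrakk> \<Longrightarrow> hdist (htransport f H) (f v) (f w) = hdist H v w"
proof -
  interpret complex_hilbert_space H by fact
  show norm: "hnorm (htransport f H) (f v) = hnorm H v" if "v \<in> hcarrier H" for v
    using that by (simp add: hnorm_def htransport_sel[OF assms(1)])
  show "hdist (htransport f H) (f v) (f w) = hdist H v w"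
    if "v \<in> hcarrier H" "w \<in> hcarrier H"
    using that by (simp add: hdist_def htransport_sel[OF assms(1)] norm)
qed

lemma htransport_hilbert:
  assumes inj: "inj_on f (hcarrier H)" and H: "complex_hilbert_space H"
  shows "complex_hilbert_space (htransport f H)"
proof -
  interpret complex_hilbert_space H by fact
  note sel = htransport_sel[OF inj] and met = htransport_metric[OF inj H]
  show ?thesis
  proof (unfold_locales, goal_cases)
    case (5 v w)
    then obtain v' w' where v': "v' \<in> hcarrier H" "w' \<in> hcarrier H" "v = f v'" "w = f w'"
      by (auto simp: sel)
    show ?case using add_commute[OF v'(1,2)] v' by (simp add: sel)
  next
    case (14 v w)
    then obtain v' w' where v': "v' \<in> hcarrier H" "w' \<in> hcarrier H" "v = f v'" "w = f w'"
      by (auto simp: sel)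
    show ?case using inner_cnj[OF v'(1,2)] v' by (simp add: sel)
  next
    case (16 v)
    then obtain v' where "v' \<in> hcarrier H" "v = f v'" by (auto simp: sel)
    then show ?case using 16(2) inner_definite[of v'] by (simp add: sel)
  next
    case (17 s)
    define t where "t n = inv_into (hcarrier H) f (s n)" for n
    have t: "t n \<in> hcarrier H" "s n = f (t n)" for n
      using 17(1) by (auto simp: t_def sel inv_into_into f_inv_into_f)
    have "\<forall>e>0. \<exists>N. \<forall>m\<ge>N. \<forall>n\<ge>N. hdist H (t m) (t n) < e"
      using 17(2) by (simp add: t met)
    then obtain v where v: "v \<in> hcarrier H" "(\<lambda>n. hdist H (t n) v) \<longlonglongrightarrow> 0"
      using complete[of t] t(1) by blast
    then show ?case by (intro bexI[of _ "f v"]) (simp_all add: t met sel)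
  qed (auto simp: sel add_assoc add_zero add_neg scale_add_right scale_add_left scale_scale
      scale_one inner_add_left inner_scale_left inner_nonneg)
qed

lemma htransport_bounded_operator:
  assumes inj: "inj_on f (hcarrier H)" and H: "complex_hilbert_space H"
    and T: "bounded_operator H T"
  shows "bounded_operator (htransport f H) (\<lambda>v. f (T (inv_into (hcarrier H) f v)))"
proof -
  interpret complex_hilbert_space H by fact
  note sel = htransport_sel[OF inj] and met = htransport_metric[OF inj H]
  show ?thesis
    using T inj unfolding bounded_operator_def by (simp add: sel met)
qed

lemma htransport_rep:
  fixes \<pi> :: "'x::topological_space ell1 \<Rightarrow> 'h \<Rightarrow> 'h" and f :: "'h \<Rightarrow> 'k"
  assumes inj: "inj_on f (hcarrier H)" and rep: "unital_star_rep \<sigma> H \<pi>"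
  defines "\<rho> \<equiv> \<lambda>a v. f (\<pi> a (inv_into (hcarrier H) f v))"
  shows "unital_star_rep \<sigma> (htransport f H) \<rho>"
    and "rep_kernel (htransport f H) \<rho> = rep_kernel H \<pi>"
    and "top_irreducible H \<pi> \<Longrightarrow> top_irreducible (htransport f H) \<rho>"
proof -
  have H: "complex_hilbert_space H" using rep by (simp add: unital_star_rep_def)
  interpret complex_hilbert_space H by fact
  note sel = htransport_sel[OF inj] and met = htransport_metric[OF inj H]
  have bop: "bounded_operator H (\<pi> a)" for a using rep by (simp add: unital_star_rep_def)
  then have cl [simp]: "v \<in> hcarrier H \<Longrightarrow> \<pi> a v \<in> hcarrier H" for a v
    by (simp add: bounded_operator_def)
  have \<rho>: "v \<in> hcarrier H \<Longrightarrow> \<rho> a (f v) = f (\<pi> a v)" for a v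
    using inj by (simp add: \<rho>_def)
  have "bounded_operator (htransport f H) (\<rho> a)" for a
    unfolding \<rho>_def by (rule htransport_bounded_operator[OF inj H bop])
  then show "unital_star_rep \<sigma> (htransport f H) \<rho>"
    using rep htransport_hilbert[OF inj H] unfolding unital_star_rep_def
    by (simp add: sel \<rho>)
  show "rep_kernel (htransport f H) \<rho> = rep_kernel H \<pi>"
    using inj_on_eq_iff[OF inj] by (auto simp: rep_kernel_def sel \<rho>)
  show "top_irreducible (htransport f H) \<rho>" if irr: "top_irreducible H \<pi>"
    unfolding top_irreducible_def
  proof (intro conjI allI impI)
    show "hcarrier (htransport f H) \<noteq> {hzero (htransport f H)}"
    proof
      assume "hcarrier (htransport f H) = {hzero (htransport f H)}"
      then have "f v = f (hzero H)" if "v \<in> hcarrier H" for v using that by (auto simp: sel)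
      then have "hcarrier H = {hzero H}" using inj_on_eq_iff[OF inj] by auto
      then show False using irr by (simp add: top_irreducible_def)
    qed
    fix M assume M: "closed_subspace (htransport f H) M \<and> (\<forall>a. \<forall>v\<in>M. \<rho> a v \<in> M)"
    define N where "N = {v \<in> hcarrier H. f v \<in> M}"
    have sub: "M \<subseteq> f ` hcarrier H" using M by (simp add: closed_subspace_def sel)
    then have MN: "M = f ` N" by (auto simp: N_def)
    have add: "hadd (htransport f H) x y \<in> M" if "x \<in> M" "y \<in> M" for x y
      using M that by (simp add: closed_subspace_def)
    have scale: "hscale (htransport f H) c x \<in> M" if "x \<in> M" for c x
      using M that by (simp add: closed_subspace_def)
    have lim: "x \<in> M" if "x \<in> f ` hcarrier H" "\<And>n. s n \<in> M"
      "(\<lambda>n. hdist (htransport f H) (s n) x) \<longlonglongrightarrow> 0" for s :: "nat \<Rightarrow> 'k" and x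
      using M that unfolding closed_subspace_def sel(1) by blast
    have "closed_subspace H N"
      unfolding closed_subspace_def
    proof (intro conjI ballI allI impI)
      show "hzero H \<in> N" using M by (simp add: N_def closed_subspace_def sel)
      show "hadd H v w \<in> N" if "v \<in> N" "w \<in> N" for v w
        using add[of "f v" "f w"] that by (simp add: N_def sel)
      show "hscale H c v \<in> N" if "v \<in> N" for c v
        using scale[of "f v" c] that by (simp add: N_def sel)
      show "v \<in> N" if v: "v \<in> hcarrier H"
        and s: "(\<forall>n. s n \<in> N) \<and> (\<lambda>n. hdist H (s n) v) \<longlonglongrightarrow> 0" for s v
        using lim[of "f v" "\<lambda>n. f (s n)"] v s by (simp add: N_def met)
    qed (simp add: N_def)
    moreover have "\<pi> a v \<in> N" if "v \<in> N" for a v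
    proof -
      have "\<rho> a (f v) \<in> M" using M that by (simp add: N_def)
      then show ?thesis using that by (simp add: N_def \<rho>)
    qed
    ultimately have "N = {hzero H} \<or> N = hcarrier H"
      using irr by (simp add: top_irreducible_def)
    then show "M = {hzero (htransport f H)} \<or> M = hcarrier (htransport f H)"
      by (auto simp: MN sel)
  qed
qed

lemma square_tendsto_0:
  fixes x y :: "nat \<Rightarrow> real"
  assumes "y \<longlonglongrightarrow> 0" "\<And>n. (x n)\<^sup>2 \<le> y n"
  shows "(\<lambda>n. (x n)\<^sup>2) \<longlonglongrightarrow> 0"
  by (rule tendsto_sandwich[OF _ _ tendsto_const assms(1)]) (simp_all add: assms(2))

lemma irreducible_carrier_embeds:
  fixes \<pi> :: "'x::topological_space ell1 \<Rightarrow> 'h \<Rightarrow> 'h"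
  assumes rep: "unital_star_rep \<sigma> H \<pi>" and irr: "top_irreducible H \<pi>"
  obtains f :: "'h \<Rightarrow> nat \<Rightarrow> 'x ell1" where "inj_on f (hcarrier H)"
proof -
  interpret complex_hilbert_space H using rep by (simp add: unital_star_rep_def)
  have bop: "bounded_operator H (\<pi> a)" for a using rep by (simp add: unital_star_rep_def)
  then have cl [simp]: "v \<in> hcarrier H \<Longrightarrow> \<pi> a v \<in> hcarrier H" for a v
    by (simp add: bounded_operator_def)
  obtain v where v [simp]: "v \<in> hcarrier H" and v0: "v \<noteq> hzero H"
    using irr zero_closed by (auto simp: top_irreducible_def)
  have radd: "hadd H (\<pi> a v) (\<pi> b v) = \<pi> (a + b) v" for a b
    using rep by (simp add: unital_star_rep_def)
  have rscale: "hscale H c (\<pi> a v) = \<pi> (ell1_scaleC c a) v" for a c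
    using rep by (simp add: unital_star_rep_def)
  have rmult: "\<pi> a (\<pi> b v) = \<pi> (ell1_mult \<sigma> a b) v" for a b
    using rep by (simp add: unital_star_rep_def)
  have rone: "\<pi> ell1_one v = v"
    using rep by (simp add: unital_star_rep_def)
  define lim where "lim s w \<longleftrightarrow> (\<lambda>n. (hdist H (\<pi> (s n) v) w)\<^sup>2) \<longlonglongrightarrow> 0"
    for s :: "nat \<Rightarrow> 'x ell1" and w
  define M where "M = {w \<in> hcarrier H. \<exists>s. lim s w}"
  have const: "lim (\<lambda>_. a) (\<pi> a v)" for a by (simp add: lim_def hdist_self)
  have bound: "\<exists>t. lim t (T w)" if w: "w \<in> hcarrier H" "lim s w" and T: "bounded_operator H T"
    and Tr: "\<And>a. \<exists>b. T (\<pi> a v) = \<pi> b v" for s w T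
  proof -
    have "\<forall>n. \<exists>b. T (\<pi> (s n) v) = \<pi> b v" using Tr by blast
    then obtain t where t: "\<And>n. T (\<pi> (s n) v) = \<pi> (t n) v" by metis
    obtain C where C: "\<And>u. u \<in> hcarrier H \<Longrightarrow> hnorm H (T u) \<le> C * hnorm H u"
      using T unfolding bounded_operator_def by blast
    have "hdist H (T u) (T w) \<le> C * hdist H u w" if "u \<in> hcarrier H" for u
      using C[of "hadd H u (hscale H (- 1) w)"] that w T by (simp add: hdist_def bounded_operator_def)
    then have "hdist H (\<pi> (t n) v) (T w) \<le> C * hdist H (\<pi> (s n) v) w" for n
      using t[of n] by (metis cl v)
    moreover have Tw: "T w \<in> hcarrier H" using T w by (simp add: bounded_operator_def)
    ultimately have "(hdist H (\<pi> (t n) v) (T w))\<^sup>2 \<le> C\<^sup>2 * (hdist H (\<pi> (s n) v) w)\<^sup>2" for n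
      using power_mono[of "hdist H (\<pi> (t n) v) (T w)" "C * hdist H (\<pi> (s n) v) w" 2]
      by (simp add: hdist_nonneg power_mult_distrib)
    note le = this
    have "(\<lambda>n. C\<^sup>2 * (hdist H (\<pi> (s n) v) w)\<^sup>2) \<longlonglongrightarrow> 0"
      using w(2) unfolding lim_def by (rule tendsto_mult_right_zero)
    then have "lim t (T w)"
      unfolding lim_def using le by (rule square_tendsto_0)
    then show ?thesis by (rule exI[of _ t])
  qed
  have "closed_subspace H M"
    unfolding closed_subspace_def
  proof (intro conjI ballI allI impI)
    have "hzero H = \<pi> (ell1_one + ell1_scaleC (- 1) ell1_one) v"
      using add_neg[OF v] by (simp add: radd[symmetric] rscale[symmetric] rone)
    then show "hzero H \<in> M" using const by (auto simp: M_def)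
    fix w assume "w \<in> M"
    then obtain s where w: "w \<in> hcarrier H" "lim s w" by (auto simp: M_def)
    show "hscale H c w \<in> M" for c
    proof -
      have eq: "hnorm H (hscale H c u) = cmod c * hnorm H u" if "u \<in> hcarrier H" for u
      proof -
        have "hinner H (hscale H c u) (hscale H c u) = (c * cnj c) * hinner H u u"
          using that by (simp add: inner_scale_left inner_scale_right)
        then have "Re (hinner H (hscale H c u) (hscale H c u)) = (cmod c)\<^sup>2 * Re (hinner H u u)"
          by (simp add: complex_norm_square[symmetric])
        then show ?thesis by (simp add: hnorm_def real_sqrt_mult)
      qed
      have "bounded_operator H (hscale H c)"
        unfolding bounded_operator_def
        by (auto simp: scale_add_right scale_scale mult.commute eq intro!: exI[of _ "cmod c"])
      from bound[OF w this] show ?thesis using w rscale by (auto simp: M_def)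
    qed
    fix u assume "u \<in> M"
    then obtain t where u: "u \<in> hcarrier H" "lim t u" by (auto simp: M_def)
    have "(\<lambda>n. 2 * (hdist H (\<pi> (s n) v) w)\<^sup>2 + 2 * (hdist H (\<pi> (t n) v) u)\<^sup>2) \<longlonglongrightarrow> 2 * 0 + 2 * 0"
      using w(2) u(2) unfolding lim_def by (intro tendsto_add tendsto_mult tendsto_const)
    then have z: "(\<lambda>n. 2 * (hdist H (\<pi> (s n) v) w)\<^sup>2 + 2 * (hdist H (\<pi> (t n) v) u)\<^sup>2) \<longlonglongrightarrow> 0"
      by simp
    have "(hdist H (\<pi> (s n + t n) v) (hadd H w u))\<^sup>2
        \<le> 2 * (hdist H (\<pi> (s n) v) w)\<^sup>2 + 2 * (hdist H (\<pi> (t n) v) u)\<^sup>2" for n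
      unfolding radd[symmetric] using w u by (intro hdist_sq_add) simp_all
    with z have "lim (\<lambda>n. s n + t n) (hadd H w u)"
      unfolding lim_def by (rule square_tendsto_0)
    then show "hadd H w u \<in> M" using w u by (auto simp: M_def)
  next
    fix s w assume w: "w \<in> hcarrier H"
      and s: "(\<forall>n. s n \<in> M) \<and> (\<lambda>n. hdist H (s n) w) \<longlonglongrightarrow> 0"
    have sH: "s n \<in> hcarrier H" for n using s by (simp add: M_def)
    have "\<exists>a. (hdist H (\<pi> a v) (s n))\<^sup>2 < 1 / Suc n" for n
    proof -
      obtain t where "lim t (s n)" using s by (auto simp: M_def)
      then have "\<forall>\<^sub>F k in sequentially. (hdist H (\<pi> (t k) v) (s n))\<^sup>2 < 1 / Suc n"
        unfolding lim_def by (rule order_tendstoD) simp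
      then show ?thesis using eventually_happens'[OF sequentially_bot] by blast
    qed
    then obtain a where a: "\<And>n. (hdist H (\<pi> (a n) v) (s n))\<^sup>2 < 1 / Suc n" by metis
    have "(\<lambda>n. 1 / real (Suc n)) \<longlonglongrightarrow> 0"
      using LIMSEQ_inverse_real_of_nat by (simp add: inverse_eq_divide)
    moreover have "(\<lambda>n. (hdist H (s n) w)\<^sup>2) \<longlonglongrightarrow> 0"
      using tendsto_hdist_sq[of s w] sH w s by simp
    ultimately have "(\<lambda>n. 2 * (1 / real (Suc n)) + 2 * (hdist H (s n) w)\<^sup>2) \<longlonglongrightarrow> 2 * 0 + 2 * 0"
      by (intro tendsto_add tendsto_mult tendsto_const)
    then have z: "(\<lambda>n. 2 * (1 / real (Suc n)) + 2 * (hdist H (s n) w)\<^sup>2) \<longlonglongrightarrow> 0"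
      by simp
    have "(hdist H (\<pi> (a n) v) w)\<^sup>2 \<le> 2 * (1 / real (Suc n)) + 2 * (hdist H (s n) w)\<^sup>2" for n
      using hdist_sq_triangle[OF cl[OF v] sH w, of "a n" n] a[of n] by linarith
    with z have "lim a w"
      unfolding lim_def by (rule square_tendsto_0)
    then show "w \<in> M" using w by (auto simp: M_def)
  qed (auto simp: M_def)
  moreover have "\<forall>a. \<forall>w\<in>M. \<pi> a w \<in> M"
  proof (intro allI ballI)
    fix a w assume "w \<in> M"
    then obtain s where w: "w \<in> hcarrier H" "lim s w" by (auto simp: M_def)
    from bound[OF w bop[of a]] show "\<pi> a w \<in> M" using w rmult by (auto simp: M_def)
  qed
  moreover have "v \<in> M" using const[of ell1_one] by (auto simp: M_def rone)
  ultimately have "M = hcarrier H"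
    using irr v0 by (auto simp: top_irreducible_def)
  then have "\<forall>w\<in>hcarrier H. \<exists>s. lim s w" by (auto simp: M_def)
  then obtain f where f: "\<And>w. w \<in> hcarrier H \<Longrightarrow> lim (f w) w" by metis
  have "inj_on f (hcarrier H)"
  proof (rule inj_onI)
    fix u w assume u: "u \<in> hcarrier H" and w: "w \<in> hcarrier H" and eq: "f u = f w"
    let ?p = "\<lambda>n. \<pi> (f u n) v"
    have "(\<lambda>n. (hdist H (?p n) u)\<^sup>2) \<longlonglongrightarrow> 0" "(\<lambda>n. (hdist H (?p n) w)\<^sup>2) \<longlonglongrightarrow> 0"
      using f[OF u] f[OF w] eq unfolding lim_def by simp_all
    then have "(\<lambda>n. 2 * (hdist H (?p n) u)\<^sup>2 + 2 * (hdist H (?p n) w)\<^sup>2) \<longlonglongrightarrow> 2 * 0 + 2 * 0"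
      by (intro tendsto_add tendsto_mult tendsto_const)
    moreover have "(hdist H u w)\<^sup>2 \<le> 2 * (hdist H (?p n) u)\<^sup>2 + 2 * (hdist H (?p n) w)\<^sup>2" for n
      using hdist_sq_triangle[OF u cl[OF v] w, of "f u n"] hdist_commute[OF u cl[OF v], of "f u n"]
      by simp
    ultimately have "(hdist H u w)\<^sup>2 \<le> 2 * 0 + 2 * 0"
      by (intro LIMSEQ_le_const) auto
    then show "u = w" using hdist_eq_0D[OF u w] by simp
  qed
  then show ?thesis by (rule that)
qed

theorem primitive_idealI:
  fixes \<pi> :: "'x::topological_space ell1 \<Rightarrow> 'h \<Rightarrow> 'h"
  assumes "unital_star_rep \<sigma> H \<pi>" "top_irreducible H \<pi>"
  shows "primitive_ideal \<sigma> (rep_kernel H \<pi>)"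
proof -
  obtain f :: "'h \<Rightarrow> nat \<Rightarrow> 'x ell1" where inj: "inj_on f (hcarrier H)"
    using irreducible_carrier_embeds[OF assms] .
  show ?thesis
    unfolding primitive_ideal_def
    using htransport_rep[OF inj assms(1)] assms(2) by metis
qed


section \<open>The representations \<open>\<pi>\<^sub>x\<close>\<close>

definition ell2_space :: "(int \<Rightarrow> complex) hspace"
  where "ell2_space =
    \<lparr>hcarrier = {\<xi>. (\<lambda>k. (cmod (\<xi> k))\<^sup>2) summable_on UNIV}, hzero = (\<lambda>_. 0),
     hadd = (\<lambda>\<xi> \<eta> k. \<xi> k + \<eta> k), hscale = (\<lambda>c \<xi> k. c * \<xi> k),
     hinner = (\<lambda>\<xi> \<eta>. \<Sum>\<^sub>\<infinity>k. \<xi> k * cnj (\<eta> k))\<rparr>"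

definition ell2_basis :: "int \<Rightarrow> int \<Rightarrow> complex"
  where "ell2_basis k = (\<lambda>m. if m = k then 1 else 0)"

text \<open>Since \<open>\<pi>\<^sub>x(f \<delta>\<^sup>n) e\<^sub>k = f(\<sigma>\<^sup>k\<^sup>+\<^sup>n x) e\<^sub>k\<^sub>+\<^sub>n\<close>, the \<open>m\<close>-th coordinate of \<open>\<pi>\<^sub>x(\<Sum>\<^sub>n a\<^sub>n \<delta>\<^sup>n) \<xi>\<close> is
  \<open>\<Sum>\<^sub>n a\<^sub>n(\<sigma>\<^sup>m x) \<xi>(m - n)\<close>.\<close>

definition orbit_rep ::
  "('x \<Rightarrow> 'x) \<Rightarrow> 'x \<Rightarrow> 'x::topological_space ell1 \<Rightarrow> (int \<Rightarrow> complex) \<Rightarrow> (int \<Rightarrow> complex)"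
  where "orbit_rep \<sigma> x a \<xi> = (\<lambda>m. \<Sum>\<^sub>\<infinity>n. ell1_coeff a n (int_iter \<sigma> m x) * \<xi> (m - n))"

definition orbit_ideal :: "('x \<Rightarrow> 'x) \<Rightarrow> 'x \<Rightarrow> 'x::topological_space ell1 set"
  where "orbit_ideal \<sigma> x = rep_kernel ell2_space (orbit_rep \<sigma> x)"

lemma orbit_rep_single:
  "orbit_rep \<sigma> x (ell1_single n f) \<xi> = (\<lambda>m. f (int_iter \<sigma> m x) * \<xi> (m - n))"
proof
  fix m
  have "orbit_rep \<sigma> x (ell1_single n f) \<xi> m =
      (\<Sum>\<^sub>\<infinity>k\<in>{n}. ell1_coeff (ell1_single n f) k (int_iter \<sigma> m x) * \<xi> (m - k))"
    unfolding orbit_rep_def by (rule infsum_cong_neutral) (auto simp: ell1_single.rep_eq)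
  then show "orbit_rep \<sigma> x (ell1_single n f) \<xi> m = f (int_iter \<sigma> m x) * \<xi> (m - n)"
    by (simp add: ell1_single.rep_eq)
qed

lemma orbit_rep_delta: "orbit_rep \<sigma> x ell1_delta (ell2_basis k) = ell2_basis (k + 1)"
  by (auto simp: ell1_delta_def orbit_rep_single ell2_basis_def fun_eq_iff)

lemma orbit_rep_C:
  "orbit_rep \<sigma> x (ell1_of_C f) (ell2_basis k)
    = hscale ell2_space (f (int_iter \<sigma> k x)) (ell2_basis k)"
  by (auto simp: ell1_of_C_def orbit_rep_single ell2_basis_def ell2_space_def fun_eq_iff)

end

theory Submission
  imports Defs
begin

text \<open>If \<open>\<sigma>\<close> is free, averaging \<open>f a f\<close> over a partition of unity by squares \<open>f\<^sup>2\<close> with small supports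
  approximates \<open>E(a)\<close> in norm, so every closed ideal is well behaved; it is then determined by a closed
  ideal of \<open>C(X)\<close>, that is by its hull.  Involutive representations are automatically contractive, so
  primitive ideals are closed.

  Conversely let \<open>x\<close> have period \<open>p\<close>.  The \<open>p\<close>-dimensional irreducible representation on the orbit of
  \<open>x\<close> kills \<open>\<delta>\<^sup>p - 1\<close> but not \<open>E(\<delta>\<^sup>p - 1)\<close>.  A closed ideal which is not self-adjoint comes from
  Malliavin's theorem, in the following form.  On the Cantor set of numbers with base 8 digits in
  \<open>{0, 1, 2}\<close> there are two real functions \<open>f\<^sub>1\<close>, \<open>f\<^sub>2\<close> with absolutely convergent Fourier series, each a
  sum of weights over the positions of the digit 2, such that the Fourier coefficients of
  \<open>exp(i(u f\<^sub>1 + v f\<^sub>2))\<close> with respect to the uniform measure decay rapidly in \<open>(u, v)\<close>, uniformly in the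
  frequency.  Hence \<open>\<Sum>\<^sub>u\<^sub>,\<^sub>v (u + iv) exp(i(u f\<^sub>1 + v f\<^sub>2))\<close>, a first derivative of the point mass at
  \<open>f\<^sub>1 = f\<^sub>2 = 0\<close>, is a bounded functional; summation by parts shows that it annihilates the ideal
  generated by \<open>sin f\<^sub>1 + i sin f\<^sub>2\<close>, but not the complex conjugate of this generator.\<close>

subsection \<open>The Banach algebra structure\<close>

text \<open>With one real function f, the derivative of the point mass at f = 0 separates f from
  f^2, but ideals generated by real functions are self-adjoint. With two functions, u + iv is up to
  a constant factor the symbol of \<partial>_1 + i \<partial>_2, which kills s_1 + i s_2 but not s_1
  - i s_2. The exponents u, v are integers, so the functional lives on a torus; hence the sines in
  the generator.

  The bound on the Fourier coefficients must be uniform in the frequency. Two digits could not give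
  this: 1 + z cis(s) has modulus 2 at z = cis(-s). With three digits the indicator of the digit 2 is
  not an affine function of the digit, and no frequency compensates for its phase.

  No limit measure on the Cantor set is formed. Only finitely many digits vary at a time, and the
  ideal is defined by a sequence of uniformly bounded functionals tending to 0. The transfer to the
  algebra uses bounded sequences along the orbit of a periodic point that \<delta>^p multiplies by a
  scalar z on the unit circle.\<close>

lemma bounded_linear_apply_bcontfun:
  "bounded_linear (\<lambda>f :: 'x::topological_space \<Rightarrow>\<^sub>C complex. apply_bcontfun f x)"
  by (rule bounded_linear_intro[where K = 1]) (simp_all add: norm_bounded)

lemma cmod_ell1_coeff_le: "cmod (ell1_coeff a n x) \<le> norm (ell1_coeff a n)"
  by (rule norm_bounded)

lemma sum_norm_ell1_coeff_le: "finite F \<Longrightarrow> (\<Sum>n\<in>F. norm (ell1_coeff a n)) \<le> norm a"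
  unfolding norm_ell1_def by (rule finite_sum_le_infsum[OF ell1_coeff_summable]) auto

lemma norm_ell1_coeff_le: "norm (ell1_coeff a n) \<le> norm a"
  using sum_norm_ell1_coeff_le[of "{n}" a] by simp

lemma norm_ell1_has_sum: "((\<lambda>n. norm (ell1_coeff a n)) has_sum norm a) UNIV"
  unfolding norm_ell1_def by (rule has_sum_infsum[OF ell1_coeff_summable])

lemma ell1_coeff_arith [simp]:
  "ell1_coeff (a + b) n = ell1_coeff a n + ell1_coeff b n"
  "ell1_coeff (a - b) n = ell1_coeff a n - ell1_coeff b n"
  "ell1_coeff (- a) n = - ell1_coeff a n"
  "ell1_coeff 0 n = 0"
  "ell1_coeff (r *\<^sub>R a) n = r *\<^sub>R ell1_coeff a n"
  by (simp_all add: plus_ell1.rep_eq minus_ell1.rep_eq uminus_ell1.rep_eq zero_ell1.rep_eq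
      scaleR_ell1.rep_eq)

lemma ell1_coeff_sum [simp]: "ell1_coeff (sum f F) n = (\<Sum>i\<in>F. ell1_coeff (f i) n)"
  by (induction F rule: infinite_finite_induct) simp_all

lemma sum_bcontfun_apply [simp]:
  fixes f :: "'i \<Rightarrow> 'x::topological_space \<Rightarrow>\<^sub>C 'b::real_normed_vector"
  shows "apply_bcontfun (sum f F) x = (\<Sum>i\<in>F. apply_bcontfun (f i) x)"
  by (induction F rule: infinite_finite_induct) simp_all

lemma coeff_ell1_scaleC [simp]:
  "ell1_coeff (ell1_scaleC c a) n = bc_mult (const_bcontfun c) (ell1_coeff a n)"
  by (simp add: ell1_scaleC.rep_eq)

lemma coeff_ell1_single [simp]: "ell1_coeff (ell1_single k f) n = (if n = k then f else 0)"
  by (simp add: ell1_single.rep_eq)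

lemma norm_ell1_scaleC [simp]: "norm (ell1_scaleC c a) = cmod c * norm a"
  by (simp add: norm_ell1_def infsum_cmult_right')

lemma ell1_scaleC_of_real: "ell1_scaleC (complex_of_real r) a = r *\<^sub>R a"
  by (intro ell1_eqI bcontfun_eqI) (simp add: scaleR_conv_of_real)

lemma norm_ell1_single [simp]: "norm (ell1_single k f) = norm f"
proof -
  have "norm (ell1_single k f) = (\<Sum>\<^sub>\<infinity>n\<in>{k}. norm (ell1_coeff (ell1_single k f) n))"
    unfolding norm_ell1_def by (rule infsum_cong_neutral) auto
  then show ?thesis by simp
qed

lemma norm_ell1_one_le: "norm (ell1_one :: 'x::topological_space ell1) \<le> 1"
  unfolding ell1_one_def ell1_of_C_def norm_ell1_single by (rule norm_bound) simp

lemma norm_ell1_leI: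
  assumes "\<And>F. finite F \<Longrightarrow> (\<Sum>n\<in>F. norm (ell1_coeff a n)) \<le> C"
  shows "norm a \<le> C"
  unfolding norm_ell1_def by (rule infsum_le_finite_sums[OF ell1_coeff_summable]) (use assms in auto)

text \<open>Limits are taken coefficient by coefficient; the Cauchy estimate on finite partial sums
  survives the limit and yields both summability of the limit and convergence in norm. Completeness
  is what sums the Neumann series in \<open>neumann_left_inverse\<close>.\<close>

instance ell1 :: (topological_space) banach
proof
  fix X :: "nat \<Rightarrow> 'a ell1"
  assume X: "Cauchy X"
  have "\<exists>l. (\<lambda>i. ell1_coeff (X i) n) \<longlonglongrightarrow> l" for n
  proof -
    have "Cauchy (\<lambda>i. ell1_coeff (X i) n)"
    proof (rule CauchyI)
      fix e :: real assume "0 < e"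
      then obtain M where "\<forall>i\<ge>M. \<forall>j\<ge>M. norm (X i - X j) < e"
        using CauchyD[OF X] by blast
      then show "\<exists>M. \<forall>i\<ge>M. \<forall>j\<ge>M. norm (ell1_coeff (X i) n - ell1_coeff (X j) n) < e"
        using norm_ell1_coeff_le[of "X _ - X _" n] by (metis (no_types) ell1_coeff_arith(2) order_le_less_trans)
    qed
    then show ?thesis using Cauchy_convergent convergent_def by blast
  qed
  then obtain L where L: "\<And>n. (\<lambda>i. ell1_coeff (X i) n) \<longlonglongrightarrow> L n" by metis
  have tail: "\<exists>M. \<forall>i\<ge>M. \<forall>F. finite F \<longrightarrow> (\<Sum>n\<in>F. norm (ell1_coeff (X i) n - L n)) \<le> e"
    if "0 < e" for e
  proof -
    obtain M where M: "\<And>i j. i \<ge> M \<Longrightarrow> j \<ge> M \<Longrightarrow> norm (X i - X j) < e"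
      using CauchyD[OF X \<open>0 < e\<close>] by blast
    have "(\<Sum>n\<in>F. norm (ell1_coeff (X i) n - L n)) \<le> e" if "i \<ge> M" "finite F" for i F
    proof (rule LIMSEQ_le_const2)
      show "(\<lambda>j. \<Sum>n\<in>F. norm (ell1_coeff (X i) n - ell1_coeff (X j) n))
          \<longlonglongrightarrow> (\<Sum>n\<in>F. norm (ell1_coeff (X i) n - L n))"
        by (intro tendsto_intros L)
      have "(\<Sum>n\<in>F. norm (ell1_coeff (X i) n - ell1_coeff (X j) n)) \<le> e" if "j \<ge> M" for j
        using sum_norm_ell1_coeff_le[OF \<open>finite F\<close>, of "X i - X j"] M[OF \<open>i \<ge> M\<close> that] by simp
      then show "\<exists>N. \<forall>j\<ge>N. (\<Sum>n\<in>F. norm (ell1_coeff (X i) n - ell1_coeff (X j) n)) \<le> e"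
        by blast
    qed
    then show ?thesis by blast
  qed
  have sumL: "(\<lambda>n. norm (L n)) summable_on UNIV"
  proof -
    obtain M where M: "\<And>F. finite F \<Longrightarrow> (\<Sum>n\<in>F. norm (ell1_coeff (X M) n - L n)) \<le> 1"
      using tail[of 1] by auto
    have "(\<lambda>n. norm (ell1_coeff (X M) n - L n)) summable_on UNIV"
      by (rule nonneg_bounded_partial_sums_imp_summable_on[where C = 1])
        (auto simp: M intro!: eventually_finite_subsets_at_top_weakI)
    then have "(\<lambda>n. norm (ell1_coeff (X M) n - L n) + norm (ell1_coeff (X M) n)) summable_on UNIV"
      by (rule summable_on_add[OF _ ell1_coeff_summable])
    then show ?thesis
      by (rule Infinite_Sum.abs_summable_on_comparison_test')
        (metis add.commute norm_minus_commute norm_triangle_sub)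
  qed
  define l where "l = Abs_ell1 L"
  have l: "ell1_coeff l n = L n" for n using sumL by (simp add: l_def Abs_ell1_inverse)
  have "X \<longlonglongrightarrow> l"
  proof (rule LIMSEQ_I)
    fix e :: real assume "0 < e"
    then obtain M where M: "\<And>i F. i \<ge> M \<Longrightarrow> finite F \<Longrightarrow> (\<Sum>n\<in>F. norm (ell1_coeff (X i) n - L n)) \<le> e / 2"
      using tail[of "e / 2"] by auto
    have "norm (X i - l) \<le> e / 2" if "i \<ge> M" for i
      by (rule norm_ell1_leI) (use M[OF that] in \<open>simp add: l\<close>)
    then show "\<exists>M. \<forall>i\<ge>M. norm (X i - l) < e" using \<open>0 < e\<close> by (intro exI[of _ M]) force
  qed
  then show "convergent X" by (rule convergentI)
qed

lemma abs_summable_product: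
  fixes f :: "'a \<Rightarrow> real" and g :: "'b \<Rightarrow> real"
  assumes "(f has_sum A) UNIV" "(g has_sum B) UNIV" "\<And>k. 0 \<le> f k" "\<And>l. 0 \<le> g l"
  shows "((\<lambda>(k, l). f k * g l) has_sum (A * B)) (UNIV \<times> UNIV)"
proof -
  have row: "((\<lambda>l. f k * g l) has_sum f k * B) UNIV" for k
    by (rule has_sum_cmult_right[OF assms(2)])
  have col: "((\<lambda>k. f k * B) has_sum A * B) UNIV"
    by (rule has_sum_cmult_left[OF assms(1)])
  have "(\<lambda>(k, l). f k * g l) summable_on (UNIV \<times> UNIV)"
    by (rule summable_on_SigmaI[where g = "\<lambda>k. f k * B"])
      (use row col assms in \<open>auto simp: summable_on_def\<close>)
  then have "((\<lambda>(k, l). f k * g l) has_sum infsum (\<lambda>(k, l). f k * g l) (UNIV \<times> UNIV)) (UNIV \<times> UNIV)"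
    by (rule has_sum_infsum)
  moreover from has_sum_SigmaD[OF this, of "\<lambda>k. f k * B"] row
  have "((\<lambda>k. f k * B) has_sum infsum (\<lambda>(k, l). f k * g l) (UNIV \<times> UNIV)) UNIV" by simp
  ultimately show ?thesis using has_sum_unique[OF _ col] by metis
qed

lemma bij_convolution_index: "bij_betw (\<lambda>(n, k). (k, n - k)) (UNIV \<times> UNIV) ((UNIV \<times> UNIV) :: (int \<times> int) set)"
  by (rule bij_betwI[where g = "\<lambda>(k, m). (k + m, k)"]) auto

section \<open>The integer action and the convolution product\<close>

locale homeo_system =
  fixes \<sigma> :: "'x::topological_space \<Rightarrow> 'x"
  assumes homeo: "homeomorphism UNIV UNIV \<sigma> (inv \<sigma>)"
begin

lemma sigma_inv [simp]: "\<sigma> (inv \<sigma> x) = x" "inv \<sigma> (\<sigma> x) = x"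
  using homeo by (auto simp: homeomorphism_def)

lemma int_iter_0 [simp]: "int_iter \<sigma> 0 x = x"
  by (simp add: int_iter_def)

lemma int_iter_succ: "int_iter \<sigma> (k + 1) x = \<sigma> (int_iter \<sigma> k x)"
proof (cases "0 \<le> k")
  case True
  then have "nat (k + 1) = Suc (nat k)" by simp
  then show ?thesis using True by (simp add: int_iter_def)
next
  case False
  then have "nat (- k) = Suc (nat (- (k + 1)))" by simp
  then have "int_iter \<sigma> k x = inv \<sigma> ((inv \<sigma> ^^ nat (- (k + 1))) x)"
    using False by (simp add: int_iter_def)
  then show ?thesis using False by (auto simp: int_iter_def)
qed

lemma int_iter_add: "int_iter \<sigma> (j + k) x = int_iter \<sigma> j (int_iter \<sigma> k x)"
proof (induction j rule: int_induct[of _ 0])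
  case (step1 i)
  then show ?case by (metis add.commute add.left_commute int_iter_succ)
next
  case (step2 i)
  have "\<sigma> (int_iter \<sigma> (i - 1 + k) x) = \<sigma> (int_iter \<sigma> (i - 1) (int_iter \<sigma> k x))"
    using step2 int_iter_succ[of "i - 1 + k" x] int_iter_succ[of "i - 1" "int_iter \<sigma> k x"]
    by (simp add: algebra_simps)
  then show ?case by (metis sigma_inv(2))
qed simp

lemma int_iter_simps [simp]:
  "int_iter \<sigma> j (int_iter \<sigma> k x) = int_iter \<sigma> (j + k) x" "int_iter \<sigma> 1 x = \<sigma> x"
  using int_iter_succ[of 0 x] by (simp_all add: int_iter_add)

lemmas alpha_pow_app [simp] = alpha_pow_apply[OF homeo]

lemma mult_terms_abs_summable:
  assumes "\<And>k l. norm (t k l) \<le> norm (ell1_coeff a k) * norm (ell1_coeff b l) * C"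
  shows "(\<lambda>(k, l). norm (t k l)) summable_on (UNIV \<times> UNIV)"
proof -
  have "(\<lambda>(k, l). norm (ell1_coeff a k) * norm (ell1_coeff b l)) summable_on (UNIV \<times> UNIV)"
    using abs_summable_product[OF norm_ell1_has_sum norm_ell1_has_sum] by (auto simp: summable_on_def)
  from summable_on_cmult_left[OF this, of C]
  have "(\<lambda>p. norm (ell1_coeff a (fst p)) * norm (ell1_coeff b (snd p)) * C) summable_on (UNIV \<times> UNIV)"
    by (simp add: case_prod_unfold)
  then show ?thesis
    unfolding case_prod_unfold
    by (rule Infinite_Sum.abs_summable_on_comparison_test') (rule assms)
qed

lemma ell1_mult_apply_has_sum:
  "((\<lambda>k. ell1_coeff a k x * ell1_coeff b (n - k) (int_iter \<sigma> (- k) x))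
    has_sum ell1_coeff (ell1_mult \<sigma> a b) n x) UNIV"
  using has_sum_bounded_linear[OF bounded_linear_apply_bcontfun[of x] ell1_mult_sum[OF homeo, of a b n]]
  by (simp add: o_def)

text \<open>Evaluation at a point is continuous, so identities in the algebra reduce to complex
  series, where uniqueness of the sum decides.\<close>

lemma ell1_mult_eqI:
  assumes "\<And>n x. ((\<lambda>k. ell1_coeff a k x * ell1_coeff b (n - k) (int_iter \<sigma> (- k) x))
    has_sum ell1_coeff c n x) UNIV"
  shows "ell1_mult \<sigma> a b = c"
  by (intro ell1_eqI bcontfun_eqI) (rule has_sum_unique[OF ell1_mult_apply_has_sum assms])

lemma norm_ell1_mult_le: "norm (ell1_mult \<sigma> a b) \<le> norm a * norm b"
proof -
  have "((\<lambda>(k, l). norm (ell1_coeff a k) * norm (ell1_coeff b l)) has_sum norm a * norm b) (UNIV \<times> UNIV)"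
    by (rule abs_summable_product[OF norm_ell1_has_sum norm_ell1_has_sum]) auto
  then have sum: "((\<lambda>(n, k). norm (ell1_coeff a k) * norm (ell1_coeff b (n - k))) has_sum norm a * norm b)
      (UNIV \<times> UNIV)"
    using has_sum_reindex_bij_betw[OF bij_convolution_index,
        of "\<lambda>(k, l). norm (ell1_coeff a k) * norm (ell1_coeff b l)"]
    by (simp add: case_prod_unfold)
  then have row: "(\<lambda>k. norm (ell1_coeff a k) * norm (ell1_coeff b (n - k))) summable_on UNIV" for n
    using summable_on_SigmaD1[of "\<lambda>n k. norm (ell1_coeff a k) * norm (ell1_coeff b (n - k))" UNIV "\<lambda>_. UNIV" n]
    by (auto simp: summable_on_def)
  have rows: "((\<lambda>n. \<Sum>\<^sub>\<infinity>k. norm (ell1_coeff a k) * norm (ell1_coeff b (n - k))) has_sum norm a * norm b) UNIV"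
    by (rule has_sum_SigmaD[OF sum]) (use row in auto)
  show ?thesis
  proof (rule has_sum_mono[OF norm_ell1_has_sum rows])
    fix n
    let ?t = "\<lambda>k. bc_mult (ell1_coeff a k) (alpha_pow \<sigma> k (ell1_coeff b (n - k)))"
    have le: "norm (?t k) \<le> norm (ell1_coeff a k) * norm (ell1_coeff b (n - k))" for k
      using order_trans[OF norm_bc_mult_le mult_left_mono[OF norm_alpha_pow_le[OF homeo] norm_ge_zero]] .
    have t: "(\<lambda>k. norm (?t k)) summable_on UNIV"
      by (rule Infinite_Sum.abs_summable_on_comparison_test'[OF row]) (rule le)
    have "norm (ell1_coeff (ell1_mult \<sigma> a b) n) \<le> (\<Sum>\<^sub>\<infinity>k. norm (?t k))"
      using norm_infsum_bound[OF t] infsumI[OF ell1_mult_sum[OF homeo, of a b n]] by simp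
    also have "\<dots> \<le> (\<Sum>\<^sub>\<infinity>k. norm (ell1_coeff a k) * norm (ell1_coeff b (n - k)))"
      by (rule infsum_mono[OF t row le])
    finally show "norm (ell1_coeff (ell1_mult \<sigma> a b) n)
        \<le> (\<Sum>\<^sub>\<infinity>k. norm (ell1_coeff a k) * norm (ell1_coeff b (n - k)))" .
  qed
qed

lemma ell1_mult_add_left: "ell1_mult \<sigma> (a + b) c = ell1_mult \<sigma> a c + ell1_mult \<sigma> b c"
proof (rule ell1_mult_eqI)
  show "((\<lambda>k. ell1_coeff (a + b) k x * ell1_coeff c (n - k) (int_iter \<sigma> (- k) x)) has_sum
      ell1_coeff (ell1_mult \<sigma> a c + ell1_mult \<sigma> b c) n x) UNIV" for n x
    using has_sum_add[OF ell1_mult_apply_has_sum[of a x c n] ell1_mult_apply_has_sum[of b x c n]]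
    by (simp add: algebra_simps)
qed

lemma ell1_mult_add_right: "ell1_mult \<sigma> c (a + b) = ell1_mult \<sigma> c a + ell1_mult \<sigma> c b"
proof (rule ell1_mult_eqI)
  show "((\<lambda>k. ell1_coeff c k x * ell1_coeff (a + b) (n - k) (int_iter \<sigma> (- k) x)) has_sum
      ell1_coeff (ell1_mult \<sigma> c a + ell1_mult \<sigma> c b) n x) UNIV" for n x
    using has_sum_add[OF ell1_mult_apply_has_sum[of c x a n] ell1_mult_apply_has_sum[of c x b n]]
    by (simp add: algebra_simps)
qed

lemma ell1_mult_scaleC:
  "ell1_mult \<sigma> (ell1_scaleC r a) b = ell1_scaleC r (ell1_mult \<sigma> a b)"
  "ell1_mult \<sigma> a (ell1_scaleC r b) = ell1_scaleC r (ell1_mult \<sigma> a b)"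
  by (rule ell1_mult_eqI,
      use has_sum_cmult_right[OF ell1_mult_apply_has_sum[of a _ b], of r] in \<open>simp add: mult_ac\<close>)+

lemma bounded_bilinear_ell1_mult: "bounded_bilinear (ell1_mult \<sigma>)"
proof
  show "\<exists>K. \<forall>a b. norm (ell1_mult \<sigma> a b) \<le> norm a * norm b * K"
    by (rule exI[of _ 1]) (simp add: norm_ell1_mult_le)
qed (simp_all add: ell1_mult_add_left ell1_mult_add_right ell1_mult_scaleC flip: ell1_scaleC_of_real)

lemma coeff_mult_single_right:
  "ell1_coeff (ell1_mult \<sigma> a (ell1_single m f)) n x
    = ell1_coeff a (n - m) x * f (int_iter \<sigma> (m - n) x)"
proof -
  have "((\<lambda>k. ell1_coeff a k x * ell1_coeff (ell1_single m f) (n - k) (int_iter \<sigma> (- k) x))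
      has_sum (\<Sum>k\<in>{n - m}. ell1_coeff a k x * ell1_coeff (ell1_single m f) (n - k) (int_iter \<sigma> (- k) x))) UNIV"
    by (rule has_sum_finite_neutralI[where B = "{n - m}"]) auto
  from has_sum_unique[OF ell1_mult_apply_has_sum this] show ?thesis by simp
qed

lemma coeff_mult_single_left:
  "ell1_coeff (ell1_mult \<sigma> (ell1_single m f) a) n x
    = f x * ell1_coeff a (n - m) (int_iter \<sigma> (- m) x)"
proof -
  have "((\<lambda>k. ell1_coeff (ell1_single m f) k x * ell1_coeff a (n - k) (int_iter \<sigma> (- k) x))
      has_sum (\<Sum>k\<in>{m}. ell1_coeff (ell1_single m f) k x * ell1_coeff a (n - k) (int_iter \<sigma> (- k) x))) UNIV"
    by (rule has_sum_finite_neutralI[where B = "{m}"]) auto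
  from has_sum_unique[OF ell1_mult_apply_has_sum this] show ?thesis by simp
qed

lemma ell1_mult_one [simp]: "ell1_mult \<sigma> a ell1_one = a"
  by (intro ell1_eqI bcontfun_eqI) (simp add: ell1_one_def ell1_of_C_def coeff_mult_single_right)

lemma coeff_star_apply: "ell1_coeff (ell1_star \<sigma> a) n x = cnj (ell1_coeff a (- n) (int_iter \<sigma> (- n) x))"
  by (simp add: coeff_ell1_star[OF homeo])

lemma ell1_star_star [simp]: "ell1_star \<sigma> (ell1_star \<sigma> a) = a"
  by (intro ell1_eqI bcontfun_eqI) (simp add: coeff_star_apply)

lemma norm_ell1_star_le: "norm (ell1_star \<sigma> a) \<le> norm a"
proof (rule norm_ell1_leI)
  fix F :: "int set" assume "finite F"
  have "(\<Sum>n\<in>F. norm (ell1_coeff (ell1_star \<sigma> a) n)) \<le> (\<Sum>n\<in>F. norm (ell1_coeff a (- n)))"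
    by (rule sum_mono) (simp add: coeff_ell1_star[OF homeo] norm_alpha_pow_le[OF homeo])
  also have "\<dots> = (\<Sum>n\<in>uminus ` F. norm (ell1_coeff a n))"
    by (subst sum.reindex) (auto simp: inj_on_def)
  also have "\<dots> \<le> norm a" using \<open>finite F\<close> by (intro sum_norm_ell1_coeff_le) simp
  finally show "(\<Sum>n\<in>F. norm (ell1_coeff (ell1_star \<sigma> a) n)) \<le> norm a" .
qed

lemma neumann_left_inverse:
  assumes "norm c < 1"
  obtains b where "ell1_mult \<sigma> b (ell1_one - c) = ell1_one"
proof -
  interpret bounded_bilinear "ell1_mult \<sigma>" by (rule bounded_bilinear_ell1_mult)
  \<comment> \<open>The powers of \<open>c\<close> are nested to the left: multiplying the series by
    \<open>c\<close> on the right then only shifts the index, with no appeal to associativity, which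
    is established later.\<close>
  define s where "s = rec_nat ell1_one (\<lambda>_ d. ell1_mult \<sigma> d c)"
  have s0: "s 0 = ell1_one" and s_Suc: "s (Suc k) = ell1_mult \<sigma> (s k) c" for k
    by (simp_all add: s_def)
  have "norm (s k) \<le> norm c ^ k" for k
  proof (induction k)
    case (Suc k)
    have "norm (s (Suc k)) \<le> norm (s k) * norm c" unfolding s_Suc by (rule norm_ell1_mult_le)
    also have "\<dots> \<le> norm c ^ k * norm c" using Suc by (simp add: mult_right_mono)
    finally show ?case by (simp add: mult.commute)
  qed (simp add: s0 norm_ell1_one_le)
  then have sum: "summable s"
    using assms by (intro summable_comparison_test[OF _ summable_geometric[of "norm c"]]) auto
  have "ell1_mult \<sigma> (suminf s) c = (\<Sum>k. ell1_mult \<sigma> (s k) c)"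
    by (rule bounded_linear.suminf[OF bounded_linear_left sum])
  also have "\<dots> = suminf s - ell1_one"
    using suminf_split_head[OF sum] by (simp add: s_Suc s0)
  finally have "ell1_mult \<sigma> (suminf s) (ell1_one - c) = ell1_one"
    by (simp add: diff_right)
  then show ?thesis by (rule that)
qed

subsection \<open>The orbit representation on bounded sequences\<close>

text \<open>Bounded sequences are the common setting: the same formula acts on square summable, on
  periodic and on quasi-periodic sequences, and every later use restricts it to one of
  these.\<close>

lemma orbit_rep_abs_summable:
  assumes "\<And>m. cmod (\<xi> m) \<le> C"
  shows "(\<lambda>n. norm (ell1_coeff a n (int_iter \<sigma> m x) * \<xi> (m - n))) summable_on UNIV"
proof -
  have "(\<lambda>n. norm (ell1_coeff a n) * C) summable_on UNIV"
    using ell1_coeff_summable by (rule summable_on_cmult_left)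
  then show ?thesis
    by (rule Infinite_Sum.abs_summable_on_comparison_test')
      (simp add: norm_mult mult_mono cmod_ell1_coeff_le assms)
qed

lemma orbit_rep_has_sum:
  assumes "\<And>m. cmod (\<xi> m) \<le> C"
  shows "((\<lambda>n. ell1_coeff a n (int_iter \<sigma> m x) * \<xi> (m - n)) has_sum orbit_rep \<sigma> x a \<xi> m) UNIV"
  unfolding orbit_rep_def
  by (rule has_sum_infsum[OF abs_summable_summable[OF orbit_rep_abs_summable[OF assms]]])

lemma cmod_orbit_rep_le:
  assumes "\<And>m. cmod (\<xi> m) \<le> C"
  shows "cmod (orbit_rep \<sigma> x a \<xi> m) \<le> norm a * C"
proof -
  have "cmod (orbit_rep \<sigma> x a \<xi> m) \<le> (\<Sum>\<^sub>\<infinity>n. norm (ell1_coeff a n (int_iter \<sigma> m x) * \<xi> (m - n)))"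
    unfolding orbit_rep_def by (rule norm_infsum_bound[OF orbit_rep_abs_summable[OF assms]])
  also have "\<dots> \<le> norm a * C"
    by (rule has_sum_mono[OF has_sum_infsum[OF orbit_rep_abs_summable[OF assms]]
          has_sum_cmult_left[OF norm_ell1_has_sum]])
      (simp add: norm_mult mult_mono cmod_ell1_coeff_le assms)
  finally show ?thesis .
qed

lemma orbit_rep_linear:
  assumes "\<And>m. cmod (\<xi> m) \<le> C" "\<And>m. cmod (\<eta> m) \<le> D"
  shows "orbit_rep \<sigma> x (a + b) \<xi> = (\<lambda>m. orbit_rep \<sigma> x a \<xi> m + orbit_rep \<sigma> x b \<xi> m)"
    and "orbit_rep \<sigma> x (a - b) \<xi> = (\<lambda>m. orbit_rep \<sigma> x a \<xi> m - orbit_rep \<sigma> x b \<xi> m)"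
    and "orbit_rep \<sigma> x (ell1_scaleC c a) \<xi> = (\<lambda>m. c * orbit_rep \<sigma> x a \<xi> m)"
    and "orbit_rep \<sigma> x a (\<lambda>m. \<xi> m + \<eta> m) = (\<lambda>m. orbit_rep \<sigma> x a \<xi> m + orbit_rep \<sigma> x a \<eta> m)"
    and "orbit_rep \<sigma> x a (\<lambda>m. c * \<xi> m) = (\<lambda>m. c * orbit_rep \<sigma> x a \<xi> m)"
proof -
  note s = orbit_rep_has_sum[of \<xi> C, OF assms(1)] orbit_rep_has_sum[of \<eta> D, OF assms(2)]
  show "orbit_rep \<sigma> x (a + b) \<xi> = (\<lambda>m. orbit_rep \<sigma> x a \<xi> m + orbit_rep \<sigma> x b \<xi> m)"
  proof
    show "orbit_rep \<sigma> x (a + b) \<xi> m = orbit_rep \<sigma> x a \<xi> m + orbit_rep \<sigma> x b \<xi> m" for m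
      using has_sum_add[OF s(1)[of a m x] s(1)[of b m x]]
      by (intro has_sum_unique[OF s(1)]) (simp add: algebra_simps)
  qed
  show "orbit_rep \<sigma> x (a - b) \<xi> = (\<lambda>m. orbit_rep \<sigma> x a \<xi> m - orbit_rep \<sigma> x b \<xi> m)"
  proof
    show "orbit_rep \<sigma> x (a - b) \<xi> m = orbit_rep \<sigma> x a \<xi> m - orbit_rep \<sigma> x b \<xi> m" for m
      using has_sum_add[OF s(1)[of a m x] has_sum_uminusI[OF s(1)[of b m x]]]
      by (intro has_sum_unique[OF s(1)]) (simp add: algebra_simps)
  qed
  show "orbit_rep \<sigma> x (ell1_scaleC c a) \<xi> = (\<lambda>m. c * orbit_rep \<sigma> x a \<xi> m)"
  proof
    show "orbit_rep \<sigma> x (ell1_scaleC c a) \<xi> m = c * orbit_rep \<sigma> x a \<xi> m" for m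
      using has_sum_cmult_right[OF s(1)[of a m x], of c]
      by (intro has_sum_unique[OF s(1)]) (simp add: mult.assoc)
  qed
  show "orbit_rep \<sigma> x a (\<lambda>m. \<xi> m + \<eta> m) = (\<lambda>m. orbit_rep \<sigma> x a \<xi> m + orbit_rep \<sigma> x a \<eta> m)"
  proof
    show "orbit_rep \<sigma> x a (\<lambda>m. \<xi> m + \<eta> m) m = orbit_rep \<sigma> x a \<xi> m + orbit_rep \<sigma> x a \<eta> m" for m
      unfolding orbit_rep_def[of \<sigma> x a "\<lambda>m. \<xi> m + \<eta> m"]
      using has_sum_add[OF s(1)[of a m x] s(2)[of a m x]]
      by (intro infsumI) (simp add: algebra_simps)
  qed
  show "orbit_rep \<sigma> x a (\<lambda>m. c * \<xi> m) = (\<lambda>m. c * orbit_rep \<sigma> x a \<xi> m)"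
  proof
    show "orbit_rep \<sigma> x a (\<lambda>m. c * \<xi> m) m = c * orbit_rep \<sigma> x a \<xi> m" for m
      unfolding orbit_rep_def[of \<sigma> x a "\<lambda>m. c * \<xi> m"]
      using has_sum_cmult_right[OF s(1)[of a m x], of c]
      by (intro infsumI) (simp add: algebra_simps)
  qed
qed

text \<open>Both sides sum one absolutely summable family: by rows in (k, l) for the composition,
  along the diagonals n = k + l for the product.\<close>

lemma orbit_rep_mult:
  assumes "\<And>m. cmod (\<xi> m) \<le> C"
  shows "orbit_rep \<sigma> x (ell1_mult \<sigma> a b) \<xi> = orbit_rep \<sigma> x a (orbit_rep \<sigma> x b \<xi>)"
proof
  fix m
  define t where "t k l = ell1_coeff a k (int_iter \<sigma> m x) *
    (ell1_coeff b l (int_iter \<sigma> (m - k) x) * \<xi> (m - k - l))" for k l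
  have "(\<lambda>(k, l). norm (t k l)) summable_on (UNIV \<times> UNIV)"
  proof (rule mult_terms_abs_summable[of _ a b C])
    show "norm (t k l) \<le> norm (ell1_coeff a k) * norm (ell1_coeff b l) * C" for k l
      unfolding t_def norm_mult mult.assoc by (intro mult_mono cmod_ell1_coeff_le assms) simp_all
  qed
  then have "(\<lambda>p. case p of (k, l) \<Rightarrow> t k l) summable_on (UNIV \<times> UNIV)"
    using abs_summable_summable[of "\<lambda>(k, l). t k l"] by (simp add: case_prod_unfold)
  then obtain S where S: "((\<lambda>(k, l). t k l) has_sum S) (UNIV \<times> UNIV)"
    by (auto simp: summable_on_def)
  then have S': "((\<lambda>(n, k). t k (n - k)) has_sum S) (UNIV \<times> UNIV)"
    using has_sum_reindex_bij_betw[OF bij_convolution_index, of "\<lambda>(k, l). t k l"]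
    by (simp add: case_prod_unfold)
  have "((\<lambda>k. ell1_coeff a k (int_iter \<sigma> m x) * orbit_rep \<sigma> x b \<xi> (m - k)) has_sum S) UNIV"
    by (rule has_sum_SigmaD[OF S])
      (use has_sum_cmult_right[OF orbit_rep_has_sum[of \<xi> C, OF assms]] in \<open>auto simp: t_def\<close>)
  then have 1: "orbit_rep \<sigma> x a (orbit_rep \<sigma> x b \<xi>) m = S"
    unfolding orbit_rep_def[of \<sigma> x a] by (rule infsumI)
  have "((\<lambda>n. ell1_coeff (ell1_mult \<sigma> a b) n (int_iter \<sigma> m x) * \<xi> (m - n)) has_sum S) UNIV"
  proof (rule has_sum_SigmaD[OF S'])
    fix n
    show "((\<lambda>k. case (n, k) of (n, k) \<Rightarrow> t k (n - k)) has_sum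
        ell1_coeff (ell1_mult \<sigma> a b) n (int_iter \<sigma> m x) * \<xi> (m - n)) UNIV"
      using has_sum_cmult_left[OF ell1_mult_apply_has_sum[of a "int_iter \<sigma> m x" b n], of "\<xi> (m - n)"]
      by (simp add: t_def mult.assoc algebra_simps)
  qed
  then show "orbit_rep \<sigma> x (ell1_mult \<sigma> a b) \<xi> m = orbit_rep \<sigma> x a (orbit_rep \<sigma> x b \<xi>) m"
    unfolding 1 orbit_rep_def[of \<sigma> x "ell1_mult \<sigma> a b"] by (rule infsumI)
qed

lemma orbit_rep_one [simp]: "orbit_rep \<sigma> x ell1_one \<xi> = \<xi>"
  by (simp add: ell1_one_def ell1_of_C_def orbit_rep_single)

end

subsection \<open>Continuous functions on a compact Hausdorff space\<close>

locale compact_system = homeo_system \<sigma> for \<sigma> :: "'x::t2_space \<Rightarrow> 'x" +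
  assumes compact_UNIV: "compact (UNIV :: 'x set)"
begin

lemma apply_Bcontfun [simp]:
  fixes g :: "'x \<Rightarrow> complex"
  assumes "continuous_on UNIV g"
  shows "apply_bcontfun (Bcontfun g) = g"
proof -
  have "bounded (range g)"
    by (rule compact_imp_bounded[OF compact_continuous_image[OF assms compact_UNIV]])
  then show ?thesis using assms by (intro Bcontfun_inverse) (simp add: bcontfun_def)
qed

lemma continuous_bcontfun [continuous_intros]:
  fixes f :: "'x \<Rightarrow>\<^sub>C complex"
  shows "continuous_on UNIV (\<lambda>x. f x)"
  by simp

lemma urysohn:
  assumes "closed (S :: 'x set)" "closed T" "S \<inter> T = {}"
  obtains g :: "'x \<Rightarrow> real" where "continuous_on UNIV g" "\<And>x. 0 \<le> g x" "\<And>x. g x \<le> 1"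
    "\<And>x. x \<in> S \<Longrightarrow> g x = 0" "\<And>x. x \<in> T \<Longrightarrow> g x = 1"
proof -
  have "Hausdorff_space (euclidean :: 'x topology)"
    unfolding Hausdorff_space_def disjnt_def using hausdorff[where 'a = 'x] by (simp del: open_openin add: open_openin[symmetric])
  then have "normal_space (euclidean :: 'x topology)"
    using compact_Hausdorff_or_regular_imp_normal_space[of "euclidean :: 'x topology"] compact_UNIV
    by (simp add: compact_space_def)
  then obtain g where g: "continuous_map (euclidean :: 'x topology) (top_of_set {0..1::real}) g"
      "g ` S \<subseteq> {0}" "g ` T \<subseteq> {1}"
    using Urysohn_lemma[of euclidean S T 0 1] assms by (auto simp: disjnt_def)
  then have "continuous_on UNIV g" "\<And>x. g x \<in> {0..1}"
    by (auto simp: continuous_map_in_subtopology)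
  then show ?thesis using g that by fastforce
qed

lemma separating_function:
  assumes "closed (S :: 'x set)" "x \<notin> S"
  obtains f :: "'x \<Rightarrow>\<^sub>C complex" where "f x = 1" "\<And>y. y \<in> S \<Longrightarrow> f y = 0" "\<And>y. cmod (f y) \<le> 1"
proof -
  obtain g :: "'x \<Rightarrow> real" where g: "continuous_on UNIV g" "\<And>x. 0 \<le> g x" "\<And>x. g x \<le> 1"
    "\<And>y. y \<in> S \<Longrightarrow> g y = 0" "g x = 1"
    using urysohn[of S "{x}"] assms by auto
  have "continuous_on UNIV (\<lambda>y. complex_of_real (g y))" using g(1) by (intro continuous_intros)
  then show ?thesis using g by (intro that[of "Bcontfun (\<lambda>y. complex_of_real (g y))"]) simp_all
qed

text \<open>Compactness of the set K where |f| \<ge> e gives finitely many members of J without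
  common zero on K; the sum S of their squared moduli lies in J because J absorbs
  \<open>bc_cnj g\<close>. The functions f n S / (1 + n S) stay in J and approach f: on K because n
  S is large, off K because f is small there.\<close>

lemma C_ideal_contains:
  fixes J :: "('x \<Rightarrow>\<^sub>C complex) set" and f :: "'x \<Rightarrow>\<^sub>C complex"
  assumes closed: "closed J" and zero: "0 \<in> J" and add: "\<And>f g. f \<in> J \<Longrightarrow> g \<in> J \<Longrightarrow> f + g \<in> J"
    and mult: "\<And>f g. f \<in> J \<Longrightarrow> bc_mult g f \<in> J" and f: "\<And>x. x \<in> C_hull J \<Longrightarrow> f x = 0"
  shows "f \<in> J"
proof -
  have "\<exists>g\<in>J. norm (g - f) \<le> e" if e: "0 < e" for e
  proof -
    define K where "K = {x. e \<le> cmod (f x)}"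
    have "closed K" unfolding K_def by (intro closed_Collect_le continuous_intros)
    then have K: "compact K" using compact_Int_closed[OF compact_UNIV, of K] by simp
    have "K \<subseteq> (\<Union>g\<in>J. {x. apply_bcontfun g x \<noteq> 0})"
    proof
      fix x assume "x \<in> K"
      then have "f x \<noteq> 0" using e by (auto simp: K_def)
      then show "x \<in> (\<Union>g\<in>J. {x. apply_bcontfun g x \<noteq> 0})" using f by (auto simp: C_hull_def)
    qed
    moreover have "open {x. apply_bcontfun g x \<noteq> 0}" for g :: "'x \<Rightarrow>\<^sub>C complex"
      by (intro open_Collect_neq continuous_intros)
    ultimately obtain G where G: "G \<subseteq> J" "finite G" "K \<subseteq> (\<Union>g\<in>G. {x. apply_bcontfun g x \<noteq> 0})"
      using compactE_image[OF K, of J "\<lambda>g. {x. apply_bcontfun g x \<noteq> 0}"] by metis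
    define s where "s x = (\<Sum>g\<in>G. (cmod (apply_bcontfun g x))\<^sup>2)" for x
    define S where "S = (\<Sum>g\<in>G. bc_mult (bc_cnj g) g)"
    have S: "S x = of_real (s x)" for x
      by (simp add: S_def s_def complex_norm_square[unfolded of_real_power] mult.commute)
    have "S \<in> J" unfolding S_def using \<open>finite G\<close> \<open>G \<subseteq> J\<close>
      by (induction rule: finite_induct) (auto simp: zero intro!: add mult)
    have s0: "0 \<le> s x" for x unfolding s_def by (simp add: sum_nonneg)
    have s_cont: "continuous_on A s" for A unfolding s_def by (intro continuous_intros continuous_on_apply_bcontfun)
    have "\<exists>m>0. \<forall>x\<in>K. m \<le> s x"
    proof (cases "K = {}")
      case False
      then obtain x0 where x0: "x0 \<in> K" "\<forall>x\<in>K. s x0 \<le> s x"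
        using continuous_attains_inf[OF K _ s_cont] by blast
      obtain g where g: "g \<in> G" "g x0 \<noteq> 0" using x0(1) G(3) by auto
      then have "0 < (cmod (g x0))\<^sup>2" by simp
      also have "\<dots> \<le> s x0" unfolding s_def by (rule member_le_sum[OF g(1) _ G(2)]) simp
      finally show ?thesis using x0(2) by blast
    qed (auto intro: exI[of _ 1])
    then obtain m where m: "0 < m" "\<And>x. x \<in> K \<Longrightarrow> m \<le> s x" by blast
    \<comment> \<open>On K this gives n s \<ge> norm f / e, hence |f| / (1 + n s) \<le> e.\<close>
    define n where "n = norm f / (e * m)"
    have n: "0 \<le> n" using e m by (simp add: n_def)
    have pos: "0 < 1 + n * s x" for x using mult_nonneg_nonneg[OF n s0[of x]] by linarith
    define h where "h = (\<lambda>x. f x * of_real (n / (1 + n * s x)))"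
    have hc: "continuous_on UNIV h"
      unfolding h_def using pos by (intro continuous_intros s_cont) (simp add: less_imp_neq[symmetric])
    define g where "g = bc_mult (Bcontfun h) S"
    have "g \<in> J" unfolding g_def using \<open>S \<in> J\<close> by (rule mult)
    moreover have "norm (g - f) \<le> e"
    proof (rule norm_bound)
      fix x
      have "g x - f x = f x * of_real (n / (1 + n * s x) * s x - 1)"
        by (simp add: g_def S apply_Bcontfun[OF hc]) (simp add: h_def algebra_simps)
      also have "n / (1 + n * s x) * s x - 1 = - 1 / (1 + n * s x)"
        using pos[of x] by (simp add: field_simps)
      finally have eq: "norm ((g - f) x) = cmod (f x) / (1 + n * s x)"
        using pos[of x] by (simp add: norm_mult del: of_real_divide of_real_add of_real_mult of_real_minus)
      show "norm ((g - f) x) \<le> e"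
      proof (cases "x \<in> K")
        case True
        have "norm f / e = n * m" using e m by (simp add: n_def)
        also have "\<dots> \<le> n * s x" using m(2)[OF True] n by (rule mult_left_mono)
        finally have "norm f \<le> e * (n * s x)" using e by (simp add: field_simps)
        then have "cmod (f x) \<le> e * (1 + n * s x)"
          using norm_bounded[of f x] e by (simp add: algebra_simps)
        then show ?thesis unfolding eq using pos[of x] by (simp add: field_simps)
      next
        case False
        have "cmod (f x) / (1 + n * s x) \<le> cmod (f x)"
          using pos[of x] mult_nonneg_nonneg[OF n s0[of x]] by (simp add: divide_le_eq mult_le_cancel_left1)
        then show ?thesis unfolding eq using False by (simp add: K_def)
      qed
    qed
    ultimately show ?thesis by blast
  qed
  then have "\<forall>e>0. \<exists>g\<in>J. dist g f < e"
    by (metis dist_norm field_lbound_gt_zero order_le_less_trans zero_less_one)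
  then show ?thesis using closed_approachable[OF closed] by blast
qed

section \<open>Free actions and partitions of unity\<close>

lemma free_int_iter_neq:
  assumes "free_system \<sigma>" "n \<noteq> 0"
  shows "int_iter \<sigma> n x \<noteq> x"
proof -
  have pos: "int_iter \<sigma> n x \<noteq> x" if "0 < n" for n
    using assms(1) that unfolding free_system_def by (auto simp: int_iter_def dest!: spec[of _ x] spec[of _ "nat n"])
  have "int_iter \<sigma> (- n) x = x" if "int_iter \<sigma> n x = x"
    using int_iter_add[of "- n" n x] that by simp
  then show ?thesis using pos[of n] pos[of "- n"] assms(2) by (cases "0 < n") auto
qed

text \<open>For each of the finitely many n with 0 < |n| \<le> N, disjoint open sets
  \<open>V n\<close> and \<open>W n\<close> separate x from its n-th iterate; intersecting
  \<open>V n\<close> with the preimage of \<open>W n\<close> yields a set that the n-th iterate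
  moves off itself.\<close>

lemma free_neighbourhood:
  assumes "free_system \<sigma>"
  obtains U where "open U" "x \<in> U"
    "\<And>y n. y \<in> U \<Longrightarrow> n \<noteq> 0 \<Longrightarrow> \<bar>n\<bar> \<le> N \<Longrightarrow> int_iter \<sigma> n y \<notin> U"
proof -
  have "\<exists>V W. open V \<and> open W \<and> x \<in> V \<and> int_iter \<sigma> n x \<in> W \<and> V \<inter> W = {}" if "n \<noteq> 0" for n
    using hausdorff[of x "int_iter \<sigma> n x"] free_int_iter_neq[OF assms that, of x] by metis
  then obtain V W where VW: "\<And>n. n \<noteq> 0 \<Longrightarrow> open (V n)" "\<And>n. n \<noteq> 0 \<Longrightarrow> open (W n)"
    "\<And>n. n \<noteq> 0 \<Longrightarrow> x \<in> V n" "\<And>n. n \<noteq> 0 \<Longrightarrow> int_iter \<sigma> n x \<in> W n"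
    "\<And>n. n \<noteq> 0 \<Longrightarrow> V n \<inter> W n = {}"
    by metis
  define U where "U = (\<Inter>n\<in>{- N..N} - {0}. V n \<inter> int_iter \<sigma> n -` W n)"
  have "open U" unfolding U_def
    by (intro open_INT ballI open_Int open_vimage VW continuous_on_int_iter[OF homeo]) auto
  moreover have "x \<in> U" unfolding U_def using VW by auto
  moreover have "int_iter \<sigma> n y \<notin> U" if "y \<in> U" "n \<noteq> 0" "\<bar>n\<bar> \<le> N" for y n
  proof -
    have n: "n \<in> {- N..N} - {0}" using that by auto
    then have "int_iter \<sigma> n y \<in> W n" using that(1) unfolding U_def by blast
    then have "int_iter \<sigma> n y \<notin> V n" using VW(5)[OF that(2)] by auto
    then show ?thesis using n unfolding U_def by auto
  qed
  ultimately show ?thesis by (rule that)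
qed

text \<open>Squares are normalised because each function will multiply an element from both sides.
  Dividing by a positive function preserves the vanishing of the products.\<close>

lemma free_partition_of_unity:
  assumes "free_system \<sigma>"
  obtains A and f :: "'x \<Rightarrow> 'x \<Rightarrow> real" where "finite A" "\<And>i. i \<in> A \<Longrightarrow> continuous_on UNIV (f i)"
    "\<And>x. (\<Sum>i\<in>A. (f i x)\<^sup>2) = 1"
    "\<And>i x n. i \<in> A \<Longrightarrow> n \<noteq> 0 \<Longrightarrow> \<bar>n\<bar> \<le> N \<Longrightarrow> f i x * f i (int_iter \<sigma> n x) = 0"
proof -
  have "\<exists>h :: 'x \<Rightarrow> real. continuous_on UNIV h \<and> h x > 0 \<and>
      (\<forall>y n. n \<noteq> 0 \<and> \<bar>n\<bar> \<le> N \<longrightarrow> h y * h (int_iter \<sigma> n y) = 0)" for x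
  proof -
    obtain U where U: "open U" "x \<in> U"
      "\<And>y n. y \<in> U \<Longrightarrow> n \<noteq> 0 \<Longrightarrow> \<bar>n\<bar> \<le> N \<Longrightarrow> int_iter \<sigma> n y \<notin> U"
      using free_neighbourhood[OF assms] by blast
    obtain g :: "'x \<Rightarrow> real" where "continuous_on UNIV g" "\<And>y. 0 \<le> g y" "\<And>y. g y \<le> 1"
        "\<And>y. y \<in> - U \<Longrightarrow> g y = 0" "\<And>y. y \<in> {x} \<Longrightarrow> g y = 1"
      by (rule urysohn[of "- U" "{x}"]) (use U in auto)
    then have g: "continuous_on UNIV g" "\<And>y. y \<in> - U \<Longrightarrow> g y = 0" "g x = 1" by auto
    have "g y * g (int_iter \<sigma> n y) = 0" if "n \<noteq> 0" "\<bar>n\<bar> \<le> N" for y n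
      using g(2)[of y] g(2)[of "int_iter \<sigma> n y"] U(3)[of y n] that by auto
    then show ?thesis using g by (intro exI[of _ g]) simp
  qed
  then obtain h :: "'x \<Rightarrow> 'x \<Rightarrow> real" where h: "\<And>x. continuous_on UNIV (h x)" "\<And>x. h x x > 0"
      "\<And>x y n. n \<noteq> 0 \<Longrightarrow> \<bar>n\<bar> \<le> N \<Longrightarrow> h x y * h x (int_iter \<sigma> n y) = 0"
    by metis
  have op: "open {y. h x y > 0}" for x
    by (intro open_Collect_less continuous_intros h)
  have cov: "UNIV \<subseteq> (\<Union>x\<in>UNIV. {y. h x y > 0})" using h(2) by auto
  obtain A where A: "finite A" "UNIV \<subseteq> (\<Union>x\<in>A. {y. h x y > 0})"
    by (rule compactE_image[OF compact_UNIV op cov]) simp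
  define s where "s y = (\<Sum>x\<in>A. (h x y)\<^sup>2)" for y
  have s: "0 < s y" for y
  proof -
    obtain x where "x \<in> A" "h x y > 0" using A(2) by blast
    then have "0 < (h x y)\<^sup>2" by simp
    also have "\<dots> \<le> s y" unfolding s_def by (rule member_le_sum) (use A \<open>x \<in> A\<close> in auto)
    finally show ?thesis .
  qed
  show ?thesis
  proof (rule that[of A "\<lambda>x y. h x y / sqrt (s y)"])
    have "continuous_on UNIV s" unfolding s_def by (intro continuous_intros h)
    then show "continuous_on UNIV (\<lambda>y. h x y / sqrt (s y))" for x
      using s by (intro continuous_intros h) (auto simp: less_imp_neq[symmetric])
    show "(\<Sum>x\<in>A. (h x y / sqrt (s y))\<^sup>2) = 1" for y
      using s[of y] by (simp add: power_divide flip: sum_divide_distrib) (simp add: s_def)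
    show "h x y / sqrt (s y) * (h x (int_iter \<sigma> n y) / sqrt (s (int_iter \<sigma> n y))) = 0"
      if "n \<noteq> 0" "\<bar>n\<bar> \<le> N" for x y n
      using h(3)[OF that, of x y] by auto
  qed (rule A)
qed

subsection \<open>Hulls and kernels\<close>

lemma closed_ideal_closed: "closed_ideal \<sigma> I \<Longrightarrow> closed I"
  by (simp add: closed_ideal_def)

lemma closed_ideal_simps:
  assumes "closed_ideal \<sigma> I"
  shows "0 \<in> I" "a \<in> I \<Longrightarrow> b \<in> I \<Longrightarrow> a + b \<in> I" "a \<in> I \<Longrightarrow> ell1_scaleC c a \<in> I"
    "a \<in> I \<Longrightarrow> ell1_mult \<sigma> d a \<in> I" "a \<in> I \<Longrightarrow> ell1_mult \<sigma> a d \<in> I"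
  using assms by (simp_all add: closed_ideal_def ell1_ideal_def)

lemma closed_ideal_sum:
  assumes "closed_ideal \<sigma> I" "\<And>i. i \<in> A \<Longrightarrow> f i \<in> I"
  shows "sum f A \<in> I"
  using assms(2) by (induction A rule: infinite_finite_induct) (auto intro: closed_ideal_simps[OF assms(1)])

lemma closed_idealI_approx:
  assumes "closed_ideal \<sigma> I" "\<And>e. 0 < e \<Longrightarrow> \<exists>b\<in>I. norm (b - a) < e"
  shows "a \<in> I"
  using closed_approachable[OF closed_ideal_closed[OF assms(1)], of a] assms(2) by (simp add: dist_norm)

section \<open>Truncation and averaging\<close>

lemma ell1_tail_small:
  assumes "0 < e"
  obtains F where "finite F" "norm a - (\<Sum>n\<in>F. norm (ell1_coeff a n)) < e"
proof -
  have "\<forall>\<^sub>F F in finite_subsets_at_top UNIV. dist (\<Sum>n\<in>F. norm (ell1_coeff a n)) (norm a) < e"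
    using norm_ell1_has_sum[of a] assms unfolding has_sum_def by (rule tendstoD)
  then obtain F where "finite F" "dist (\<Sum>n\<in>F. norm (ell1_coeff a n)) (norm a) < e"
    unfolding eventually_finite_subsets_at_top by blast
  then show ?thesis by (intro that[of F]) (auto simp: dist_real_def)
qed

text \<open>Serves two approximations: of E(a) by averages, and of a by its finite truncations. In
  both, the error has no coefficients in F and is dominated by a elsewhere.\<close>

lemma norm_ell1_le_tail:
  assumes "finite F" "\<And>n. n \<in> F \<Longrightarrow> ell1_coeff d n = 0"
    "\<And>n. n \<notin> F \<Longrightarrow> norm (ell1_coeff d n) \<le> norm (ell1_coeff a n)"
  shows "norm d \<le> norm a - (\<Sum>n\<in>F. norm (ell1_coeff a n))"
proof (rule norm_ell1_leI)
  fix G :: "int set" assume G: "finite G"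
  have "(\<Sum>n\<in>G. norm (ell1_coeff d n)) = (\<Sum>n\<in>G - F. norm (ell1_coeff d n))"
    by (rule sum.mono_neutral_right) (use G assms in auto)
  also have "\<dots> \<le> (\<Sum>n\<in>G - F. norm (ell1_coeff a n))"
    by (rule sum_mono) (use assms in auto)
  also have "\<dots> = (\<Sum>n\<in>G \<union> F. norm (ell1_coeff a n)) - (\<Sum>n\<in>F. norm (ell1_coeff a n))"
    using G assms(1) by (subst sum_diff[symmetric]) (auto intro: arg_cong2[where f = sum])
  also have "\<dots> \<le> norm a - (\<Sum>n\<in>F. norm (ell1_coeff a n))"
    using G assms(1) by (simp add: sum_norm_ell1_coeff_le)
  finally show "(\<Sum>n\<in>G. norm (ell1_coeff d n)) \<le> norm a - (\<Sum>n\<in>F. norm (ell1_coeff a n))" .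
qed

text \<open>Averaging \<open>f a f\<close> over functions \<open>f\<close> whose squares sum to \<open>1\<close> and whose supports are moved off
  themselves by \<open>\<sigma>\<^sup>n\<close>, \<open>0 < |n| \<le> N\<close>, keeps \<open>a\<^sub>0\<close> and deletes these coefficients.\<close>

lemma free_imp_well_behaved:
  assumes free: "free_system \<sigma>" and I: "closed_ideal \<sigma> I"
  shows "well_behaved I"
proof -
  have "ell1_of_C (ell1_E a) \<in> I" if a: "a \<in> I" for a
  proof (rule closed_idealI_approx[OF I])
    fix e :: real assume "0 < e"
    then obtain F where F: "finite F" "norm a - (\<Sum>n\<in>F. norm (ell1_coeff a n)) < e"
      by (rule ell1_tail_small)
    define N where "N = Max (insert 0 (abs ` F))"
    have N: "\<bar>n\<bar> \<le> N" if "n \<in> F" for n unfolding N_def using F(1) that by (intro Max_ge) auto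
    obtain A and f :: "'x \<Rightarrow> 'x \<Rightarrow> real" where A: "finite A" "\<And>i. i \<in> A \<Longrightarrow> continuous_on UNIV (f i)"
      "\<And>x. (\<Sum>i\<in>A. (f i x)\<^sup>2) = 1"
      "\<And>i x n. i \<in> A \<Longrightarrow> n \<noteq> 0 \<Longrightarrow> \<bar>n\<bar> \<le> N \<Longrightarrow> f i x * f i (int_iter \<sigma> n x) = 0"
      using free_partition_of_unity[OF free] by blast
    define g where "g i = ell1_single 0 (Bcontfun (\<lambda>x. complex_of_real (f i x)))" for i
    have g: "ell1_mult \<sigma> (ell1_mult \<sigma> (g i) a) (g i) \<in> I" for i
      by (intro closed_ideal_simps[OF I] a)
    define b where "b = (\<Sum>i\<in>A. ell1_mult \<sigma> (ell1_mult \<sigma> (g i) a) (g i))"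
    define c where "c n x = (\<Sum>i\<in>A. f i x * f i (int_iter \<sigma> (- n) x))" for n x
    have cg: "continuous_on UNIV (\<lambda>x. complex_of_real (f i x))" if "i \<in> A" for i
      using A(2)[OF that] by (intro continuous_intros)
    have b: "ell1_coeff b n x = ell1_coeff a n x * of_real (c n x)" for n x
      unfolding b_def c_def of_real_sum sum_distrib_left ell1_coeff_sum sum_bcontfun_apply
      by (rule sum.cong[OF refl])
        (simp add: g_def coeff_mult_single_left coeff_mult_single_right cg A(2))
    \<comment> \<open>By the inequality between geometric and arithmetic mean and the normalisation
      at both points, averaging enlarges no coefficient; those outside F therefore stay within the
      tail of a.\<close>
    have c1: "\<bar>c n x\<bar> \<le> 1" for n x
    proof -
      have "\<bar>c n x\<bar> \<le> (\<Sum>i\<in>A. \<bar>f i x * f i (int_iter \<sigma> (- n) x)\<bar>)" unfolding c_def by (rule sum_abs)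
      also have "\<dots> \<le> (\<Sum>i\<in>A. ((f i x)\<^sup>2 + (f i (int_iter \<sigma> (- n) x))\<^sup>2) / 2)"
      proof (rule sum_mono)
        fix i
        show "\<bar>f i x * f i (int_iter \<sigma> (- n) x)\<bar> \<le> ((f i x)\<^sup>2 + (f i (int_iter \<sigma> (- n) x))\<^sup>2) / 2"
          using sum_squares_bound[of "\<bar>f i x\<bar>" "\<bar>f i (int_iter \<sigma> (- n) x)\<bar>"] by (simp add: abs_mult)
      qed
      also have "\<dots> = 1" by (simp add: sum.distrib A flip: sum_divide_distrib)
      finally show ?thesis .
    qed
    have c2: "c 0 x = 1" for x unfolding c_def using A(3)[of x] by (simp add: power2_eq_square)
    have c3: "c n x = 0" if "n \<in> F" "n \<noteq> 0" for n x
      unfolding c_def using A(4)[of _ "- n" x] N[OF that(1)] that(2) by (intro sum.neutral) simp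
    define d where "d = b - ell1_of_C (ell1_E a)"
    have d: "ell1_coeff d n x = (if n = 0 then 0 else ell1_coeff a n x * of_real (c n x))" for n x
      by (simp add: d_def b ell1_of_C_def ell1_E_def c2)
    have "norm d \<le> norm a - (\<Sum>n\<in>F. norm (ell1_coeff a n))"
    proof (rule norm_ell1_le_tail[OF F(1)])
      show "ell1_coeff d n = 0" if "n \<in> F" for n
        using c3[OF that] by (intro bcontfun_eqI) (simp add: d)
      show "norm (ell1_coeff d n) \<le> norm (ell1_coeff a n)" for n
      proof (rule norm_bound)
        fix x
        have "cmod (ell1_coeff a n x) * \<bar>c n x\<bar> \<le> norm (ell1_coeff a n) * 1"
          by (intro mult_mono c1 norm_bounded) auto
        then show "norm (ell1_coeff d n x) \<le> norm (ell1_coeff a n)" by (simp add: d norm_mult)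
      qed
    qed
    then show "\<exists>b\<in>I. norm (b - ell1_of_C (ell1_E a)) < e"
      using F(2) closed_ideal_sum[OF I g] by (intro bexI[of _ b]) (auto simp: d_def b_def)
  qed
  then show ?thesis by (auto simp: well_behaved_def)
qed

section \<open>Ideals determined by their hulls\<close>

lemma ell1_E_shift: "ell1_E (ell1_mult \<sigma> a (ell1_single (- n) (const_bcontfun 1))) = ell1_coeff a n"
  by (rule bcontfun_eqI) (simp add: ell1_E_def coeff_mult_single_right)

text \<open>Right multiplication by \<delta>^(-n) brings the n-th coefficient to position 0 without
  twisting it, so E(I) already contains all coefficients of elements of I.\<close>

lemma C_hull_E: "closed_ideal \<sigma> I \<Longrightarrow> C_hull (ell1_E ` I) = ell1_hull I"
  unfolding C_hull_def ell1_hull_def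
  using closed_ideal_simps(5)[of I] ell1_E_shift by (auto simp: ell1_E_def) metis

text \<open>Good behaviour places every coefficient of an element of I in the closed ideal J, the
  intersection of I with C(X); hence the hull of J lies in the hull of I. An element of the kernel
  of that hull therefore has its coefficients in J by \<open>C_ideal_contains\<close>, its finite
  truncations lie in I, and I is closed.\<close>

lemma kernel_hull:
  assumes I: "closed_ideal \<sigma> I" and wb: "well_behaved I"
  shows "ell1_kernel (ell1_hull I) = I"
proof
  show "I \<subseteq> ell1_kernel (ell1_hull I)" by (auto simp: ell1_kernel_def ell1_hull_def)
  define J where "J = {f. ell1_of_C f \<in> I}"
  have coeff: "ell1_coeff a n \<in> J" if "a \<in> I" for a n
  proof -
    have "ell1_of_C (ell1_E (ell1_mult \<sigma> a (ell1_single (- n) (const_bcontfun 1)))) \<in> I"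
      using wb closed_ideal_simps(5)[OF I that] unfolding well_behaved_def by blast
    then show ?thesis by (simp add: J_def ell1_E_shift)
  qed
  have lin: "bounded_linear (ell1_of_C :: ('x \<Rightarrow>\<^sub>C complex) \<Rightarrow> _)"
    unfolding ell1_of_C_def by (rule bounded_linear_intro[where K = 1]) (auto intro!: ell1_eqI)
  have J: "closed J" "0 \<in> J" "\<And>f g. f \<in> J \<Longrightarrow> g \<in> J \<Longrightarrow> f + g \<in> J"
    "\<And>f g. f \<in> J \<Longrightarrow> bc_mult g f \<in> J"
  proof -
    show "closed J"
      using continuous_closed_vimage[OF closed_ideal_closed[OF I], of ell1_of_C]
        linear_continuous_at[OF lin] by (simp add: J_def vimage_def)
    show "0 \<in> J" using linear_0[OF bounded_linear.linear[OF lin]] closed_ideal_simps(1)[OF I]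
      by (simp add: J_def)
    show "f + g \<in> J" if "f \<in> J" "g \<in> J" for f g
      using linear_add[OF bounded_linear.linear[OF lin]] closed_ideal_simps(2)[OF I] that
      by (simp add: J_def)
    have "ell1_of_C (bc_mult g f) = ell1_mult \<sigma> (ell1_of_C g) (ell1_of_C f)" for f g :: "'x \<Rightarrow>\<^sub>C complex"
      by (intro ell1_eqI bcontfun_eqI) (simp add: ell1_of_C_def coeff_mult_single_left)
    then show "bc_mult g f \<in> J" if "f \<in> J" for f g
      using closed_ideal_simps(4)[OF I] that by (simp add: J_def)
  qed
  show "ell1_kernel (ell1_hull I) \<subseteq> I"
  proof
    fix a assume a: "a \<in> ell1_kernel (ell1_hull I)"
    have aJ: "ell1_coeff a n \<in> J" for n
    proof (rule C_ideal_contains[OF J])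
      fix x assume "x \<in> C_hull J"
      then have "x \<in> ell1_hull I" using coeff by (auto simp: C_hull_def ell1_hull_def)
      then show "ell1_coeff a n x = 0" using a by (simp add: ell1_kernel_def)
    qed
    have single: "ell1_single n (ell1_coeff a n) \<in> I" for n
    proof -
      have "ell1_single n (ell1_coeff a n)
          = ell1_mult \<sigma> (ell1_of_C (ell1_coeff a n)) (ell1_single n (const_bcontfun 1))"
        by (intro ell1_eqI bcontfun_eqI) (simp add: ell1_of_C_def coeff_mult_single_left)
      then show ?thesis using aJ[of n] closed_ideal_simps(5)[OF I] by (simp add: J_def)
    qed
    show "a \<in> I"
    proof (rule closed_idealI_approx[OF I])
      fix e :: real assume "0 < e"
      then obtain F where F: "finite F" "norm a - (\<Sum>n\<in>F. norm (ell1_coeff a n)) < e"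
        by (rule ell1_tail_small)
      let ?b = "\<Sum>n\<in>F. ell1_single n (ell1_coeff a n)"
      have b: "ell1_coeff ?b n = (if n \<in> F then ell1_coeff a n else 0)" for n
        using F(1) by (simp add: sum.delta')
      have "norm (?b - a) \<le> norm a - (\<Sum>n\<in>F. norm (ell1_coeff a n))"
        by (rule norm_ell1_le_tail[OF F(1)]) (simp_all add: b del: ell1_coeff_sum)
      then show "\<exists>b\<in>I. norm (b - a) < e"
        using F(2) closed_ideal_sum[OF I single] by (intro bexI[of _ ?b]) auto
    qed
  qed
qed

text \<open>Left multiplication by \<delta>^(-k) does twist: it carries the value of a coefficient
  at \<open>int_iter \<sigma> k x\<close> to x. This moves points of the hull along their
  orbits.\<close>

lemma invariant_hull:
  assumes I: "closed_ideal \<sigma> I"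
  shows "invariant_closed \<sigma> (ell1_hull I)"
  unfolding invariant_closed_def
proof
  have "ell1_hull I = (\<Inter>a\<in>I. \<Inter>n. {x. ell1_coeff a n x = 0})" by (auto simp: ell1_hull_def)
  moreover have "closed {x. ell1_coeff a n x = 0}" for a :: "'x ell1" and n
    by (intro closed_Collect_eq continuous_intros)
  ultimately show "closed (ell1_hull I)" by (auto intro!: closed_INT)
  have shift: "int_iter \<sigma> k x \<in> ell1_hull I" if x: "x \<in> ell1_hull I" for k x
    unfolding ell1_hull_def
  proof (intro CollectI ballI allI)
    fix a n assume "a \<in> I"
    let ?b = "ell1_mult \<sigma> (ell1_single (- k) (const_bcontfun 1)) a"
    have "?b \<in> I" using \<open>a \<in> I\<close> by (rule closed_ideal_simps[OF I])
    then have "ell1_coeff ?b (n - k) x = 0" using x unfolding ell1_hull_def by blast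
    then show "ell1_coeff a n (int_iter \<sigma> k x) = 0" by (simp add: coeff_mult_single_left)
  qed
  show "\<sigma> ` ell1_hull I = ell1_hull I"
  proof (intro subset_antisym subsetI)
    show "x \<in> ell1_hull I" if "x \<in> \<sigma> ` ell1_hull I" for x
      using shift[of _ 1] that by auto
    show "x \<in> \<sigma> ` ell1_hull I" if "x \<in> ell1_hull I" for x
      using shift[OF that, of "- 1"] int_iter_succ[of "- 1" x] by (intro image_eqI) simp_all
  qed
qed

lemma invariant_closed_iter:
  assumes "invariant_closed \<sigma> S" "x \<in> S"
  shows "int_iter \<sigma> k x \<in> S"
proof (induction k rule: int_induct[of _ 0])
  case (step1 i)
  then show ?case using assms(1) int_iter_succ[of i x] by (auto simp: invariant_closed_def)
next
  case (step2 i)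
  then obtain y where "y \<in> S" "int_iter \<sigma> i x = \<sigma> y"
    using assms(1) by (auto simp: invariant_closed_def)
  then show ?case using int_iter_succ[of "i - 1" x] by (metis diff_add_cancel sigma_inv(2))
qed (simp add: assms)

lemma closed_ideal_kernel_iter:
  assumes S: "\<And>x k. x \<in> S \<Longrightarrow> int_iter \<sigma> k x \<in> S"
  shows "closed_ideal \<sigma> (ell1_kernel S)"
  unfolding closed_ideal_def ell1_ideal_def
proof (intro conjI ballI allI)
  show "ell1_mult \<sigma> b a \<in> ell1_kernel S" if "a \<in> ell1_kernel S" for a b
    unfolding ell1_kernel_def
  proof (intro CollectI allI ballI)
    fix n x assume "x \<in> S"
    then have "ell1_coeff a (n - k) (int_iter \<sigma> (- k) x) = 0" for k
      using that S by (auto simp: ell1_kernel_def)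
    then show "ell1_coeff (ell1_mult \<sigma> b a) n x = 0"
      using ell1_mult_apply_has_sum[of b x a n] has_sum_unique[OF _ has_sum_0] by auto
  qed
  show "ell1_mult \<sigma> a b \<in> ell1_kernel S" if "a \<in> ell1_kernel S" for a b
    unfolding ell1_kernel_def
  proof (intro CollectI allI ballI)
    fix n x assume "x \<in> S"
    then have "ell1_coeff a k x = 0" for k using that by (auto simp: ell1_kernel_def)
    then show "ell1_coeff (ell1_mult \<sigma> a b) n x = 0"
      using ell1_mult_apply_has_sum[of a x b n] has_sum_unique[OF _ has_sum_0] by auto
  qed
  have lin: "bounded_linear (\<lambda>a. ell1_coeff a n x)" for n and x :: 'x
    by (rule bounded_linear_intro[where K = 1])
      (auto intro: order_trans[OF cmod_ell1_coeff_le norm_ell1_coeff_le])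
  have "closed {a. ell1_coeff a n x = 0}" for n and x :: 'x
    by (intro closed_Collect_eq continuous_intros linear_continuous_on lin)
  moreover have "ell1_kernel S = (\<Inter>n. \<Inter>x\<in>S. {a. ell1_coeff a n x = 0})"
    by (auto simp: ell1_kernel_def)
  ultimately show "closed (ell1_kernel S)" by auto
qed (auto simp: ell1_kernel_def)

lemma closed_ideal_kernel: "invariant_closed \<sigma> S \<Longrightarrow> closed_ideal \<sigma> (ell1_kernel S)"
  by (rule closed_ideal_kernel_iter) (rule invariant_closed_iter)

lemma hull_kernel:
  assumes "closed (S :: 'x set)"
  shows "ell1_hull (ell1_kernel S) = S"
proof
  show "S \<subseteq> ell1_hull (ell1_kernel S)" by (auto simp: ell1_kernel_def ell1_hull_def)
  show "ell1_hull (ell1_kernel S) \<subseteq> S"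
  proof
    fix x assume x: "x \<in> ell1_hull (ell1_kernel S)"
    show "x \<in> S"
    proof (rule ccontr)
      assume "x \<notin> S"
      then obtain f :: "'x \<Rightarrow>\<^sub>C complex" where f: "f x = 1" "\<And>y. y \<in> S \<Longrightarrow> f y = 0"
        using separating_function[OF assms] by metis
      then have "ell1_single 0 f \<in> ell1_kernel S" by (simp add: ell1_kernel_def)
      then have "ell1_coeff (ell1_single 0 f) 0 x = 0" using x unfolding ell1_hull_def by blast
      then show False using f by simp
    qed
  qed
qed

section \<open>Self-adjoint ideals and the bijections\<close>

lemma self_adjointI:
  assumes "\<And>a. a \<in> I \<Longrightarrow> ell1_star \<sigma> a \<in> I"
  shows "self_adjoint_ideal \<sigma> I"
  unfolding self_adjoint_ideal_def using assms by (metis ell1_star_star image_iff subsetI subset_antisym)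

lemma self_adjointD: "self_adjoint_ideal \<sigma> I \<Longrightarrow> a \<in> I \<Longrightarrow> ell1_star \<sigma> a \<in> I"
  unfolding self_adjoint_ideal_def by blast

lemma self_adjoint_kernel:
  assumes "\<And>x k. x \<in> S \<Longrightarrow> int_iter \<sigma> k x \<in> S"
  shows "self_adjoint_ideal \<sigma> (ell1_kernel S)"
  by (rule self_adjointI) (use assms in \<open>auto simp: ell1_kernel_def coeff_star_apply\<close>)

lemma well_behaved_imp_inverse_bijections:
  assumes "\<forall>I. closed_ideal \<sigma> I \<longrightarrow> well_behaved I"
  shows "bij_betw ell1_hull {I. closed_ideal \<sigma> I} {S. invariant_closed \<sigma> S} \<and>
    bij_betw ell1_kernel {S. invariant_closed \<sigma> S} {I. closed_ideal \<sigma> I} \<and>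
    (\<forall>I. closed_ideal \<sigma> I \<longrightarrow> ell1_kernel (ell1_hull I) = I) \<and>
    (\<forall>S. invariant_closed \<sigma> S \<longrightarrow> ell1_hull (ell1_kernel S) = S)"
proof -
  have 1: "ell1_kernel (ell1_hull I) = I" if "closed_ideal \<sigma> I" for I
    using kernel_hull[OF that] assms that by blast
  have 2: "ell1_hull (ell1_kernel S) = S" if "invariant_closed \<sigma> S" for S
    using hull_kernel[of S] that by (simp add: invariant_closed_def)
  have "bij_betw ell1_hull {I. closed_ideal \<sigma> I} {S. invariant_closed \<sigma> S}"
    by (rule bij_betwI[where g = ell1_kernel]) (use 1 2 invariant_hull closed_ideal_kernel in auto)
  moreover have "bij_betw ell1_kernel {S. invariant_closed \<sigma> S} {I. closed_ideal \<sigma> I}"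
    by (rule bij_betwI[where g = ell1_hull]) (use 1 2 invariant_hull closed_ideal_kernel in auto)
  ultimately show ?thesis using 1 2 by blast
qed

end

subsection \<open>Automatic continuity of involutive representations\<close>

context complex_hilbert_space
begin

lemma scale_zero: "v \<in> hcarrier H \<Longrightarrow> hscale H 0 v = hzero H"
  using scale_add_left[of v 1 "- 1"] add_neg[of v] by (simp add: scale_one)

lemma scale_hzero: "hscale H c (hzero H) = hzero H"
  using scale_scale[of "hzero H" c 0] by (simp add: scale_zero)

lemma inner_hzero: "w \<in> hcarrier H \<Longrightarrow> hinner H (hzero H) w = 0" "w \<in> hcarrier H \<Longrightarrow> hinner H w (hzero H) = 0"
  using inner_scale_left[of w w 0] inner_scale_right[of w w 0] by (simp_all add: scale_zero)

lemma hnorm_sq: "v \<in> hcarrier H \<Longrightarrow> (hnorm H v)\<^sup>2 = Re (hinner H v v)"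
  by (simp add: hnorm_def inner_nonneg)

lemma hnorm_nonneg: "v \<in> hcarrier H \<Longrightarrow> 0 \<le> hnorm H v"
  by (simp add: hnorm_def inner_nonneg)

lemma hnorm_hzero: "hnorm H (hzero H) = 0"
  by (simp add: hnorm_def inner_hzero)

lemma hnorm_eq_0D:
  assumes "v \<in> hcarrier H" "hnorm H v = 0"
  shows "v = hzero H"
proof -
  have "Re (hinner H v v) = 0" using hnorm_sq[OF assms(1)] assms(2) by simp
  moreover have "Im (hinner H v v) = 0" using inner_cnj[OF assms(1) assms(1)] by (simp add: complex_eq_iff)
  ultimately show ?thesis using inner_definite[OF assms(1)] by (simp add: complex_eq_iff)
qed

text \<open>With p, q the norms of v, w, the squared norm of q v - p w equals 2 p q (p q - Re <v,
  w>), and it is nonnegative.\<close>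

lemma Re_inner_le:
  assumes "v \<in> hcarrier H" "w \<in> hcarrier H"
  shows "Re (hinner H v w) \<le> hnorm H v * hnorm H w"
proof (cases "hnorm H v = 0 \<or> hnorm H w = 0")
  case True
  then show ?thesis using assms hnorm_eq_0D inner_hzero hnorm_hzero by fastforce
next
  case False
  define p where "p = hnorm H v"
  define q where "q = hnorm H w"
  have pos: "0 < p * q" using False hnorm_nonneg assms by (simp add: p_def q_def order_less_le)
  let ?z = "hadd H (hscale H (of_real q) v) (hscale H (- of_real p) w)"
  have "0 \<le> Re (hinner H ?z ?z)" using assms by (intro inner_nonneg) simp
  also have "Re (hinner H ?z ?z) = 2 * (p * q) * (p * q - Re (hinner H v w))"
    using Re_inner_commute[OF assms]
    by (simp add: assms inner_add_left inner_add_right inner_scale_left inner_scale_right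
        algebra_simps power2_eq_square flip: p_def q_def
        hnorm_sq[OF assms(1), unfolded power2_eq_square] hnorm_sq[OF assms(2), unfolded power2_eq_square])
  finally show ?thesis using pos by (simp add: p_def q_def zero_le_mult_iff)
qed

end

locale star_rep = homeo_system \<sigma> + complex_hilbert_space H
  for \<sigma> :: "'x::topological_space \<Rightarrow> 'x" and H :: "'h hspace" +
  fixes \<pi> :: "'x ell1 \<Rightarrow> 'h \<Rightarrow> 'h"
  assumes rep: "unital_star_rep \<sigma> H \<pi>"
begin

lemma rep_simps:
  assumes "v \<in> hcarrier H"
  shows "\<pi> a v \<in> hcarrier H" "\<pi> (a + b) v = hadd H (\<pi> a v) (\<pi> b v)"
    "\<pi> (ell1_scaleC c a) v = hscale H c (\<pi> a v)" "\<pi> (ell1_mult \<sigma> a b) v = \<pi> a (\<pi> b v)"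
    "w \<in> hcarrier H \<Longrightarrow> hinner H (\<pi> a v) w = hinner H v (\<pi> (ell1_star \<sigma> a) w)"
    "\<pi> ell1_one v = v" "\<pi> a (hscale H c v) = hscale H c (\<pi> a v)"
  using rep assms by (simp_all add: unital_star_rep_def bounded_operator_def)

lemma rep_hzero: "\<pi> a (hzero H) = hzero H"
  using rep_simps(7)[of "hzero H" a 0] rep_simps(1)[of "hzero H" a] by (simp add: scale_hzero scale_zero)

lemma rep_bounded: "\<exists>C. \<forall>v\<in>hcarrier H. hnorm H (\<pi> a v) \<le> C * hnorm H v"
  using rep by (simp add: unital_star_rep_def bounded_operator_def)

text \<open>If the operator norm \<open>M\<close> of \<open>\<pi>(a)\<close> exceeded \<open>\<parallel>a\<parallel>\<close>, then \<open>1 - a\<^sup>*a/M\<^sup>2\<close> would be invertible by the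
  Neumann series, while \<open>\<pi>(1 - a\<^sup>*a/M\<^sup>2)\<close> is not bounded below.\<close>

lemma rep_contractive:
  assumes v: "v \<in> hcarrier H"
  shows "hnorm H (\<pi> a v) \<le> norm a * hnorm H v"
proof -
  define B where "B = {C. 0 \<le> C \<and> (\<forall>v\<in>hcarrier H. hnorm H (\<pi> a v) \<le> C * hnorm H v)}"
  define M where "M = Inf B"
  obtain C where C: "\<forall>v\<in>hcarrier H. hnorm H (\<pi> a v) \<le> C * hnorm H v" using rep_bounded by blast
  have CB: "max C 0 \<in> B"
  proof -
    have "C * hnorm H v \<le> max C 0 * hnorm H v" if "v \<in> hcarrier H" for v
      using hnorm_nonneg[OF that] by (intro mult_right_mono) auto
    then show ?thesis unfolding B_def using C by (auto intro: order_trans)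
  qed
  have bdd: "bdd_below B" by (rule bdd_belowI[of _ 0]) (simp add: B_def)
  have M: "hnorm H (\<pi> a v) \<le> M * hnorm H v" if v: "v \<in> hcarrier H" for v
  proof (cases "hnorm H v = 0")
    case True
    then show ?thesis using C v by fastforce
  next
    case False
    then have pos: "0 < hnorm H v" using hnorm_nonneg[OF v] by simp
    have "hnorm H (\<pi> a v) / hnorm H v \<le> M"
      unfolding M_def
    proof (rule cInf_greatest)
      show "B \<noteq> {}" using CB by auto
    qed (use v pos in \<open>auto simp: B_def divide_le_eq\<close>)
    then show ?thesis using pos by (simp add: divide_le_eq)
  qed
  have "M \<le> norm a"
  proof (rule ccontr)
    assume "\<not> M \<le> norm a"
    then have Ma: "norm a < M" by simp
    then have M0: "0 < M" using norm_ge_zero[of a] by linarith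
    define s where "s = ell1_star \<sigma> a"
    \<comment> \<open>The adjoint inherits the bound M: the squared norm of \<open>\<pi> s w\<close>
      is the real part of the inner product of \<open>\<pi> a (\<pi> s w)\<close> with
      \<open>w\<close>.\<close>
    have s: "hnorm H (\<pi> s w) \<le> M * hnorm H w" if w: "w \<in> hcarrier H" for w
    proof (cases "hnorm H (\<pi> s w) = 0")
      case True
      then show ?thesis using M0 hnorm_nonneg[OF w] by simp
    next
      case False
      have u: "\<pi> s w \<in> hcarrier H" using w by (rule rep_simps)
      then have pos: "0 < hnorm H (\<pi> s w)" using hnorm_nonneg[OF u] False by simp
      have "(hnorm H (\<pi> s w))\<^sup>2 = Re (hinner H (\<pi> a (\<pi> s w)) w)"
        using u w by (simp add: hnorm_sq rep_simps(5) s_def)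
      also have "\<dots> \<le> hnorm H (\<pi> a (\<pi> s w)) * hnorm H w"
        using u w rep_simps(1) by (intro Re_inner_le)
      also have "\<dots> \<le> M * hnorm H (\<pi> s w) * hnorm H w"
        using M[OF u] hnorm_nonneg[OF w] by (rule mult_right_mono)
      finally show ?thesis using pos by (simp add: power2_eq_square mult.assoc mult.left_commute)
    qed
    define r where "r = 1 / M\<^sup>2"
    define c where "c = ell1_scaleC (of_real r) (ell1_mult \<sigma> s a)"
    have "norm (ell1_mult \<sigma> s a) \<le> norm a * norm a"
      using norm_ell1_mult_le[of s a] mult_right_mono[OF norm_ell1_star_le[of a] norm_ge_zero[of a]]
      by (simp add: s_def)
    also have "\<dots> < M * M" using Ma M0 by (intro mult_strict_mono) auto
    finally have "norm c < 1" using M0 by (simp add: c_def r_def norm_divide norm_mult power2_eq_square field_simps)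
    then obtain b where b: "ell1_mult \<sigma> b (ell1_one - c) = ell1_one" by (rule neumann_left_inverse)
    obtain D' where D': "\<forall>v\<in>hcarrier H. hnorm H (\<pi> b v) \<le> D' * hnorm H v" using rep_bounded by blast
    define D where "D = max D' 1"
    have D1: "1 \<le> D" by (simp add: D_def)
    have D: "hnorm H (\<pi> b v) \<le> D * hnorm H v" if "v \<in> hcarrier H" for v
      using D' that mult_right_mono[OF _ hnorm_nonneg[OF that], of D' D] by (force simp: D_def)
    \<comment> \<open>For u = \<pi>(1 - c) v the left inverse forces |v| \<le> D |u|, while |u|^2
      \<le> |v|^2 - |\<pi>(a) v|^2 / M^2. Together |\<pi>(a) v| \<le> M q |v| with q < 1, against
      the choice of M as an infimum. The radicand is nonnegative because D \<ge> 1.\<close>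
    define q where "q = sqrt (1 - 1 / D\<^sup>2)"
    have D2: "1 \<le> D\<^sup>2" using D1 by (simp add: one_le_power)
    then have q: "0 \<le> q" "q < 1" "q\<^sup>2 = 1 - 1 / D\<^sup>2" using D1 by (auto simp: q_def)
    have "hnorm H (\<pi> a v) \<le> M * q * hnorm H v" if v: "v \<in> hcarrier H" for v
    proof -
      define w where "w = \<pi> a v"
      have w: "w \<in> hcarrier H" "\<pi> s w \<in> hcarrier H" unfolding w_def using v by (simp_all add: rep_simps)
      have eq: "ell1_one - c = ell1_one + ell1_scaleC (- of_real r) (ell1_mult \<sigma> s a)"
        unfolding c_def by (intro ell1_eqI bcontfun_eqI) simp
      have u: "\<pi> (ell1_one - c) v = hadd H v (hscale H (- of_real r) (\<pi> s w))"
        unfolding eq using v by (simp add: rep_simps w_def)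
      let ?u = "\<pi> (ell1_one - c) v"
      have uc: "?u \<in> hcarrier H" using v by (rule rep_simps)
      have "hinner H v (\<pi> s w) = hinner H w w" using v w by (simp add: rep_simps(5) w_def s_def)
      then have "(hnorm H ?u)\<^sup>2 = (hnorm H v)\<^sup>2 - 2 * r * (hnorm H w)\<^sup>2 + r\<^sup>2 * (hnorm H (\<pi> s w))\<^sup>2"
        using v w Re_inner_commute[OF v w(2)]
        unfolding hnorm_sq[OF uc] hnorm_sq[OF v] hnorm_sq[OF w(1)] hnorm_sq[OF w(2)] unfolding u
        by (simp add: inner_add_left inner_add_right inner_scale_left inner_scale_right
            power2_eq_square algebra_simps)
      also have "(hnorm H (\<pi> s w))\<^sup>2 \<le> M\<^sup>2 * (hnorm H w)\<^sup>2"
        using power_mono[OF s[OF w(1)] hnorm_nonneg[OF w(2)], of 2] by (simp add: power_mult_distrib)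
      then have "(hnorm H v)\<^sup>2 - 2 * r * (hnorm H w)\<^sup>2 + r\<^sup>2 * (hnorm H (\<pi> s w))\<^sup>2
          \<le> (hnorm H v)\<^sup>2 - 2 * r * (hnorm H w)\<^sup>2 + r\<^sup>2 * (M\<^sup>2 * (hnorm H w)\<^sup>2)"
        by (intro add_left_mono mult_left_mono) auto
      also have "\<dots> = (hnorm H v)\<^sup>2 - (hnorm H w)\<^sup>2 / M\<^sup>2"
        using M0 by (simp add: r_def power2_eq_square field_simps)
      finally have 1: "(hnorm H ?u)\<^sup>2 \<le> (hnorm H v)\<^sup>2 - (hnorm H w)\<^sup>2 / M\<^sup>2" .
      have "v = \<pi> b ?u" using v b rep_simps(4)[OF v, of b "ell1_one - c"] by (simp add: rep_simps)
      then have "hnorm H v \<le> D * hnorm H ?u" using D[OF uc] by simp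
      then have "(hnorm H v)\<^sup>2 \<le> D\<^sup>2 * (hnorm H ?u)\<^sup>2"
        using power_mono[OF _ hnorm_nonneg[OF v], of "D * hnorm H ?u" 2] by (simp add: power_mult_distrib)
      also have "\<dots> \<le> D\<^sup>2 * ((hnorm H v)\<^sup>2 - (hnorm H w)\<^sup>2 / M\<^sup>2)" using 1 by (intro mult_left_mono) auto
      finally have "(hnorm H w)\<^sup>2 \<le> M\<^sup>2 * ((1 - 1 / D\<^sup>2) * (hnorm H v)\<^sup>2)"
        using M0 D1 by (simp add: field_simps)
      also have "\<dots> = (M * q * hnorm H v)\<^sup>2" by (simp add: power_mult_distrib q(3))
      finally have "(hnorm H w)\<^sup>2 \<le> (M * q * hnorm H v)\<^sup>2" .
      moreover have "0 \<le> M * q * hnorm H v" using M0 q(1) hnorm_nonneg[OF v] by simp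
      ultimately show ?thesis unfolding w_def by (rule power2_le_imp_le)
    qed
    then have "M * q \<in> B" using M0 q by (simp add: B_def)
    then have "Inf B \<le> M * q" using bdd by (rule cInf_lower)
    then have "M \<le> M * q" by (simp only: M_def)
    then show False using M0 q(2) by (simp add: mult_le_cancel_left1)
  qed
  then show ?thesis using M[OF v] mult_right_mono[OF _ hnorm_nonneg[OF v]] by (meson order_trans)
qed

lemma closed_ideal_rep_kernel: "closed_ideal \<sigma> (rep_kernel H \<pi>)"
  unfolding closed_ideal_def ell1_ideal_def
proof (intro conjI ballI allI)
  have zero: "\<pi> 0 v = hzero H" if "v \<in> hcarrier H" for v
  proof -
    have "ell1_scaleC 0 0 = (0 :: 'x ell1)" by (intro ell1_eqI bcontfun_eqI) simp
    then show ?thesis using rep_simps(3)[OF that, of 0 0] rep_simps(1)[OF that, of 0] by (simp add: scale_zero)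
  qed
  then show "0 \<in> rep_kernel H \<pi>" by (simp add: rep_kernel_def)
  show "closed (rep_kernel H \<pi>)"
    unfolding closed_sequential_limits
  proof (intro allI impI)
    fix s a assume s: "(\<forall>n. s n \<in> rep_kernel H \<pi>) \<and> s \<longlonglongrightarrow> a"
    show "a \<in> rep_kernel H \<pi>"
      unfolding rep_kernel_def
    proof (intro CollectI ballI)
      fix v assume v: "v \<in> hcarrier H"
      have "hnorm H (\<pi> a v) \<le> norm (s n - a) * hnorm H v" for n
      proof -
        have "\<pi> a v = hadd H (\<pi> (a - s n) v) (\<pi> (s n) v)"
          using rep_simps(2)[OF v, of "a - s n" "s n"] by simp
        also have "\<dots> = \<pi> (a - s n) v"
          using s v by (simp add: rep_kernel_def add_zero rep_simps)
        finally show ?thesis using rep_contractive[OF v, of "a - s n"] by (simp add: norm_minus_commute)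
      qed
      moreover have "(\<lambda>n. norm (s n - a) * hnorm H v) \<longlonglongrightarrow> 0"
        using s by (intro tendsto_mult_left_zero tendsto_norm_zero LIM_zero) simp
      ultimately have "hnorm H (\<pi> a v) \<le> 0" by (intro LIMSEQ_le_const) auto
      then show "\<pi> a v = hzero H"
        using v hnorm_nonneg[of "\<pi> a v"] by (intro hnorm_eq_0D) (auto simp: rep_simps)
    qed
  qed
qed (auto simp: rep_kernel_def rep_simps scale_hzero add_zero rep_hzero)

text \<open>The squared norm of \<open>\<pi> (ell1_star \<sigma> a) w\<close> is the inner product
  of \<open>\<pi> a (\<pi> (ell1_star \<sigma> a) w)\<close> with \<open>w\<close>, which is 0. This
  makes intersections of primitive ideals self-adjoint.\<close>

lemma star_rep_kernel:
  assumes "a \<in> rep_kernel H \<pi>"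
  shows "ell1_star \<sigma> a \<in> rep_kernel H \<pi>"
  unfolding rep_kernel_def
proof (intro CollectI ballI)
  fix w assume w: "w \<in> hcarrier H"
  let ?u = "\<pi> (ell1_star \<sigma> a) w"
  have u: "?u \<in> hcarrier H" using w by (rule rep_simps)
  have "hinner H ?u ?u = hinner H (\<pi> a ?u) w" using rep_simps(5)[OF u w] by simp
  also have "\<dots> = 0" using assms u w by (simp add: rep_kernel_def inner_hzero)
  finally show "?u = hzero H" using u by (rule inner_definite[rotated])
qed

end

context homeo_system
begin

lemma primitive_idealE:
  assumes "primitive_ideal \<sigma> P"
  obtains H :: "(nat \<Rightarrow> 'x ell1) hspace" and \<pi> where "star_rep \<sigma> H \<pi>" "P = rep_kernel H \<pi>"
proof -
  obtain H :: "(nat \<Rightarrow> 'x ell1) hspace" and \<pi>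
    where rep: "unital_star_rep \<sigma> H \<pi>" and P: "P = rep_kernel H \<pi>"
    using assms unfolding primitive_ideal_def by blast
  have "star_rep \<sigma> H \<pi>"
    using rep homeo_system_axioms unfolding star_rep_def star_rep_axioms_def
    by (simp add: unital_star_rep_def)
  then show ?thesis using P by (rule that)
qed

lemma closed_ideal_primitive: "primitive_ideal \<sigma> P \<Longrightarrow> closed_ideal \<sigma> P"
  by (metis primitive_idealE star_rep.closed_ideal_rep_kernel)

lemma star_primitive: "primitive_ideal \<sigma> P \<Longrightarrow> a \<in> P \<Longrightarrow> ell1_star \<sigma> a \<in> P"
  by (metis primitive_idealE star_rep.star_rep_kernel)

end

subsection \<open>Square summable sequences supported on a set\<close>

text \<open>One construction covers both Hilbert spaces in use: \<ell>^2 over the integers for an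
  aperiodic orbit, and the p-dimensional space for a periodic one.\<close>

definition ell2_on :: "int set \<Rightarrow> (int \<Rightarrow> complex) hspace"
  where "ell2_on J = ell2_space\<lparr>hcarrier := {\<xi> \<in> hcarrier ell2_space. \<forall>k. k \<notin> J \<longrightarrow> \<xi> k = 0}\<rparr>"

lemma ell2_on_UNIV: "ell2_on UNIV = ell2_space"
  by (simp add: ell2_on_def ell2_space_def)

lemma ell2_on_sel:
  "hcarrier (ell2_on J) = {\<xi>. (\<lambda>k. (cmod (\<xi> k))\<^sup>2) summable_on UNIV \<and> (\<forall>k. k \<notin> J \<longrightarrow> \<xi> k = 0)}"
  "hzero (ell2_on J) = (\<lambda>_. 0)" "hadd (ell2_on J) \<xi> \<eta> = (\<lambda>k. \<xi> k + \<eta> k)"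
  "hscale (ell2_on J) c \<xi> = (\<lambda>k. c * \<xi> k)"
  "hinner (ell2_on J) \<xi> \<eta> = (\<Sum>\<^sub>\<infinity>k. \<xi> k * cnj (\<eta> k))"
  by (auto simp: ell2_on_def ell2_space_def)

lemma ell2_add:
  fixes \<xi> \<eta> :: "int \<Rightarrow> complex"
  assumes "(\<lambda>k. (cmod (\<xi> k))\<^sup>2) summable_on UNIV" "(\<lambda>k. (cmod (\<eta> k))\<^sup>2) summable_on UNIV"
  shows "(\<lambda>k. (cmod (\<xi> k + \<eta> k))\<^sup>2) summable_on UNIV"
proof -
  have "(\<lambda>k. 2 * (cmod (\<xi> k))\<^sup>2 + 2 * (cmod (\<eta> k))\<^sup>2) summable_on UNIV"
    by (intro summable_on_add summable_on_cmult_right assms)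
  moreover have "(cmod (x + y))\<^sup>2 \<le> 2 * (cmod x)\<^sup>2 + 2 * (cmod y)\<^sup>2" for x y :: complex
  proof -
    have "(cmod (x + y))\<^sup>2 \<le> (cmod x + cmod y)\<^sup>2" by (intro power_mono norm_triangle_ineq) auto
    then show ?thesis using sum_squares_bound[of "cmod x" "cmod y"] by (simp add: power2_sum)
  qed
  ultimately show ?thesis by (rule summable_on_comparison_test) auto
qed

lemma ell2_scale:
  fixes \<xi> :: "int \<Rightarrow> complex"
  assumes "(\<lambda>k. (cmod (\<xi> k))\<^sup>2) summable_on UNIV"
  shows "(\<lambda>k. (cmod (c * \<xi> k))\<^sup>2) summable_on UNIV"
  using summable_on_cmult_right[OF assms, of "(cmod c)\<^sup>2"] by (simp add: norm_mult power_mult_distrib)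

lemma ell2_inner_summable:
  fixes \<xi> \<eta> :: "int \<Rightarrow> complex"
  assumes "(\<lambda>k. (cmod (\<xi> k))\<^sup>2) summable_on UNIV" "(\<lambda>k. (cmod (\<eta> k))\<^sup>2) summable_on UNIV"
  shows "(\<lambda>k. \<xi> k * cnj (\<eta> k)) summable_on UNIV"
proof -
  have "(\<lambda>k. (cmod (\<xi> k))\<^sup>2 + (cmod (\<eta> k))\<^sup>2) summable_on UNIV"
    by (intro summable_on_add assms)
  then have "(\<lambda>k. norm (\<xi> k * cnj (\<eta> k))) summable_on UNIV"
  proof (rule Infinite_Sum.abs_summable_on_comparison_test')
    fix k
    have "0 \<le> cmod (\<xi> k) * cmod (\<eta> k)" by simp
    then show "norm (\<xi> k * cnj (\<eta> k)) \<le> (cmod (\<xi> k))\<^sup>2 + (cmod (\<eta> k))\<^sup>2"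
      using sum_squares_bound[of "cmod (\<xi> k)" "cmod (\<eta> k)"]
      unfolding norm_mult complex_mod_cnj by linarith
  qed
  then show ?thesis by (rule abs_summable_summable)
qed

lemma ell2_inner_self:
  fixes \<xi> :: "int \<Rightarrow> complex"
  assumes "(\<lambda>k. (cmod (\<xi> k))\<^sup>2) summable_on UNIV"
  shows "(\<Sum>\<^sub>\<infinity>k. \<xi> k * cnj (\<xi> k)) = of_real (\<Sum>\<^sub>\<infinity>k. (cmod (\<xi> k))\<^sup>2)"
  using has_sum_of_real[OF has_sum_infsum[OF assms], where 'a = complex]
  by (intro infsumI) (simp add: complex_norm_square[unfolded of_real_power])

lemma ell2_hnorm:
  fixes \<xi> :: "int \<Rightarrow> complex"
  assumes "(\<lambda>k. (cmod (\<xi> k))\<^sup>2) summable_on UNIV"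
  shows "hnorm (ell2_on J) \<xi> = sqrt (\<Sum>\<^sub>\<infinity>k. (cmod (\<xi> k))\<^sup>2)"
  using ell2_inner_self[OF assms] by (simp add: hnorm_def ell2_on_sel)

lemma ell2_minus:
  fixes \<xi> \<eta> :: "int \<Rightarrow> complex"
  assumes "(\<lambda>k. (cmod (\<xi> k))\<^sup>2) summable_on UNIV" "(\<lambda>k. (cmod (\<eta> k))\<^sup>2) summable_on UNIV"
  shows "(\<lambda>k. (cmod (\<xi> k - \<eta> k))\<^sup>2) summable_on UNIV"
  using ell2_add[OF assms(1) ell2_scale[OF assms(2), of "- 1"]] by simp

lemma ell2_hdist:
  fixes \<xi> \<eta> :: "int \<Rightarrow> complex"
  assumes "(\<lambda>k. (cmod (\<xi> k))\<^sup>2) summable_on UNIV" "(\<lambda>k. (cmod (\<eta> k))\<^sup>2) summable_on UNIV"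
  shows "hdist (ell2_on J) \<xi> \<eta> = sqrt (\<Sum>\<^sub>\<infinity>k. (cmod (\<xi> k - \<eta> k))\<^sup>2)"
  using ell2_hnorm[OF ell2_minus[OF assms], of J] by (simp add: hdist_def ell2_on_sel)

lemma ell2_coord_le:
  fixes \<xi> :: "int \<Rightarrow> complex"
  assumes "(\<lambda>k. (cmod (\<xi> k))\<^sup>2) summable_on UNIV"
  shows "cmod (\<xi> k) \<le> sqrt (\<Sum>\<^sub>\<infinity>k. (cmod (\<xi> k))\<^sup>2)"
proof (rule real_le_rsqrt)
  show "(cmod (\<xi> k))\<^sup>2 \<le> (\<Sum>\<^sub>\<infinity>k. (cmod (\<xi> k))\<^sup>2)"
    using finite_sum_le_infsum[OF assms, of "{k}"] by simp
qed

lemma ell2_finite_support: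
  fixes \<xi> :: "int \<Rightarrow> complex"
  assumes "finite J" "\<And>k. k \<notin> J \<Longrightarrow> \<xi> k = (0 :: complex)"
  shows "(\<lambda>k. (cmod (\<xi> k))\<^sup>2) summable_on UNIV"
  using summable_on_cong_neutral[of J UNIV "\<lambda>k. (cmod (\<xi> k))\<^sup>2" "\<lambda>k. (cmod (\<xi> k))\<^sup>2"] assms by auto

lemma complex_hilbert_space_ell2_on: "complex_hilbert_space (ell2_on J)"
proof (unfold_locales, goal_cases)
  case (14 \<xi> \<eta>)
  have "cnj (\<Sum>\<^sub>\<infinity>k. \<eta> k * cnj (\<xi> k)) = (\<Sum>\<^sub>\<infinity>k. cnj (\<eta> k * cnj (\<xi> k)))" by (rule infsum_cnj[symmetric])
  then show ?case by (simp add: ell2_on_sel mult.commute)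
next
  case (16 \<xi>)
  then have \<xi>: "(\<lambda>k. (cmod (\<xi> k))\<^sup>2) summable_on UNIV" by (simp add: ell2_on_sel)
  then have "(\<Sum>\<^sub>\<infinity>k. (cmod (\<xi> k))\<^sup>2) \<le> 0" using 16 ell2_inner_self[OF \<xi>] by (simp add: ell2_on_sel)
  then have "(cmod (\<xi> k))\<^sup>2 = 0" for k
    using nonneg_infsum_le_0D[OF _ \<xi>, of k] by simp
  then show ?case by (auto simp: ell2_on_sel)
next
  case (17 s)
  have sl: "(\<lambda>k. (cmod (s n k))\<^sup>2) summable_on UNIV" and sJ: "k \<notin> J \<Longrightarrow> s n k = 0" for n k
    using 17(1) by (auto simp: ell2_on_sel)
  have cau: "\<exists>N. \<forall>m\<ge>N. \<forall>n\<ge>N. sqrt (\<Sum>\<^sub>\<infinity>k. (cmod (s m k - s n k))\<^sup>2) < e" if "0 < e" for e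
    using 17(2) that by (simp add: ell2_hdist[OF sl sl])
  have "\<exists>l. (\<lambda>n. s n k) \<longlonglongrightarrow> l" for k
  proof -
    have "Cauchy (\<lambda>n. s n k)"
    proof (rule CauchyI)
      fix e :: real assume "0 < e"
      then obtain N where "\<forall>m\<ge>N. \<forall>n\<ge>N. sqrt (\<Sum>\<^sub>\<infinity>k. (cmod (s m k - s n k))\<^sup>2) < e"
        using cau by blast
      then show "\<exists>N. \<forall>m\<ge>N. \<forall>n\<ge>N. norm (s m k - s n k) < e"
        using ell2_coord_le[OF ell2_minus[OF sl sl]] by (meson order_le_less_trans)
    qed
    then show ?thesis using Cauchy_convergent convergent_def by blast
  qed
  then obtain L where L: "\<And>k. (\<lambda>n. s n k) \<longlonglongrightarrow> L k" by metis
  have LJ: "L k = 0" if "k \<notin> J" for k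
    using L[of k] sJ[OF that] LIMSEQ_unique[OF _ tendsto_const] by auto
  have tail: "\<exists>N. \<forall>m\<ge>N. \<forall>F. finite F \<longrightarrow> (\<Sum>k\<in>F. (cmod (s m k - L k))\<^sup>2) \<le> e\<^sup>2"
    if e: "0 < e" for e
  proof -
    obtain N where N: "\<And>m n. m \<ge> N \<Longrightarrow> n \<ge> N \<Longrightarrow> sqrt (\<Sum>\<^sub>\<infinity>k. (cmod (s m k - s n k))\<^sup>2) < e"
      using cau[OF e] by blast
    have "(\<Sum>k\<in>F. (cmod (s m k - L k))\<^sup>2) \<le> e\<^sup>2" if m: "m \<ge> N" and F: "finite F" for m F
    proof (rule LIMSEQ_le_const2)
      show "(\<lambda>n. \<Sum>k\<in>F. (cmod (s m k - s n k))\<^sup>2) \<longlonglongrightarrow> (\<Sum>k\<in>F. (cmod (s m k - L k))\<^sup>2)"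
        by (intro tendsto_intros L)
      have "(\<Sum>k\<in>F. (cmod (s m k - s n k))\<^sup>2) \<le> e\<^sup>2" if n: "n \<ge> N" for n
      proof -
        have "(\<Sum>k\<in>F. (cmod (s m k - s n k))\<^sup>2) \<le> (\<Sum>\<^sub>\<infinity>k. (cmod (s m k - s n k))\<^sup>2)"
          by (rule finite_sum_le_infsum[OF ell2_minus[OF sl sl] F]) auto
        also have "\<dots> \<le> e\<^sup>2" using N[OF m n] \<open>0 < e\<close> real_sqrt_le_iff[of _ "e\<^sup>2"] by (metis abs_of_pos order_less_imp_le real_sqrt_abs)
        finally show ?thesis .
      qed
      then show "\<exists>N. \<forall>n\<ge>N. (\<Sum>k\<in>F. (cmod (s m k - s n k))\<^sup>2) \<le> e\<^sup>2" by blast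
    qed
    then show ?thesis by blast
  qed
  have sub: "(\<lambda>k. (cmod (s m k - L k))\<^sup>2) summable_on UNIV"
    if "\<And>F. finite F \<Longrightarrow> (\<Sum>k\<in>F. (cmod (s m k - L k))\<^sup>2) \<le> C" for m C
    by (rule nonneg_bounded_partial_sums_imp_summable_on[where C = C])
      (auto intro!: eventually_finite_subsets_at_top_weakI that)
  obtain N where N: "\<And>F. finite F \<Longrightarrow> (\<Sum>k\<in>F. (cmod (s N k - L k))\<^sup>2) \<le> 1"
    using tail[of 1] by auto
  \<comment> \<open>L is the difference of the square summable sequences \<open>s N\<close> and
    \<open>s N - L\<close>.\<close>
  have Ll: "(\<lambda>k. (cmod (L k))\<^sup>2) summable_on UNIV"
    using ell2_minus[OF sl[of N] sub[OF N]] by simp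
  have "(\<lambda>n. hdist (ell2_on J) (s n) L) \<longlonglongrightarrow> 0"
  proof (rule LIMSEQ_I)
    fix e :: real assume "0 < e"
    then obtain N where N: "\<And>m F. m \<ge> N \<Longrightarrow> finite F \<Longrightarrow> (\<Sum>k\<in>F. (cmod (s m k - L k))\<^sup>2) \<le> (e / 2)\<^sup>2"
      using tail[of "e / 2"] by auto
    have "norm (hdist (ell2_on J) (s m) L - 0) < e" if m: "m \<ge> N" for m
    proof -
      have "(\<Sum>\<^sub>\<infinity>k. (cmod (s m k - L k))\<^sup>2) \<le> (e / 2)\<^sup>2"
        by (rule infsum_le_finite_sums[OF ell2_minus[OF sl Ll] N[OF m]])
      then have "hdist (ell2_on J) (s m) L \<le> e / 2"
        unfolding ell2_hdist[OF sl Ll] using \<open>0 < e\<close> by (intro real_le_lsqrt) auto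
      moreover have "0 \<le> hdist (ell2_on J) (s m) L"
        unfolding ell2_hdist[OF sl Ll] by (simp add: infsum_nonneg)
      ultimately show ?thesis using \<open>0 < e\<close> by simp
    qed
    then show "\<exists>N. \<forall>m\<ge>N. norm (hdist (ell2_on J) (s m) L - 0) < e" by blast
  qed
  then show ?case using Ll LJ by (intro bexI[of _ L]) (auto simp: ell2_on_sel)
qed (auto simp: ell2_on_sel algebra_simps ell2_add ell2_scale ell2_inner_self infsum_nonneg
    infsum_cmult_right' infsum_add[OF ell2_inner_summable ell2_inner_summable, symmetric])

subsection \<open>The orbit representations\<close>

text \<open>The weights c will be the norms of the coefficients of a, with sum the norm of a. Summed
  over the coordinates, the inequality shows that convolution by an \<ell>^1 family is bounded on
  \<ell>^2.\<close>

lemma weighted_cauchy_schwarz: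
  fixes c x :: "'a \<Rightarrow> real"
  assumes c: "\<And>n. 0 \<le> c n" and x: "\<And>n. 0 \<le> x n"
    and sums: "c summable_on UNIV" "(\<lambda>n. c n * x n) summable_on UNIV" "(\<lambda>n. c n * (x n)\<^sup>2) summable_on UNIV"
  shows "(\<Sum>\<^sub>\<infinity>n. c n * x n)\<^sup>2 \<le> (\<Sum>\<^sub>\<infinity>n. c n) * (\<Sum>\<^sub>\<infinity>n. c n * (x n)\<^sup>2)"
proof -
  have "(\<Sum>\<^sub>\<infinity>n. c n * x n) \<le> sqrt ((\<Sum>\<^sub>\<infinity>n. c n) * (\<Sum>\<^sub>\<infinity>n. c n * (x n)\<^sup>2))"
  proof (rule infsum_le_finite_sums[OF sums(2)])
    fix F :: "'a set" assume F: "finite F"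
    have "(\<Sum>n\<in>F. c n * x n)\<^sup>2 = (\<Sum>n\<in>F. sqrt (c n) * (sqrt (c n) * x n))\<^sup>2"
      using c by (simp flip: mult.assoc)
    also have "\<dots> \<le> (\<Sum>n\<in>F. (sqrt (c n))\<^sup>2) * (\<Sum>n\<in>F. (sqrt (c n) * x n)\<^sup>2)"
      by (rule Cauchy_Schwarz_ineq_sum)
    also have "\<dots> = (\<Sum>n\<in>F. c n) * (\<Sum>n\<in>F. c n * (x n)\<^sup>2)"
      using c by (simp add: power_mult_distrib)
    also have "\<dots> \<le> (\<Sum>\<^sub>\<infinity>n. c n) * (\<Sum>\<^sub>\<infinity>n. c n * (x n)\<^sup>2)"
      using c F sums by (intro mult_mono finite_sum_le_infsum sum_nonneg infsum_nonneg) auto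
    finally show "(\<Sum>n\<in>F. c n * x n) \<le> sqrt ((\<Sum>\<^sub>\<infinity>n. c n) * (\<Sum>\<^sub>\<infinity>n. c n * (x n)\<^sup>2))"
      by (rule real_le_rsqrt)
  qed
  then have "(\<Sum>\<^sub>\<infinity>n. c n * x n)\<^sup>2 \<le> (sqrt ((\<Sum>\<^sub>\<infinity>n. c n) * (\<Sum>\<^sub>\<infinity>n. c n * (x n)\<^sup>2)))\<^sup>2"
    using c x by (intro power_mono infsum_nonneg) auto
  then show ?thesis using c by (simp add: infsum_nonneg)
qed

lemma has_sum_finite_sum:
  fixes f :: "'i \<Rightarrow> 'a \<Rightarrow> 'b::topological_comm_monoid_add"
  assumes "\<And>i. i \<in> I \<Longrightarrow> (f i has_sum s i) A"
  shows "((\<lambda>x. \<Sum>i\<in>I. f i x) has_sum (\<Sum>i\<in>I. s i)) A"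
  using assms by (induction I rule: infinite_finite_induct) (auto intro: has_sum_add)

lemma ell2_tail_tendsto_0:
  fixes \<xi> :: "int \<Rightarrow> complex"
  assumes "(\<lambda>k. (cmod (\<xi> k))\<^sup>2) summable_on UNIV"
  shows "(\<lambda>N. \<Sum>\<^sub>\<infinity>k. if \<bar>k\<bar> \<le> int N then 0 else (cmod (\<xi> k))\<^sup>2) \<longlonglongrightarrow> 0"
proof (rule LIMSEQ_I)
  fix e :: real assume "0 < e"
  define T where "T = (\<Sum>\<^sub>\<infinity>k. (cmod (\<xi> k))\<^sup>2)"
  have "((\<lambda>k. (cmod (\<xi> k))\<^sup>2) has_sum T) UNIV" unfolding T_def by (rule has_sum_infsum[OF assms])
  then have "\<forall>\<^sub>F F in finite_subsets_at_top UNIV. dist (\<Sum>k\<in>F. (cmod (\<xi> k))\<^sup>2) T < e"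
    using \<open>0 < e\<close> unfolding has_sum_def by (rule tendstoD)
  then obtain F where F: "finite F" "\<And>G. finite G \<Longrightarrow> F \<subseteq> G \<Longrightarrow> dist (\<Sum>k\<in>G. (cmod (\<xi> k))\<^sup>2) T < e"
    unfolding eventually_finite_subsets_at_top by auto
  define M where "M = nat (Max (insert 0 (abs ` F)))"
  have M: "\<bar>k\<bar> \<le> int N" if "k \<in> F" "N \<ge> M" for k N
  proof -
    have "\<bar>k\<bar> \<le> Max (insert 0 (abs ` F))" using F(1) that by (intro Max_ge) auto
    then show ?thesis using that(2) unfolding M_def by linarith
  qed
  have "norm ((\<Sum>\<^sub>\<infinity>k. if \<bar>k\<bar> \<le> int N then 0 else (cmod (\<xi> k))\<^sup>2) - 0) < e" if N: "N \<ge> M" for N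
  proof -
    define G where "G = {k. \<bar>k\<bar> \<le> int N}"
    have "G = {- int N..int N}" by (auto simp: G_def)
    then have G: "finite G" by simp
    have tl: "(\<Sum>\<^sub>\<infinity>k. if \<bar>k\<bar> \<le> int N then 0 else (cmod (\<xi> k))\<^sup>2) = (\<Sum>\<^sub>\<infinity>k\<in>UNIV - G. (cmod (\<xi> k))\<^sup>2)"
      by (rule infsum_cong_neutral) (auto simp: G_def)
    have "(\<Sum>\<^sub>\<infinity>k\<in>UNIV - G. (cmod (\<xi> k))\<^sup>2) = T - (\<Sum>k\<in>G. (cmod (\<xi> k))\<^sup>2)"
      using infsum_Diff[OF assms, of G] G by (simp add: T_def)
    moreover have "0 \<le> (\<Sum>\<^sub>\<infinity>k\<in>UNIV - G. (cmod (\<xi> k))\<^sup>2)" by (simp add: infsum_nonneg)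
    moreover have "dist (\<Sum>k\<in>G. (cmod (\<xi> k))\<^sup>2) T < e" using M N by (intro F G) (auto simp: G_def)
    ultimately show ?thesis unfolding tl by (simp add: dist_real_def)
  qed
  then show "\<exists>M. \<forall>N\<ge>M. norm ((\<Sum>\<^sub>\<infinity>k. if \<bar>k\<bar> \<le> int N then 0 else (cmod (\<xi> k))\<^sup>2) - 0) < e" by blast
qed

context homeo_system
begin

lemma orbit_rep_ell2:
  assumes \<xi>: "(\<lambda>k. (cmod (\<xi> k))\<^sup>2) summable_on UNIV"
  shows "(\<lambda>m. (cmod (orbit_rep \<sigma> x a \<xi> m))\<^sup>2) summable_on UNIV"
    and "(\<Sum>\<^sub>\<infinity>m. (cmod (orbit_rep \<sigma> x a \<xi> m))\<^sup>2) \<le> (norm a)\<^sup>2 * (\<Sum>\<^sub>\<infinity>k. (cmod (\<xi> k))\<^sup>2)"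
proof -
  define T where "T = (\<Sum>\<^sub>\<infinity>k. (cmod (\<xi> k))\<^sup>2)"
  have "((\<lambda>(k, l). norm (ell1_coeff a k) * (cmod (\<xi> l))\<^sup>2) has_sum norm a * T) (UNIV \<times> UNIV)"
    unfolding T_def by (rule abs_summable_product[OF norm_ell1_has_sum has_sum_infsum[OF \<xi>]]) auto
  then have s: "((\<lambda>(m, n). norm (ell1_coeff a n) * (cmod (\<xi> (m - n)))\<^sup>2) has_sum norm a * T) (UNIV \<times> UNIV)"
    using has_sum_reindex_bij_betw[OF bij_convolution_index,
        of "\<lambda>(k, l). norm (ell1_coeff a k) * (cmod (\<xi> l))\<^sup>2"]
    by (simp add: case_prod_unfold)
  define R where "R m = (\<Sum>\<^sub>\<infinity>n. norm (ell1_coeff a n) * (cmod (\<xi> (m - n)))\<^sup>2)" for m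
  have row: "(\<lambda>n. norm (ell1_coeff a n) * (cmod (\<xi> (m - n)))\<^sup>2) summable_on UNIV" for m
    using s summable_on_SigmaD1[of "\<lambda>m n. norm (ell1_coeff a n) * (cmod (\<xi> (m - n)))\<^sup>2" UNIV "\<lambda>_. UNIV" m]
    by (auto simp: summable_on_def)
  have rows: "(R has_sum norm a * T) UNIV"
    unfolding R_def by (rule has_sum_SigmaD[OF s]) (use row in auto)
  have le: "(cmod (orbit_rep \<sigma> x a \<xi> m))\<^sup>2 \<le> norm a * R m" for m
  proof -
    have lin: "(\<lambda>n. norm (ell1_coeff a n) * cmod (\<xi> (m - n))) summable_on UNIV"
    proof (rule summable_on_comparison_test)
      show "(\<lambda>n. norm (ell1_coeff a n) * sqrt T) summable_on UNIV"
        using ell1_coeff_summable by (rule summable_on_cmult_left)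
      show "norm (ell1_coeff a n) * cmod (\<xi> (m - n)) \<le> norm (ell1_coeff a n) * sqrt T" for n
        unfolding T_def by (intro mult_left_mono ell2_coord_le[OF \<xi>]) auto
    qed auto
    have bd: "cmod (\<xi> m) \<le> sqrt T" for m unfolding T_def by (rule ell2_coord_le[OF \<xi>])
    have "cmod (orbit_rep \<sigma> x a \<xi> m) \<le> (\<Sum>\<^sub>\<infinity>n. norm (ell1_coeff a n (int_iter \<sigma> m x) * \<xi> (m - n)))"
      unfolding orbit_rep_def by (rule norm_infsum_bound[OF orbit_rep_abs_summable[OF bd]])
    also have "\<dots> \<le> (\<Sum>\<^sub>\<infinity>n. norm (ell1_coeff a n) * cmod (\<xi> (m - n)))"
      by (rule infsum_mono[OF orbit_rep_abs_summable[OF bd] lin])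
        (simp add: norm_mult mult_right_mono cmod_ell1_coeff_le)
    finally have "(cmod (orbit_rep \<sigma> x a \<xi> m))\<^sup>2 \<le> (\<Sum>\<^sub>\<infinity>n. norm (ell1_coeff a n) * cmod (\<xi> (m - n)))\<^sup>2"
      by (rule power_mono) simp
    also have "\<dots> \<le> norm a * R m"
      unfolding norm_ell1_def R_def
      by (rule weighted_cauchy_schwarz[OF _ _ ell1_coeff_summable lin row]) auto
    finally show ?thesis .
  qed
  have aR: "((\<lambda>m. norm a * R m) has_sum norm a * (norm a * T)) UNIV"
    by (rule has_sum_cmult_right[OF rows])
  show sum: "(\<lambda>m. (cmod (orbit_rep \<sigma> x a \<xi> m))\<^sup>2) summable_on UNIV"
    by (rule summable_on_comparison_test[of "\<lambda>m. norm a * R m"]) (use aR le in \<open>auto simp: summable_on_def\<close>)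
  show "(\<Sum>\<^sub>\<infinity>m. (cmod (orbit_rep \<sigma> x a \<xi> m))\<^sup>2) \<le> (norm a)\<^sup>2 * (\<Sum>\<^sub>\<infinity>k. (cmod (\<xi> k))\<^sup>2)"
    using has_sum_mono[OF has_sum_infsum[OF sum] aR le] by (simp add: T_def power2_eq_square mult.assoc)
qed

text \<open>Both inner products sum the family \<open>t n k\<close>, which pairs \<xi> at k with
  \<eta> at k + n and is absolutely summable since the product of two moduli is at most the sum of
  their squares. The adjoint side is reached by replacing n with -n, because
  \<open>ell1_star\<close> reverses the index.\<close>

lemma orbit_rep_adjoint:
  assumes \<xi>: "(\<lambda>k. (cmod (\<xi> k))\<^sup>2) summable_on UNIV" and \<eta>: "(\<lambda>k. (cmod (\<eta> k))\<^sup>2) summable_on UNIV"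
  shows "(\<Sum>\<^sub>\<infinity>m. orbit_rep \<sigma> x a \<xi> m * cnj (\<eta> m)) = (\<Sum>\<^sub>\<infinity>m. \<xi> m * cnj (orbit_rep \<sigma> x (ell1_star \<sigma> a) \<eta> m))"
proof -
  define t where "t n k = ell1_coeff a n (int_iter \<sigma> (k + n) x) * \<xi> k * cnj (\<eta> (k + n))" for n k
  have "(\<lambda>(n, k). norm (ell1_coeff a n) * (cmod (\<xi> k))\<^sup>2) summable_on (UNIV \<times> UNIV)"
    using abs_summable_product[OF norm_ell1_has_sum has_sum_infsum[OF \<xi>], of a] by (auto simp: summable_on_def)
  moreover have "(\<lambda>(n, k). norm (ell1_coeff a n) * (cmod (\<eta> (k + n)))\<^sup>2) summable_on (UNIV \<times> UNIV)"
  proof -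
    have 1: "(\<lambda>(n, k). norm (ell1_coeff a n) * (cmod (\<eta> k))\<^sup>2) summable_on (UNIV \<times> UNIV)"
      using abs_summable_product[OF norm_ell1_has_sum has_sum_infsum[OF \<eta>], of a] by (auto simp: summable_on_def)
    have bij: "bij_betw (\<lambda>(n, k). (n, k + n)) (UNIV \<times> UNIV) ((UNIV \<times> UNIV) :: (int \<times> int) set)"
      by (rule bij_betwI[where g = "\<lambda>(n, k). (n, k - n)"]) auto
    show ?thesis
      using 1 summable_on_reindex_bij_betw[OF bij, of "\<lambda>(n, k). norm (ell1_coeff a n) * (cmod (\<eta> k))\<^sup>2"]
      by (simp add: case_prod_unfold)
  qed
  ultimately have "(\<lambda>p. (case p of (n, k) \<Rightarrow> norm (ell1_coeff a n) * (cmod (\<xi> k))\<^sup>2)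
      + (case p of (n, k) \<Rightarrow> norm (ell1_coeff a n) * (cmod (\<eta> (k + n)))\<^sup>2)) summable_on (UNIV \<times> UNIV)"
    by (rule summable_on_add)
  then have "(\<lambda>p. norm (case p of (n, k) \<Rightarrow> t n k)) summable_on (UNIV \<times> UNIV)"
  proof (rule Infinite_Sum.abs_summable_on_comparison_test')
    fix p :: "int \<times> int"
    obtain n k where p: "p = (n, k)" by (cases p)
    have "0 \<le> cmod (\<xi> k) * cmod (\<eta> (k + n))" by simp
    then have "cmod (\<xi> k) * cmod (\<eta> (k + n)) \<le> (cmod (\<xi> k))\<^sup>2 + (cmod (\<eta> (k + n)))\<^sup>2"
      using sum_squares_bound[of "cmod (\<xi> k)" "cmod (\<eta> (k + n))"] by linarith
    then have "cmod (ell1_coeff a n (int_iter \<sigma> (k + n) x)) * (cmod (\<xi> k) * cmod (\<eta> (k + n)))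
        \<le> norm (ell1_coeff a n) * ((cmod (\<xi> k))\<^sup>2 + (cmod (\<eta> (k + n)))\<^sup>2)"
      by (intro mult_mono cmod_ell1_coeff_le) auto
    then show "norm (case p of (n, k) \<Rightarrow> t n k) \<le> (case p of (n, k) \<Rightarrow> norm (ell1_coeff a n) * (cmod (\<xi> k))\<^sup>2)
      + (case p of (n, k) \<Rightarrow> norm (ell1_coeff a n) * (cmod (\<eta> (k + n)))\<^sup>2)"
      by (simp add: p t_def norm_mult algebra_simps)
  qed
  then have "(\<lambda>p. case p of (n, k) \<Rightarrow> t n k) summable_on (UNIV \<times> UNIV)" by (rule abs_summable_summable)
  then obtain S where S: "((\<lambda>(n, k). t n k) has_sum S) (UNIV \<times> UNIV)" by (auto simp: summable_on_def)
  have S1: "((\<lambda>(m, n). t n (m - n)) has_sum S) (UNIV \<times> UNIV)"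
    using S has_sum_reindex_bij_betw[OF bij_convolution_index, of "\<lambda>(k, l). t k l"]
    by (simp add: case_prod_unfold)
  have bij: "bij_betw (\<lambda>(k, n). (- n, k)) (UNIV \<times> UNIV) ((UNIV \<times> UNIV) :: (int \<times> int) set)"
    by (rule bij_betwI[where g = "\<lambda>(n, k). (k, - n)"]) auto
  have S2: "((\<lambda>(k, n). t (- n) k) has_sum S) (UNIV \<times> UNIV)"
    using S has_sum_reindex_bij_betw[OF bij, of "\<lambda>(k, l). t k l"] by (simp add: case_prod_unfold)
  note bd = ell2_coord_le[OF \<xi>] ell2_coord_le[OF \<eta>]
  have "((\<lambda>m. orbit_rep \<sigma> x a \<xi> m * cnj (\<eta> m)) has_sum S) UNIV"
  proof (rule has_sum_SigmaD[OF S1])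
    show "((\<lambda>n. case (m, n) of (m, n) \<Rightarrow> t n (m - n)) has_sum orbit_rep \<sigma> x a \<xi> m * cnj (\<eta> m)) UNIV" for m
      using has_sum_cmult_left[OF orbit_rep_has_sum[of \<xi>, OF bd(1), of a m x], of "cnj (\<eta> m)"] by (simp add: t_def)
  qed
  moreover have "((\<lambda>k. \<xi> k * cnj (orbit_rep \<sigma> x (ell1_star \<sigma> a) \<eta> k)) has_sum S) UNIV"
  proof (rule has_sum_SigmaD[OF S2])
    fix k
    have "((\<lambda>n. cnj (ell1_coeff (ell1_star \<sigma> a) n (int_iter \<sigma> k x) * \<eta> (k - n))) has_sum
        cnj (orbit_rep \<sigma> x (ell1_star \<sigma> a) \<eta> k)) UNIV"
      unfolding has_sum_cnj_iff by (rule orbit_rep_has_sum[of \<eta>, OF bd(2)])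
    from has_sum_cmult_right[OF this, of "\<xi> k"]
    show "((\<lambda>n. case (k, n) of (k, n) \<Rightarrow> t (- n) k) has_sum \<xi> k * cnj (orbit_rep \<sigma> x (ell1_star \<sigma> a) \<eta> k)) UNIV"
      by (simp add: t_def coeff_star_apply mult_ac)
  qed
  ultimately show ?thesis by (simp add: infsumI)
qed

lemma unital_star_rep_orbit: "unital_star_rep \<sigma> ell2_space (orbit_rep \<sigma> x)"
  unfolding unital_star_rep_def
proof (intro conjI allI ballI)
  show "complex_hilbert_space ell2_space"
    using complex_hilbert_space_ell2_on[of UNIV] by (simp add: ell2_on_UNIV)
  have sel: "hcarrier ell2_space = {\<xi>. (\<lambda>k. (cmod (\<xi> k))\<^sup>2) summable_on UNIV}"
    "hadd ell2_space \<xi> \<eta> = (\<lambda>k. \<xi> k + \<eta> k)" "hscale ell2_space c \<xi> = (\<lambda>k. c * \<xi> k)"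
    "hinner ell2_space \<xi> \<eta> = (\<Sum>\<^sub>\<infinity>k. \<xi> k * cnj (\<eta> k))" for \<xi> \<eta> c
    by (simp_all add: ell2_space_def)
  have bd: "\<exists>C. \<forall>m. cmod (\<xi> m) \<le> C" if "\<xi> \<in> hcarrier ell2_space" for \<xi>
    using ell2_coord_le[of \<xi>] that by (auto simp: sel)
  fix a
  show "bounded_operator ell2_space (orbit_rep \<sigma> x a)"
    unfolding bounded_operator_def
  proof (intro conjI allI ballI)
    fix \<xi> assume \<xi>: "\<xi> \<in> hcarrier ell2_space"
    then obtain C where C: "\<And>m. cmod (\<xi> m) \<le> C" using bd by blast
    show "orbit_rep \<sigma> x a \<xi> \<in> hcarrier ell2_space" using \<xi> orbit_rep_ell2(1) by (simp add: sel)
    show "orbit_rep \<sigma> x a (hscale ell2_space c \<xi>) = hscale ell2_space c (orbit_rep \<sigma> x a \<xi>)" for c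
      unfolding sel by (rule orbit_rep_linear(5)[OF C C])
    fix \<eta> assume \<eta>: "\<eta> \<in> hcarrier ell2_space"
    then obtain D where D: "\<And>m. cmod (\<eta> m) \<le> D" using bd by blast
    show "orbit_rep \<sigma> x a (hadd ell2_space \<xi> \<eta>) = hadd ell2_space (orbit_rep \<sigma> x a \<xi>) (orbit_rep \<sigma> x a \<eta>)"
      unfolding sel by (rule orbit_rep_linear(4)[OF C D])
  next
    show "\<exists>C. \<forall>v\<in>hcarrier ell2_space. hnorm ell2_space (orbit_rep \<sigma> x a v) \<le> C * hnorm ell2_space v"
    proof (intro exI[of _ "norm a"] ballI)
      fix \<xi> assume "\<xi> \<in> hcarrier ell2_space"
      then have \<xi>: "(\<lambda>k. (cmod (\<xi> k))\<^sup>2) summable_on UNIV" by (simp add: sel)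
      have "sqrt (\<Sum>\<^sub>\<infinity>m. (cmod (orbit_rep \<sigma> x a \<xi> m))\<^sup>2) \<le> sqrt ((norm a)\<^sup>2 * (\<Sum>\<^sub>\<infinity>k. (cmod (\<xi> k))\<^sup>2))"
        using orbit_rep_ell2(2)[OF \<xi>] by (rule real_sqrt_le_mono)
      then show "hnorm ell2_space (orbit_rep \<sigma> x a \<xi>) \<le> norm a * hnorm ell2_space \<xi>"
        using ell2_hnorm[OF \<xi>, of UNIV] ell2_hnorm[OF orbit_rep_ell2(1)[OF \<xi>], of UNIV x a]
        by (simp add: ell2_on_UNIV real_sqrt_mult)
    qed
  qed
  fix \<xi> assume \<xi>: "\<xi> \<in> hcarrier ell2_space"
  then obtain C where C: "\<And>m. cmod (\<xi> m) \<le> C" using bd by blast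
  show "orbit_rep \<sigma> x (a + b) \<xi> = hadd ell2_space (orbit_rep \<sigma> x a \<xi>) (orbit_rep \<sigma> x b \<xi>)" for b
    unfolding sel by (rule orbit_rep_linear(1)[OF C C])
  show "orbit_rep \<sigma> x (ell1_mult \<sigma> a b) \<xi> = orbit_rep \<sigma> x a (orbit_rep \<sigma> x b \<xi>)" for b
    by (rule orbit_rep_mult[OF C])
  show "hinner ell2_space (orbit_rep \<sigma> x a \<xi>) \<eta> = hinner ell2_space \<xi> (orbit_rep \<sigma> x (ell1_star \<sigma> a) \<eta>)"
    if "\<eta> \<in> hcarrier ell2_space" for \<eta>
    using orbit_rep_adjoint[of \<xi> \<eta>] \<xi> that by (simp add: sel)
next
  fix c a \<xi> assume "\<xi> \<in> hcarrier ell2_space"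
  then obtain C where C: "\<And>m. cmod (\<xi> m) \<le> C"
    using ell2_coord_le[of \<xi>] by (auto simp: ell2_space_def)
  show "orbit_rep \<sigma> x (ell1_scaleC c a) \<xi> = hscale ell2_space c (orbit_rep \<sigma> x a \<xi>)"
    using orbit_rep_linear(3)[OF C C] by (simp add: ell2_space_def)
qed simp

section \<open>Matrix entries of the orbit representations\<close>

lemma orbit_rep_basis: "orbit_rep \<sigma> x a (ell2_basis (m - n)) m = ell1_coeff a n (int_iter \<sigma> m x)"
proof -
  have "orbit_rep \<sigma> x a (ell2_basis (m - n)) m
      = (\<Sum>\<^sub>\<infinity>k\<in>{n}. ell1_coeff a k (int_iter \<sigma> m x) * ell2_basis (m - n) (m - k))"
    unfolding orbit_rep_def by (rule infsum_cong_neutral) (auto simp: ell2_basis_def)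
  then show ?thesis by (simp add: ell2_basis_def)
qed

text \<open>The matrix entries of the representations at all points recover every coefficient
  (\<open>orbit_rep_basis\<close>), so associativity is inherited from the composition of
  operators.\<close>

lemma ell1_mult_assoc: "ell1_mult \<sigma> (ell1_mult \<sigma> a b) c = ell1_mult \<sigma> a (ell1_mult \<sigma> b c)"
proof (intro ell1_eqI bcontfun_eqI)
  fix n x
  have basis: "cmod (ell2_basis k m) \<le> 1" for k m by (simp add: ell2_basis_def)
  have "orbit_rep \<sigma> x (ell1_mult \<sigma> (ell1_mult \<sigma> a b) c) (ell2_basis (0 - n))
      = orbit_rep \<sigma> x (ell1_mult \<sigma> a (ell1_mult \<sigma> b c)) (ell2_basis (0 - n))"
    by (simp only: orbit_rep_mult[of "ell2_basis (0 - n)", OF basis]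
        orbit_rep_mult[of "orbit_rep \<sigma> x c (ell2_basis (0 - n))", OF cmod_orbit_rep_le[OF basis]])
  then show "ell1_coeff (ell1_mult \<sigma> (ell1_mult \<sigma> a b) c) n x = ell1_coeff (ell1_mult \<sigma> a (ell1_mult \<sigma> b c)) n x"
    using orbit_rep_basis[of x _ 0 n] by (metis int_iter_0)
qed

lemma orbit_ideal_eq_kernel: "orbit_ideal \<sigma> x = ell1_kernel (int_orbit \<sigma> x)"
proof (intro subset_antisym subsetI)
  fix a assume a: "a \<in> orbit_ideal \<sigma> x"
  have "ell1_coeff a n (int_iter \<sigma> m x) = 0" for m n
  proof -
    have "ell2_basis (m - n) \<in> hcarrier ell2_space"
      using ell2_finite_support[of "{m - n}" "ell2_basis (m - n)"] by (simp add: ell2_space_def ell2_basis_def)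
    then have "orbit_rep \<sigma> x a (ell2_basis (m - n)) m = 0"
      using a by (simp add: orbit_ideal_def rep_kernel_def ell2_space_def)
    then show ?thesis by (simp add: orbit_rep_basis)
  qed
  then show "a \<in> ell1_kernel (int_orbit \<sigma> x)" by (auto simp: ell1_kernel_def int_orbit_def)
next
  fix a assume "a \<in> ell1_kernel (int_orbit \<sigma> x)"
  then have "ell1_coeff a n (int_iter \<sigma> m x) = 0" for m n by (auto simp: ell1_kernel_def int_orbit_def)
  then show "a \<in> orbit_ideal \<sigma> x"
    by (simp add: orbit_ideal_def rep_kernel_def orbit_rep_def ell2_space_def)
qed

lemma well_behaved_kernel: "well_behaved (ell1_kernel S)"
  by (auto simp: well_behaved_def ell1_kernel_def ell1_of_C_def ell1_E_def)

end

context compact_system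
begin

text \<open>A nonzero coordinate v m of a vector in M is isolated by functions equal to 1 at the
  m-th orbit point and 0 at the other orbit points with index in [-N, N]; they exist because the
  orbit points are distinct. In the limit M contains v m times a basis vector, and the powers of
  \<delta> then produce the whole basis.\<close>

lemma top_irreducible_orbit:
  assumes aper: "\<And>n. n \<noteq> 0 \<Longrightarrow> int_iter \<sigma> n x \<noteq> x"
  shows "top_irreducible ell2_space (orbit_rep \<sigma> x)"
proof -
  have inj: "int_iter \<sigma> j x \<noteq> int_iter \<sigma> k x" if "j \<noteq> k" for j k
  proof
    assume "int_iter \<sigma> j x = int_iter \<sigma> k x"
    then have "int_iter \<sigma> (- k) (int_iter \<sigma> j x) = int_iter \<sigma> (- k) (int_iter \<sigma> k x)" by simp
    then show False using aper[of "j - k"] that by simp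
  qed
  have fin: "(\<lambda>k. (cmod (\<xi> k))\<^sup>2) summable_on UNIV" if "finite J" "\<And>k. k \<notin> J \<Longrightarrow> \<xi> k = 0"
    for J and \<xi> :: "int \<Rightarrow> complex" using that by (rule ell2_finite_support)
  have basis: "(\<lambda>k. (cmod (c * ell2_basis j k))\<^sup>2) summable_on UNIV" for c j
    by (rule fin[of "{j}"]) (auto simp: ell2_basis_def)
  have basis': "ell2_basis j \<in> hcarrier ell2_space" for j
    using basis[of 1 j] by (simp add: ell2_space_def)
  show ?thesis
    unfolding top_irreducible_def
  proof (intro conjI allI impI)
    show "hcarrier ell2_space \<noteq> {hzero ell2_space}"
    proof
      assume "hcarrier ell2_space = {hzero ell2_space}"
      then have "ell2_basis 0 = hzero ell2_space" using basis'[of 0] by simp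
      then have "ell2_basis 0 0 = hzero ell2_space 0" by (rule fun_cong)
      then show False by (simp add: ell2_basis_def ell2_space_def)
    qed
    fix M assume M: "closed_subspace ell2_space M \<and> (\<forall>a. \<forall>v\<in>M. orbit_rep \<sigma> x a v \<in> M)"
    have inv: "orbit_rep \<sigma> x a v \<in> M" if "v \<in> M" for a v using M that by blast
    have sub: "(\<lambda>k. (cmod (v k))\<^sup>2) summable_on UNIV" if "v \<in> M" for v
      using M that by (auto simp: closed_subspace_def ell2_space_def)
    have zero: "(\<lambda>_. 0) \<in> M" and add: "v \<in> M \<Longrightarrow> w \<in> M \<Longrightarrow> (\<lambda>k. v k + w k) \<in> M"
      and scale: "v \<in> M \<Longrightarrow> (\<lambda>k. c * v k) \<in> M" for v w c
      using M by (simp_all add: closed_subspace_def ell2_space_def)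
    \<comment> \<open>Membership of limits is checked by domination: the error vanishes on [-N, N]
      and is bounded outside by one fixed square summable w.\<close>
    have lim: "v \<in> M" if s: "\<And>N. s N \<in> M" and v: "(\<lambda>k. (cmod (v k))\<^sup>2) summable_on UNIV"
      and w: "(\<lambda>k. (cmod (w k))\<^sup>2) summable_on UNIV"
      and le: "\<And>N k. N \<ge> N0 \<Longrightarrow> cmod (s N k - v k) \<le> (if \<bar>k\<bar> \<le> int N then 0 else cmod (w k))"
      for s :: "nat \<Rightarrow> int \<Rightarrow> complex" and v w N0
    proof -
      note sl = sub[OF s]
      have tl: "(\<lambda>k. if \<bar>k\<bar> \<le> int N then 0 else (cmod (w k))\<^sup>2) summable_on UNIV" for N
        by (rule summable_on_comparison_test[OF w]) auto
      have bd: "(hdist ell2_space (s N) v) \<le> sqrt (\<Sum>\<^sub>\<infinity>k. if \<bar>k\<bar> \<le> int N then 0 else (cmod (w k))\<^sup>2)"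
        if N: "N \<ge> N0" for N
        unfolding ell2_on_UNIV[symmetric] ell2_hdist[OF sl v]
      proof (intro real_sqrt_le_mono infsum_mono[OF ell2_minus[OF sl v] tl])
        show "(cmod (s N k - v k))\<^sup>2 \<le> (if \<bar>k\<bar> \<le> int N then 0 else (cmod (w k))\<^sup>2)" for k
          using power_mono[OF le[OF N, of k], of 2] by (auto split: if_splits)
      qed
      have "(\<lambda>N. sqrt (\<Sum>\<^sub>\<infinity>k. if \<bar>k\<bar> \<le> int N then 0 else (cmod (w k))\<^sup>2)) \<longlonglongrightarrow> sqrt 0"
        by (intro tendsto_real_sqrt ell2_tail_tendsto_0[OF w])
      then have lim0: "(\<lambda>N. sqrt (\<Sum>\<^sub>\<infinity>k. if \<bar>k\<bar> \<le> int N then 0 else (cmod (w k))\<^sup>2)) \<longlonglongrightarrow> 0" by simp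
      have "(\<lambda>N. hdist ell2_space (s N) v) \<longlonglongrightarrow> 0"
      proof (rule tendsto_sandwich[OF _ _ tendsto_const lim0])
        show "\<forall>\<^sub>F N in sequentially. 0 \<le> hdist ell2_space (s N) v"
          unfolding ell2_on_UNIV[symmetric] ell2_hdist[OF sl v] by (simp add: infsum_nonneg)
        show "\<forall>\<^sub>F N in sequentially. hdist ell2_space (s N) v
            \<le> sqrt (\<Sum>\<^sub>\<infinity>k. if \<bar>k\<bar> \<le> int N then 0 else (cmod (w k))\<^sup>2)"
          using bd by (intro eventually_sequentiallyI[of N0])
      qed
      moreover have "v \<in> hcarrier ell2_space" using v by (simp add: ell2_space_def)
      ultimately show ?thesis using M s unfolding closed_subspace_def by blast
    qed
    show "M = {hzero ell2_space} \<or> M = hcarrier ell2_space"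
    proof (cases "\<exists>v\<in>M. \<exists>m. v m \<noteq> 0")
      case False
      then have "M = {\<lambda>_. 0}" using zero by (auto simp: fun_eq_iff)
      then show ?thesis by (simp add: ell2_space_def)
    next
      case True
      then obtain v m where v: "v \<in> M" "v m \<noteq> 0" by blast
      have "\<exists>f :: 'x \<Rightarrow>\<^sub>C complex. f (int_iter \<sigma> m x) = 1 \<and> (\<forall>y. cmod (f y) \<le> 1) \<and>
          (\<forall>k. \<bar>k\<bar> \<le> int N \<and> k \<noteq> m \<longrightarrow> f (int_iter \<sigma> k x) = 0)" for N
      proof -
        define K where "K = (\<lambda>k. int_iter \<sigma> k x) ` ({- int N..int N} - {m})"
        have "closed K" by (auto simp: K_def intro!: finite_imp_closed)
        moreover have "int_iter \<sigma> m x \<notin> K" using inj by (force simp: K_def)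
        ultimately obtain f :: "'x \<Rightarrow>\<^sub>C complex" where f: "f (int_iter \<sigma> m x) = 1"
          "\<And>y. y \<in> K \<Longrightarrow> f y = 0" "\<And>y. cmod (f y) \<le> 1"
          using separating_function by metis
        have "f (int_iter \<sigma> k x) = 0" if "\<bar>k\<bar> \<le> int N" "k \<noteq> m" for k
          using that by (intro f(2)) (auto simp: K_def intro!: image_eqI[of _ _ k])
        then show ?thesis using f by blast
      qed
      then obtain f :: "nat \<Rightarrow> 'x \<Rightarrow>\<^sub>C complex" where f: "\<And>N. f N (int_iter \<sigma> m x) = 1"
        "\<And>N y. cmod (f N y) \<le> 1" "\<And>N k. \<bar>k\<bar> \<le> int N \<Longrightarrow> k \<noteq> m \<Longrightarrow> f N (int_iter \<sigma> k x) = 0"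
        by metis
      have "(\<lambda>k. v m * ell2_basis m k) \<in> M"
      proof (rule lim[of "\<lambda>N. orbit_rep \<sigma> x (ell1_single 0 (f N)) v" _ v "nat \<bar>m\<bar>"])
        show "orbit_rep \<sigma> x (ell1_single 0 (f N)) v \<in> M" for N by (rule inv[OF v(1)])
        show "cmod (orbit_rep \<sigma> x (ell1_single 0 (f N)) v k - v m * ell2_basis m k)
            \<le> (if \<bar>k\<bar> \<le> int N then 0 else cmod (v k))" if "N \<ge> nat \<bar>m\<bar>" for N k
          using that f(1)[of N] f(3)[of k N] mult_right_mono[OF f(2)[of N "int_iter \<sigma> k x"], of "cmod (v k)"]
          by (auto simp: orbit_rep_single ell2_basis_def norm_mult)
      qed (use basis sub[OF v(1)] in auto)
      from scale[OF this, of "1 / v m"] have em: "ell2_basis m \<in> M" using v(2) by simp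
      have e: "ell2_basis k \<in> M" for k
      proof -
        have "orbit_rep \<sigma> x (ell1_single (k - m) (const_bcontfun 1)) (ell2_basis m) = ell2_basis k"
          by (auto simp: orbit_rep_single ell2_basis_def fun_eq_iff)
        then show ?thesis using inv[OF em] by metis
      qed
      have "w \<in> M" if w: "(\<lambda>k. (cmod (w k))\<^sup>2) summable_on UNIV" for w
      proof (rule lim[OF _ w w, of "\<lambda>N k. if \<bar>k\<bar> \<le> int N then w k else 0" 0])
        have fs: "(\<lambda>k. if k \<in> F then w k else 0) \<in> M" if "finite F" for F
          using that
        proof (induction F rule: finite_induct)
          case (insert j F)
          have "(\<lambda>k. w j * ell2_basis j k + (if k \<in> F then w k else 0)) \<in> M"
            by (intro add scale e insert)
          moreover have "(\<lambda>k. w j * ell2_basis j k + (if k \<in> F then w k else 0)) = (\<lambda>k. if k \<in> insert j F then w k else 0)"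
            using insert(2) by (auto simp: ell2_basis_def fun_eq_iff)
          ultimately show ?case by simp
        qed (simp add: zero)
        have "\<bar>k\<bar> \<le> int N \<longleftrightarrow> k \<in> {- int N..int N}" for k N by auto
        then show "(\<lambda>k. if \<bar>k\<bar> \<le> int N then w k else 0) \<in> M" for N
          using fs[of "{- int N..int N}"] by simp
      qed auto
      then have "M = hcarrier ell2_space" using sub by (auto simp: ell2_space_def)
      then show ?thesis ..
    qed
  qed
qed

lemma primitive_orbit_ideal:
  assumes "\<And>n. n \<noteq> 0 \<Longrightarrow> int_iter \<sigma> n x \<noteq> x"
  shows "primitive_ideal \<sigma> (orbit_ideal \<sigma> x)"
  unfolding orbit_ideal_def
  by (rule primitive_idealI[OF unital_star_rep_orbit top_irreducible_orbit[OF assms]])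

end

section \<open>Finite-dimensional representations at a periodic point\<close>

context homeo_system
begin

text \<open>Shifting the index by p does not change the orbit points, so every operator commutes
  with this shift and preserves its eigenspaces. The multiplier 1 gives the p-dimensional
  representation; multipliers on the unit circle give the functionals behind the ideal that is not
  self-adjoint.\<close>

lemma orbit_rep_quasi_periodic:
  assumes "int_iter \<sigma> p x = x" "\<And>m. \<eta> (m + p) = c * \<eta> m"
  shows "orbit_rep \<sigma> x a \<eta> (m + p) = c * orbit_rep \<sigma> x a \<eta> m"
proof -
  have "\<eta> (m + p - n) = c * \<eta> (m - n)" for n
    using assms(2)[of "m - n"] by (simp add: algebra_simps)
  moreover have "int_iter \<sigma> (m + p) x = int_iter \<sigma> m x" by (simp add: int_iter_add assms(1) del: int_iter_simps)
  ultimately show ?thesis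
    unfolding orbit_rep_def by (simp add: mult.left_commute infsum_cmult_right')
qed

end

locale periodic_point = compact_system \<sigma> for \<sigma> :: "'x::t2_space \<Rightarrow> 'x" +
  fixes x :: 'x and p :: int
  assumes p_pos: "0 < p" and period: "int_iter \<sigma> p x = x"
    and minimal: "\<And>k. 0 < k \<Longrightarrow> k < p \<Longrightarrow> int_iter \<sigma> k x \<noteq> x"
begin

text \<open>The p-dimensional space consists of sequences supported on one period; repeating them
  periodically lets the orbit representation on bounded sequences act on them.\<close>

definition ext :: "(int \<Rightarrow> complex) \<Rightarrow> int \<Rightarrow> complex"
  where "ext \<xi> m = \<xi> (m mod p)"

definition periodic_rep :: "'x ell1 \<Rightarrow> (int \<Rightarrow> complex) \<Rightarrow> int \<Rightarrow> complex"
  where "periodic_rep a \<xi> m = (if m \<in> {0..<p} then orbit_rep \<sigma> x a (ext \<xi>) m else 0)"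

abbreviation "Hp \<equiv> ell2_on {0..<p}"

lemma carrier_Hp: "hcarrier Hp = {\<xi>. \<forall>k. k \<notin> {0..<p} \<longrightarrow> \<xi> k = 0}"
  using ell2_finite_support[of "{0..<p}"] by (auto simp: ell2_on_sel)

lemma inner_Hp: "\<xi> \<in> hcarrier Hp \<Longrightarrow> hinner Hp \<xi> \<eta> = (\<Sum>k\<in>{0..<p}. \<xi> k * cnj (\<eta> k))"
  using infsum_cong_neutral[of "{0..<p}" UNIV "\<lambda>k. \<xi> k * cnj (\<eta> k)" "\<lambda>k. \<xi> k * cnj (\<eta> k)"]
  by (simp add: ell2_on_sel carrier_Hp)

lemma hnorm_Hp: "\<xi> \<in> hcarrier Hp \<Longrightarrow> (hnorm Hp \<xi>)\<^sup>2 = (\<Sum>k\<in>{0..<p}. (cmod (\<xi> k))\<^sup>2)"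
proof -
  assume \<xi>: "\<xi> \<in> hcarrier Hp"
  have "(\<Sum>\<^sub>\<infinity>k. (cmod (\<xi> k))\<^sup>2) = (\<Sum>k\<in>{0..<p}. (cmod (\<xi> k))\<^sup>2)"
    using infsum_cong_neutral[of "{0..<p}" UNIV "\<lambda>k. (cmod (\<xi> k))\<^sup>2" "\<lambda>k. (cmod (\<xi> k))\<^sup>2"] \<xi>
    by (simp add: carrier_Hp)
  then show ?thesis using ell2_hnorm[of \<xi> "{0..<p}"] \<xi> by (simp add: ell2_on_sel(1) sum_nonneg)
qed

lemma mod_p: "m mod p \<in> {0..<p}"
  using p_pos by simp

lemma ext_eq: "m \<in> {0..<p} \<Longrightarrow> ext \<xi> m = \<xi> m"
  by (simp add: ext_def)

lemma ext_period: "ext \<xi> (m + p) = ext \<xi> m"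
  by (simp add: ext_def)

lemma cmod_ext_le: "\<xi> \<in> hcarrier Hp \<Longrightarrow> cmod (ext \<xi> m) \<le> hnorm Hp \<xi>"
  using ell2_coord_le[of \<xi> "m mod p"] ell2_hnorm[of \<xi> "{0..<p}"] by (simp add: ell2_on_sel(1) ext_def)

lemma periodic_int:
  assumes "\<And>m. \<eta> (m + p) = \<eta> m"
  shows "\<eta> (m mod p) = (\<eta> m :: 'b)"
proof -
  have "\<eta> (m + k * p) = \<eta> m" for m k
  proof (induction k rule: int_induct[of _ 0])
    case (step1 i)
    then show ?case using assms[of "m + i * p"] by (simp add: algebra_simps)
  next
    case (step2 i)
    then show ?case using assms[of "m + (i - 1) * p"] by (simp add: algebra_simps)
  qed simp
  from this[of "m mod p" "m div p"] show ?thesis by simp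
qed

lemma ext_periodic_rep: "ext (periodic_rep a \<xi>) = orbit_rep \<sigma> x a (ext \<xi>)"
proof
  fix m
  have "orbit_rep \<sigma> x a (ext \<xi>) (m + p) = orbit_rep \<sigma> x a (ext \<xi>) m" for m
    using orbit_rep_quasi_periodic[OF period, of "ext \<xi>" 1] ext_period by simp
  from periodic_int[of "orbit_rep \<sigma> x a (ext \<xi>)", OF this]
  show "ext (periodic_rep a \<xi>) m = orbit_rep \<sigma> x a (ext \<xi>) m"
    using mod_p[of m] by (simp add: ext_def periodic_rep_def)
qed

lemma sum_period_shift:
  fixes G :: "int \<Rightarrow> complex"
  assumes "\<And>m. G (m + p) = G m"
  shows "(\<Sum>k\<in>{0..<p}. G (k + n)) = (\<Sum>k\<in>{0..<p}. G k)"
proof -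
  have bij: "bij_betw (\<lambda>k. (k + n) mod p) {0..<p} {0..<p}"
    by (rule bij_betwI[where g = "\<lambda>k. (k - n) mod p"]) (use p_pos in \<open>auto simp: mod_simps\<close>)
  have "(\<Sum>k\<in>{0..<p}. G (k + n)) = (\<Sum>k\<in>{0..<p}. G ((k + n) mod p))"
    using periodic_int[of G, OF assms] by simp
  also have "\<dots> = (\<Sum>k\<in>{0..<p}. G k)" by (rule sum.reindex_bij_betw[OF bij])
  finally show ?thesis .
qed

text \<open>For each n the summand \<open>G n\<close> is p-periodic in its argument, so a sum over
  one period may be shifted by n. This replaces the change of variables over all integers in
  \<open>orbit_rep_adjoint\<close>.\<close>

lemma periodic_rep_adjoint:
  assumes \<xi>: "\<xi> \<in> hcarrier Hp" and \<eta>: "\<eta> \<in> hcarrier Hp"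
  shows "hinner Hp (periodic_rep a \<xi>) \<eta> = hinner Hp \<xi> (periodic_rep (ell1_star \<sigma> a) \<eta>)"
proof -
  have rep: "periodic_rep a \<xi> \<in> hcarrier Hp" for a \<xi> by (simp add: carrier_Hp periodic_rep_def)
  define G where "G n m = ell1_coeff a n (int_iter \<sigma> m x) * ext \<xi> (m - n) * cnj (ext \<eta> m)" for n m
  have per: "G n (m + p) = G n m" for n m
  proof -
    have "int_iter \<sigma> (m + p) x = int_iter \<sigma> m x" by (simp add: int_iter_add period del: int_iter_simps)
    then show ?thesis using ext_period[of \<xi> "m - n"] ext_period[of \<eta> m] by (simp add: G_def algebra_simps)
  qed
  have "((\<lambda>n. G n m) has_sum periodic_rep a \<xi> m * cnj (\<eta> m)) UNIV" if "m \<in> {0..<p}" for m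
    using has_sum_cmult_left[OF orbit_rep_has_sum[of "ext \<xi>", OF cmod_ext_le[OF \<xi>], of a m x], of "cnj (ext \<eta> m)"]
    unfolding G_def periodic_rep_def ext_eq[OF that] using that by simp
  then have 1: "((\<lambda>n. \<Sum>m\<in>{0..<p}. G n m) has_sum hinner Hp (periodic_rep a \<xi>) \<eta>) UNIV"
    unfolding inner_Hp[OF rep] by (rule has_sum_finite_sum)
  have "((\<lambda>n. \<xi> k * cnj (ell1_coeff (ell1_star \<sigma> a) n (int_iter \<sigma> k x) * ext \<eta> (k - n)))
      has_sum \<xi> k * cnj (periodic_rep (ell1_star \<sigma> a) \<eta> k)) UNIV" if "k \<in> {0..<p}" for k
    using orbit_rep_has_sum[of "ext \<eta>", OF cmod_ext_le[OF \<eta>], of "ell1_star \<sigma> a" k x] that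
    by (intro has_sum_cmult_right) (simp only: has_sum_cnj_iff periodic_rep_def if_True)
  then have "((\<lambda>n. \<Sum>k\<in>{0..<p}. \<xi> k * cnj (ell1_coeff (ell1_star \<sigma> a) n (int_iter \<sigma> k x) * ext \<eta> (k - n)))
      has_sum hinner Hp \<xi> (periodic_rep (ell1_star \<sigma> a) \<eta>)) UNIV"
    unfolding inner_Hp[OF \<xi>] by (rule has_sum_finite_sum)
  moreover have "(\<Sum>k\<in>{0..<p}. \<xi> k * cnj (ell1_coeff (ell1_star \<sigma> a) n (int_iter \<sigma> k x) * ext \<eta> (k - n)))
      = (\<Sum>k\<in>{0..<p}. G (- n) k)" for n
  proof -
    have "(\<Sum>k\<in>{0..<p}. \<xi> k * cnj (ell1_coeff (ell1_star \<sigma> a) n (int_iter \<sigma> k x) * ext \<eta> (k - n)))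
      = (\<Sum>k\<in>{0..<p}. G (- n) (k + (- n)))"
      by (rule sum.cong) (auto simp: G_def coeff_star_apply ext_eq mult_ac)
    then show ?thesis using sum_period_shift[of "G (- n)" "- n", OF per] by simp
  qed
  ultimately have "((\<lambda>n. \<Sum>k\<in>{0..<p}. G (- n) k) has_sum hinner Hp \<xi> (periodic_rep (ell1_star \<sigma> a) \<eta>)) UNIV"
    by simp
  then have "((\<lambda>n. \<Sum>k\<in>{0..<p}. G n k) has_sum hinner Hp \<xi> (periodic_rep (ell1_star \<sigma> a) \<eta>)) UNIV"
    using has_sum_reindex_bij_betw[OF bij_uminus, of "\<lambda>n. \<Sum>k\<in>{0..<p}. G n k"] by simp
  then show ?thesis by (rule has_sum_unique[OF 1])
qed

lemma unital_star_rep_periodic: "unital_star_rep \<sigma> Hp periodic_rep"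
  unfolding unital_star_rep_def
proof (intro conjI allI ballI)
  show "complex_hilbert_space Hp" by (rule complex_hilbert_space_ell2_on)
  interpret complex_hilbert_space Hp by fact
  have rep: "periodic_rep a \<xi> \<in> hcarrier Hp" for a \<xi> by (simp add: carrier_Hp periodic_rep_def)
  have ext_lin: "ext (hadd Hp \<xi> \<eta>) = (\<lambda>m. ext \<xi> m + ext \<eta> m)" "ext (hscale Hp c \<xi>) = (\<lambda>m. c * ext \<xi> m)" for \<xi> \<eta> c
    by (simp_all add: ext_def ell2_on_sel fun_eq_iff)
  fix a
  show "bounded_operator Hp (periodic_rep a)"
    unfolding bounded_operator_def
  proof (intro conjI allI ballI)
    fix \<xi> assume \<xi>: "\<xi> \<in> hcarrier Hp"
    show "periodic_rep a \<xi> \<in> hcarrier Hp" by (rule rep)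
    show "periodic_rep a (hscale Hp c \<xi>) = hscale Hp c (periodic_rep a \<xi>)" for c
      unfolding periodic_rep_def ext_lin orbit_rep_linear(5)[OF cmod_ext_le[OF \<xi>] cmod_ext_le[OF \<xi>]]
      by (auto simp: ell2_on_sel periodic_rep_def)
    show "periodic_rep a (hadd Hp \<xi> \<eta>) = hadd Hp (periodic_rep a \<xi>) (periodic_rep a \<eta>)"
      if \<eta>: "\<eta> \<in> hcarrier Hp" for \<eta>
      unfolding periodic_rep_def ext_lin orbit_rep_linear(4)[OF cmod_ext_le[OF \<xi>] cmod_ext_le[OF \<eta>]]
      by (auto simp: ell2_on_sel periodic_rep_def)
  next
    show "\<exists>C. \<forall>\<xi>\<in>hcarrier Hp. hnorm Hp (periodic_rep a \<xi>) \<le> C * hnorm Hp \<xi>"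
    proof (intro exI[of _ "sqrt p * norm a"] ballI)
      fix \<xi> assume \<xi>: "\<xi> \<in> hcarrier Hp"
      have "(hnorm Hp (periodic_rep a \<xi>))\<^sup>2 \<le> (\<Sum>k\<in>{0..<p}. (norm a * hnorm Hp \<xi>)\<^sup>2)"
        unfolding hnorm_Hp[OF rep]
        by (intro sum_mono power_mono)
          (auto simp: periodic_rep_def intro!: cmod_orbit_rep_le cmod_ext_le \<xi>)
      also have "\<dots> = (sqrt p * norm a * hnorm Hp \<xi>)\<^sup>2"
        using p_pos by (simp add: power_mult_distrib)
      finally show "hnorm Hp (periodic_rep a \<xi>) \<le> sqrt p * norm a * hnorm Hp \<xi>"
        by (rule power2_le_imp_le) (use p_pos hnorm_nonneg[OF \<xi>] in simp)
    qed
  qed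
  fix \<xi> assume \<xi>: "\<xi> \<in> hcarrier Hp"
  show "periodic_rep (a + b) \<xi> = hadd Hp (periodic_rep a \<xi>) (periodic_rep b \<xi>)" for b
    unfolding periodic_rep_def orbit_rep_linear(1)[OF cmod_ext_le[OF \<xi>] cmod_ext_le[OF \<xi>]]
    by (auto simp: ell2_on_sel periodic_rep_def)
  show "periodic_rep (ell1_mult \<sigma> a b) \<xi> = periodic_rep a (periodic_rep b \<xi>)" for b
    unfolding periodic_rep_def[of a] ext_periodic_rep
    by (auto simp: periodic_rep_def orbit_rep_mult[OF cmod_ext_le[OF \<xi>]])
  show "hinner Hp (periodic_rep a \<xi>) \<eta> = hinner Hp \<xi> (periodic_rep (ell1_star \<sigma> a) \<eta>)"
    if "\<eta> \<in> hcarrier Hp" for \<eta> using periodic_rep_adjoint[OF \<xi> that] .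
next
  fix c a \<xi> assume \<xi>: "\<xi> \<in> hcarrier Hp"
  show "periodic_rep (ell1_scaleC c a) \<xi> = hscale Hp c (periodic_rep a \<xi>)"
    unfolding periodic_rep_def orbit_rep_linear(3)[OF cmod_ext_le[OF \<xi>] cmod_ext_le[OF \<xi>]]
    by (auto simp: ell2_on_sel periodic_rep_def)
next
  fix \<xi> assume "\<xi> \<in> hcarrier Hp"
  then show "periodic_rep ell1_one \<xi> = \<xi>"
    by (auto simp: periodic_rep_def fun_eq_iff ext_eq carrier_Hp)
qed

text \<open>Minimality of p makes the p orbit points distinct, so a single continuous function cuts
  a vector down to a multiple of a basis vector exactly, and the powers of \<delta> permute the
  basis cyclically.\<close>

lemma top_irreducible_periodic: "top_irreducible Hp periodic_rep"
proof -
  have inj: "int_iter \<sigma> j x \<noteq> int_iter \<sigma> k x" if "j \<noteq> k" "j \<in> {0..<p}" "k \<in> {0..<p}" for j k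
    using that
  proof (induction j k rule: linorder_wlog)
    case (le j k)
    show ?case
    proof
      assume "int_iter \<sigma> j x = int_iter \<sigma> k x"
      then have "int_iter \<sigma> (- j) (int_iter \<sigma> j x) = int_iter \<sigma> (- j) (int_iter \<sigma> k x)" by simp
      then show False using minimal[of "k - j"] le by simp
    qed
  next
    case (sym j k)
    then show ?case by metis
  qed
  have basis: "ell2_basis j \<in> hcarrier Hp" if "j \<in> {0..<p}" for j
    using that by (auto simp: carrier_Hp ell2_basis_def)
  show ?thesis
    unfolding top_irreducible_def
  proof (intro conjI allI impI)
    show "hcarrier Hp \<noteq> {hzero Hp}"
    proof
      assume "hcarrier Hp = {hzero Hp}"
      then have "ell2_basis 0 = hzero Hp" using basis[of 0] p_pos by simp
      then have "ell2_basis 0 0 = hzero Hp 0" by (rule fun_cong)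
      then show False by (simp add: ell2_basis_def ell2_on_sel)
    qed
    fix M assume M: "closed_subspace Hp M \<and> (\<forall>a. \<forall>v\<in>M. periodic_rep a v \<in> M)"
    have inv: "periodic_rep a v \<in> M" if "v \<in> M" for a v using M that by blast
    have sub: "M \<subseteq> hcarrier Hp" using M by (simp add: closed_subspace_def)
    have zero: "(\<lambda>_. 0) \<in> M" and add: "v \<in> M \<Longrightarrow> w \<in> M \<Longrightarrow> (\<lambda>k. v k + w k) \<in> M"
      and scale: "v \<in> M \<Longrightarrow> (\<lambda>k. c * v k) \<in> M" for v w c
      using M by (simp_all add: closed_subspace_def ell2_on_sel)
    show "M = {hzero Hp} \<or> M = hcarrier Hp"
    proof (cases "\<exists>v\<in>M. \<exists>m. v m \<noteq> 0")
      case False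
      then have "M = {\<lambda>_. 0}" using zero by (auto simp: fun_eq_iff)
      then show ?thesis by (simp add: ell2_on_sel)
    next
      case True
      then obtain v m where v: "v \<in> M" "v m \<noteq> 0" by blast
      then have m: "m \<in> {0..<p}" and v0: "\<And>k. k \<notin> {0..<p} \<Longrightarrow> v k = 0" using sub by (auto simp: carrier_Hp)
      define K where "K = (\<lambda>k. int_iter \<sigma> k x) ` ({0..<p} - {m})"
      have "closed K" by (auto simp: K_def intro!: finite_imp_closed)
      moreover have "int_iter \<sigma> m x \<notin> K" using inj m by (force simp: K_def)
      ultimately obtain f :: "'x \<Rightarrow>\<^sub>C complex" where f: "f (int_iter \<sigma> m x) = 1" "\<And>y. y \<in> K \<Longrightarrow> f y = 0"
        using separating_function by metis
      have f0: "f (int_iter \<sigma> k x) = 0" if "k \<in> {0..<p}" "k \<noteq> m" for k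
        using that by (intro f(2)) (auto simp: K_def)
      have "periodic_rep (ell1_single 0 f) v = (\<lambda>k. v m * ell2_basis m k)"
        using f(1) f0 m by (auto simp: periodic_rep_def orbit_rep_single fun_eq_iff ell2_basis_def ext_eq)
      then have "(\<lambda>k. v m * ell2_basis m k) \<in> M" using inv[OF v(1)] by metis
      from scale[OF this, of "1 / v m"] have em: "ell2_basis m \<in> M" using v(2) by simp
      have e: "ell2_basis k \<in> M" if k: "k \<in> {0..<p}" for k
      proof -
        have "(j - (k - m)) mod p = m \<longleftrightarrow> j = k" if j: "j \<in> {0..<p}" for j
        proof
          assume "(j - (k - m)) mod p = m"
          then have "(j - (k - m)) mod p = m mod p" using m by simp
          then have "p dvd j - k" by (simp add: mod_eq_dvd_iff)
          then show "j = k" using j k zdvd_imp_le[of p "j - k"] zdvd_imp_le[of p "k - j"] by (fastforce simp: dvd_diff_commute)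
        qed (use m in simp)
        then have "periodic_rep (ell1_single (k - m) (const_bcontfun 1)) (ell2_basis m) = ell2_basis k"
          using k m by (auto simp: periodic_rep_def orbit_rep_single ell2_basis_def fun_eq_iff ext_def)
        then show ?thesis using inv[OF em] by metis
      qed
      have fs: "(\<lambda>k. if k \<in> F then w k else 0) \<in> M" if "finite F" "F \<subseteq> {0..<p}" for F and w :: "int \<Rightarrow> complex"
        using that
      proof (induction F rule: finite_induct)
        case (insert j F)
        have "(\<lambda>k. w j * ell2_basis j k + (if k \<in> F then w k else 0)) \<in> M"
          using insert by (intro add scale e) auto
        moreover have "(\<lambda>k. w j * ell2_basis j k + (if k \<in> F then w k else 0)) = (\<lambda>k. if k \<in> insert j F then w k else 0)"
          using insert(2) by (auto simp: ell2_basis_def fun_eq_iff)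
        ultimately show ?case by simp
      qed (simp add: zero)
      have "w \<in> M" if "w \<in> hcarrier Hp" for w
      proof -
        have "(\<lambda>k. if k \<in> {0..<p} then w k else 0) = w" using that by (auto simp: carrier_Hp fun_eq_iff)
        then show ?thesis using fs[of "{0..<p}" w] by simp
      qed
      then show ?thesis using sub by blast
    qed
  qed
qed

lemma primitive_not_well_behaved: "\<exists>P. primitive_ideal \<sigma> P \<and> \<not> well_behaved P"
proof (intro exI conjI)
  let ?P = "rep_kernel Hp periodic_rep"
  show "primitive_ideal \<sigma> ?P"
    by (rule primitive_idealI[OF unital_star_rep_periodic top_irreducible_periodic])
  let ?a = "ell1_single p (const_bcontfun 1) - ell1_one"
  have "periodic_rep ?a \<xi> = hzero Hp" if \<xi>: "\<xi> \<in> hcarrier Hp" for \<xi>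
  proof -
    have "orbit_rep \<sigma> x ?a (ext \<xi>) = (\<lambda>m. 0)"
      unfolding orbit_rep_linear(2)[OF cmod_ext_le[OF \<xi>] cmod_ext_le[OF \<xi>]]
      using ext_period[of \<xi> "_ - p"] by (simp add: orbit_rep_single)
    then show ?thesis by (auto simp: periodic_rep_def ell2_on_sel)
  qed
  then have a: "?a \<in> ?P" by (simp add: rep_kernel_def)
  show "\<not> well_behaved ?P"
  proof
    assume "well_behaved ?P"
    then have "ell1_of_C (ell1_E ?a) \<in> ?P" using a unfolding well_behaved_def by blast
    moreover have e0: "ell2_basis 0 \<in> hcarrier Hp" using p_pos by (auto simp: carrier_Hp ell2_basis_def)
    ultimately have "periodic_rep (ell1_of_C (ell1_E ?a)) (ell2_basis 0) = hzero Hp"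
      by (simp add: rep_kernel_def)
    then have "periodic_rep (ell1_of_C (ell1_E ?a)) (ell2_basis 0) 0 = 0" by (simp add: ell2_on_sel)
    then show False
      using p_pos by (simp add: periodic_rep_def ell1_of_C_def orbit_rep_single ell1_E_def ell1_one_def ext_def ell2_basis_def)
  qed
qed

end

subsection \<open>Absolutely convergent Fourier series\<close>

text \<open>Membership in the Wiener algebra of the circle with norm at most C; values of g off the
  circle are unconstrained. The explicit bound is carried along because infinite series need it in
  \<open>wiener_suminf\<close>.\<close>

definition wiener :: "real \<Rightarrow> (complex \<Rightarrow> complex) \<Rightarrow> bool"
  where "wiener C g \<longleftrightarrow> (\<exists>c :: int \<Rightarrow> complex. (\<exists>s\<le>C. ((\<lambda>l. cmod (c l)) has_sum s) UNIV) \<and>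
    (\<forall>z. cmod z = 1 \<longrightarrow> ((\<lambda>l. c l * z powi l) has_sum g z) UNIV))"

lemma wienerI:
  assumes "((\<lambda>l. cmod (c l)) has_sum s) UNIV" "s \<le> C"
    "\<And>z. cmod z = 1 \<Longrightarrow> ((\<lambda>l. c l * z powi l) has_sum g z) UNIV"
  shows "wiener C g"
  using assms unfolding wiener_def by blast

lemma wienerE:
  assumes "wiener C g"
  obtains c s where "((\<lambda>l. cmod (c l)) has_sum s) UNIV" "0 \<le> s" "s \<le> C"
    "\<And>z. cmod z = 1 \<Longrightarrow> ((\<lambda>l. c l * z powi l) has_sum g z) UNIV"
proof -
  obtain c s where c: "((\<lambda>l. cmod (c l)) has_sum s) UNIV" "s \<le> C"
    "\<And>z. cmod z = 1 \<Longrightarrow> ((\<lambda>l. c l * z powi l) has_sum g z) UNIV"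
    using assms unfolding wiener_def by blast
  moreover have "0 \<le> s" using c(1) by (rule has_sum_nonneg) simp
  ultimately show ?thesis using that by blast
qed

lemma wiener_monomial: "wiener 1 (\<lambda>z. z powi k)"
proof (rule wienerI[where c = "\<lambda>l. if l = k then 1 else 0"])
  show "((\<lambda>l. cmod (if l = k then 1 else 0)) has_sum 1) UNIV"
    by (rule has_sum_finite_neutralI[where B = "{k}"]) auto
  show "((\<lambda>l. (if l = k then 1 else 0) * z powi l) has_sum z powi k) UNIV" for z :: complex
    by (rule has_sum_finite_neutralI[where B = "{k}"]) auto
qed simp

lemma wiener_scale:
  assumes "wiener C g"
  shows "wiener (cmod k * C) (\<lambda>z. k * g z)"
proof -
  obtain c s where c: "((\<lambda>l. cmod (c l)) has_sum s) UNIV" "s \<le> C"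
    "\<And>z. cmod z = 1 \<Longrightarrow> ((\<lambda>l. c l * z powi l) has_sum g z) UNIV" using wienerE[OF assms] by metis
  show ?thesis
    using has_sum_cmult_right[OF c(1), of "cmod k"] mult_left_mono[OF c(2), of "cmod k"]
      has_sum_cmult_right[OF c(3), of _ k]
    by (intro wienerI[where c = "\<lambda>l. k * c l"]) (simp_all add: norm_mult mult.assoc)
qed

lemma wiener_add:
  assumes "wiener C g" "wiener D h"
  shows "wiener (C + D) (\<lambda>z. g z + h z)"
proof -
  obtain c s where c: "((\<lambda>l. cmod (c l)) has_sum s) UNIV" "s \<le> C"
    "\<And>z. cmod z = 1 \<Longrightarrow> ((\<lambda>l. c l * z powi l) has_sum g z) UNIV" using wienerE[OF assms(1)] by metis
  obtain d t where d: "((\<lambda>l. cmod (d l)) has_sum t) UNIV" "t \<le> D"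
    "\<And>z. cmod z = 1 \<Longrightarrow> ((\<lambda>l. d l * z powi l) has_sum h z) UNIV" using wienerE[OF assms(2)] by metis
  have sum: "((\<lambda>l. cmod (c l) + cmod (d l)) has_sum s + t) UNIV" by (rule has_sum_add[OF c(1) d(1)])
  then have "(\<lambda>l. cmod (c l) + cmod (d l)) summable_on UNIV" by (auto simp: summable_on_def)
  then have "(\<lambda>l. cmod (c l + d l)) summable_on UNIV"
    by (rule Infinite_Sum.abs_summable_on_comparison_test') (rule norm_triangle_ineq)
  then have cd: "((\<lambda>l. cmod (c l + d l)) has_sum infsum (\<lambda>l. cmod (c l + d l)) UNIV) UNIV" by (rule has_sum_infsum)
  show ?thesis
  proof (rule wienerI[OF cd])
    show "infsum (\<lambda>l. cmod (c l + d l)) UNIV \<le> C + D"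
      using has_sum_mono[OF cd sum] c(2) d(2) norm_triangle_ineq by force
    show "((\<lambda>l. (c l + d l) * z powi l) has_sum g z + h z) UNIV" if "cmod z = 1" for z
      using has_sum_add[OF c(3)[OF that] d(3)[OF that]] by (simp add: algebra_simps)
  qed
qed

lemma wiener_const: "wiener (cmod k) (\<lambda>_. k)"
  using wiener_scale[OF wiener_monomial[of 0], of k] by simp

lemma wiener_mult:
  assumes "wiener C g" "wiener D h"
  shows "wiener (C * D) (\<lambda>z. g z * h z)"
proof -
  obtain c s where c: "((\<lambda>l. cmod (c l)) has_sum s) UNIV" "0 \<le> s" "s \<le> C"
    "\<And>z. cmod z = 1 \<Longrightarrow> ((\<lambda>l. c l * z powi l) has_sum g z) UNIV" using wienerE[OF assms(1)] by metis
  obtain d t where d: "((\<lambda>l. cmod (d l)) has_sum t) UNIV" "0 \<le> t" "t \<le> D"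
    "\<And>z. cmod z = 1 \<Longrightarrow> ((\<lambda>l. d l * z powi l) has_sum h z) UNIV" using wienerE[OF assms(2)] by metis
  have "((\<lambda>(k, l). cmod (c k) * cmod (d l)) has_sum s * t) (UNIV \<times> UNIV)"
    by (rule abs_summable_product[OF c(1) d(1)]) auto
  then have pair: "((\<lambda>(n, k). cmod (c k) * cmod (d (n - k))) has_sum s * t) (UNIV \<times> UNIV)"
    using has_sum_reindex_bij_betw[OF bij_convolution_index, of "\<lambda>(k, l). cmod (c k) * cmod (d l)"]
    by (simp add: case_prod_unfold)
  have row: "(\<lambda>k. cmod (c k * d (n - k))) summable_on UNIV" for n
    using pair summable_on_SigmaD1[of "\<lambda>n k. cmod (c k) * cmod (d (n - k))" UNIV "\<lambda>_. UNIV" n]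
    by (auto simp: summable_on_def norm_mult)
  define R where "R n = (\<Sum>\<^sub>\<infinity>k. cmod (c k * d (n - k)))" for n
  have R: "(R has_sum s * t) UNIV"
    unfolding R_def by (rule has_sum_SigmaD[OF pair]) (use row in \<open>auto simp: norm_mult\<close>)
  define e where "e n = (\<Sum>\<^sub>\<infinity>k. c k * d (n - k))" for n
  have e: "((\<lambda>k. c k * d (n - k)) has_sum e n) UNIV" for n
    unfolding e_def by (rule has_sum_infsum[OF abs_summable_summable[OF row]])
  have eR: "cmod (e n) \<le> R n" for n unfolding e_def R_def by (rule norm_infsum_bound[OF row])
  then have "(\<lambda>n. cmod (e n)) summable_on UNIV"
    using R by (intro Infinite_Sum.abs_summable_on_comparison_test'[of R]) (auto simp: summable_on_def)
  then have es: "((\<lambda>n. cmod (e n)) has_sum infsum (\<lambda>n. cmod (e n)) UNIV) UNIV" by (rule has_sum_infsum)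
  show ?thesis
  proof (rule wienerI[OF es])
    show "infsum (\<lambda>n. cmod (e n)) UNIV \<le> C * D"
      using has_sum_mono[OF es R eR] mult_mono[OF c(3) d(3)] c(2,3) d(2) by simp
    fix z :: complex assume z: "cmod z = 1"
    then have z0: "z \<noteq> 0" by auto
    have "(\<lambda>p. norm (case p of (n, k) \<Rightarrow> c k * d (n - k) * z powi n)) summable_on (UNIV \<times> UNIV)"
      using pair z by (auto simp: summable_on_def norm_mult norm_power_int case_prod_unfold)
    then have "(\<lambda>p. case p of (n, k) \<Rightarrow> c k * d (n - k) * z powi n) summable_on (UNIV \<times> UNIV)"
      by (rule abs_summable_summable)
    then obtain S where S: "((\<lambda>(n, k). c k * d (n - k) * z powi n) has_sum S) (UNIV \<times> UNIV)"
      by (auto simp: summable_on_def)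
    have 1: "((\<lambda>n. e n * z powi n) has_sum S) UNIV"
      by (rule has_sum_SigmaD[OF S]) (use has_sum_cmult_left[OF e] in simp)
    have "((\<lambda>(k, l). (c k * z powi k) * (d l * z powi l)) has_sum S) (UNIV \<times> UNIV)"
    proof -
      have "z powi k * z powi (n - k) = z powi n" for n k
        using z0 power_int_add[of z k "n - k"] by simp
      then have "(c k * z powi k) * (d (n - k) * z powi (n - k)) = c k * d (n - k) * z powi n" for n k
        by (metis (no_types, opaque_lifting) mult.assoc mult.left_commute)
      then have "(\<lambda>(n, k). (c k * z powi k) * (d (n - k) * z powi (n - k))) = (\<lambda>(n, k). c k * d (n - k) * z powi n)"
        by (simp add: fun_eq_iff)
      then show ?thesis
        using S has_sum_reindex_bij_betw[OF bij_convolution_index, of "\<lambda>(k, l). (c k * z powi k) * (d l * z powi l)"]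
        by (simp add: case_prod_unfold)
    qed
    from has_sum_SigmaD[OF this, of "\<lambda>k. (c k * z powi k) * h z"] has_sum_cmult_right[OF d(4)[OF z]]
    have "((\<lambda>k. (c k * z powi k) * h z) has_sum S) UNIV" by simp
    then have "S = g z * h z" by (rule has_sum_unique[OF _ has_sum_cmult_left[OF c(4)[OF z]]])
    then show "((\<lambda>n. e n * z powi n) has_sum g z * h z) UNIV" using 1 by simp
  qed
qed

lemma wiener_power: "wiener C g \<Longrightarrow> wiener (C ^ n) (\<lambda>z. g z ^ n)"
proof (induction n)
  case 0
  then show ?case using wiener_const[of 1] by simp
next
  case (Suc n)
  then show ?case using wiener_mult[of C g "C ^ n" "\<lambda>z. g z ^ n"] by simp
qed

text \<open>The coefficients form an absolutely summable family in (n, l) with total at most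
  \<open>suminf C\<close>. Summing over n first gives the coefficients of the limit, summing over l
  first its values.\<close>

lemma wiener_suminf:
  assumes "\<And>n. wiener (C n) (g n)" "summable C"
  shows "wiener (suminf C) (\<lambda>z. \<Sum>n. g n z)"
proof -
  have "\<exists>c s. ((\<lambda>l. cmod (c l)) has_sum s) UNIV \<and> 0 \<le> s \<and> s \<le> C n \<and>
    (\<forall>z. cmod z = 1 \<longrightarrow> ((\<lambda>l. c l * z powi l) has_sum g n z) UNIV)" for n
    using wienerE[OF assms(1)[of n]] by metis
  then obtain c s where c: "\<And>n. ((\<lambda>l. cmod (c n l)) has_sum s n) UNIV" "\<And>n. 0 \<le> s n" "\<And>n. s n \<le> C n"
    "\<And>n z. cmod z = 1 \<Longrightarrow> ((\<lambda>l. c n l * z powi l) has_sum g n z) UNIV" by metis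
  have ss: "summable s"
    by (rule summable_comparison_test[OF _ assms(2)]) (use c(2,3) in auto)
  have son: "s summable_on UNIV" by (rule summable_nonneg_imp_summable_on[OF ss c(2)])
  then have sT: "(s has_sum suminf s) UNIV"
    using has_sum_infsum[OF son] sums_unique[OF has_sum_imp_sums[OF has_sum_infsum[OF son]]] by simp
  have pair: "(\<lambda>(n, l). cmod (c n l)) summable_on (UNIV \<times> UNIV)"
    by (rule summable_on_SigmaI[where g = s]) (use c(1) son in auto)
  have "((\<lambda>(n, l). cmod (c n l)) has_sum infsum (\<lambda>(n, l). cmod (c n l)) (UNIV \<times> UNIV)) (UNIV \<times> UNIV)"
    by (rule has_sum_infsum[OF pair])
  moreover from has_sum_SigmaD[OF this, of s] c(1)
  have "(s has_sum infsum (\<lambda>(n, l). cmod (c n l)) (UNIV \<times> UNIV)) UNIV" by simp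
  then have "infsum (\<lambda>(n, l). cmod (c n l)) (UNIV \<times> UNIV) = suminf s" by (rule has_sum_unique[OF _ sT])
  ultimately have tot: "((\<lambda>(l, n). cmod (c n l)) has_sum suminf s) (UNIV \<times> UNIV)"
    by (subst has_sum_swap) (simp add: case_prod_unfold)
  have row: "(\<lambda>n. cmod (c n l)) summable_on UNIV" for l
    using tot summable_on_SigmaD1[of "\<lambda>l n. cmod (c n l)" UNIV "\<lambda>_. UNIV" l] by (auto simp: summable_on_def)
  define R where "R l = (\<Sum>\<^sub>\<infinity>n. cmod (c n l))" for l
  have R: "(R has_sum suminf s) UNIV"
    unfolding R_def by (rule has_sum_SigmaD[OF tot]) (use row in auto)
  define e where "e l = (\<Sum>\<^sub>\<infinity>n. c n l)" for l
  have e: "((\<lambda>n. c n l) has_sum e l) UNIV" for l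
    unfolding e_def by (rule has_sum_infsum[OF abs_summable_summable[OF row]])
  have eR: "cmod (e n) \<le> R n" for n unfolding e_def R_def by (rule norm_infsum_bound[OF row])
  then have "(\<lambda>n. cmod (e n)) summable_on UNIV"
    using R by (intro Infinite_Sum.abs_summable_on_comparison_test'[of R]) (auto simp: summable_on_def)
  then have es: "((\<lambda>n. cmod (e n)) has_sum infsum (\<lambda>n. cmod (e n)) UNIV) UNIV" by (rule has_sum_infsum)
  show ?thesis
  proof (rule wienerI[OF es])
    show "infsum (\<lambda>n. cmod (e n)) UNIV \<le> suminf C"
      using has_sum_mono[OF es R eR] suminf_le[OF c(3) ss assms(2)] by simp
    fix z :: complex assume z: "cmod z = 1"
    have "(\<lambda>p. norm (case p of (l, n) \<Rightarrow> c n l * z powi l)) summable_on (UNIV \<times> UNIV)"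
      using tot z by (auto simp: summable_on_def norm_mult norm_power_int case_prod_unfold)
    then have "(\<lambda>p. case p of (l, n) \<Rightarrow> c n l * z powi l) summable_on (UNIV \<times> UNIV)"
      by (rule abs_summable_summable)
    then obtain S where S: "((\<lambda>(l, n). c n l * z powi l) has_sum S) (UNIV \<times> UNIV)"
      by (auto simp: summable_on_def)
    have 1: "((\<lambda>l. e l * z powi l) has_sum S) UNIV"
      by (rule has_sum_SigmaD[OF S]) (use has_sum_cmult_left[OF e] in simp)
    have "((\<lambda>(n, l). c n l * z powi l) has_sum S) (UNIV \<times> UNIV)"
      using S by (subst has_sum_swap) (simp add: case_prod_unfold)
    from has_sum_SigmaD[OF this, of "\<lambda>n. g n z"] c(4)[OF z]
    have "((\<lambda>n. g n z) has_sum S) UNIV" by simp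
    then have "S = (\<Sum>n. g n z)" using has_sum_imp_sums sums_unique by blast
    then show "((\<lambda>l. e l * z powi l) has_sum (\<Sum>n. g n z)) UNIV" using 1 by simp
  qed
qed

lemma wiener_exp:
  assumes "wiener C g"
  shows "wiener (exp C) (\<lambda>z. exp (g z))"
proof -
  have "wiener (cmod (1 / fact n) * C ^ n) (\<lambda>z. 1 / fact n * g z ^ n)" for n
    by (intro wiener_scale wiener_power assms)
  then have w: "wiener (C ^ n /\<^sub>R fact n) (\<lambda>z. g z ^ n /\<^sub>R fact n)" for n
    by (simp add: norm_inverse scaleR_conv_of_real divide_inverse mult.commute)
  show ?thesis unfolding exp_def by (rule wiener_suminf[OF w summable_exp_generic])
qed

text \<open>Rotation multiplies each Fourier coefficient by a number of modulus 1. It moves the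
  corner of the parabola to the nodes used in \<open>plateau\<close>.\<close>

lemma wiener_rotate:
  assumes "wiener C g" "cmod w = 1"
  shows "wiener C (\<lambda>z. g (z * w))"
proof -
  obtain c s where c: "((\<lambda>l. cmod (c l)) has_sum s) UNIV" "s \<le> C"
    "\<And>z. cmod z = 1 \<Longrightarrow> ((\<lambda>l. c l * z powi l) has_sum g z) UNIV" using wienerE[OF assms(1)] by metis
  show ?thesis
  proof (rule wienerI[where c = "\<lambda>l. c l * w powi l" and s = s])
    show "((\<lambda>l. cmod (c l * w powi l)) has_sum s) UNIV" using c(1) assms(2) by (simp add: norm_mult norm_power_int)
    show "((\<lambda>l. c l * w powi l * z powi l) has_sum g (z * w)) UNIV" if "cmod z = 1" for z
      using c(3)[of "z * w"] that assms(2) by (simp add: norm_mult power_int_mult_distrib mult_ac)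
  qed (rule c)
qed

lemma has_sum_multiples:
  fixes F :: "int \<Rightarrow> 'b::real_normed_vector"
  assumes "0 < p" "((\<lambda>l. F (p * l)) has_sum S) UNIV" "\<And>l. \<not> p dvd l \<Longrightarrow> F l = 0"
  shows "(F has_sum S) UNIV"
proof -
  have inj: "inj (\<lambda>l. p * l)" using assms(1) by (auto simp: inj_def)
  have "(F has_sum S) (range (\<lambda>l. p * l))"
    using assms(2) has_sum_reindex[OF inj, of F S] by (simp add: o_def)
  also have "(F has_sum S) (range (\<lambda>l. p * l)) \<longleftrightarrow> (F has_sum S) UNIV"
    by (rule has_sum_cong_neutral) (use assms(3) in \<open>auto simp: dvd_def\<close>)
  finally show ?thesis .
qed

text \<open>Substituting z^n only spreads the Fourier coefficients over the multiples of n, so the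
  norm does not grow. A fixed function can thus be applied at every scale 8^q at the same
  cost.\<close>

lemma wiener_power_arg:
  assumes "wiener C g" "0 < n"
  shows "wiener C (\<lambda>z. g (z ^ n))"
proof -
  obtain c s where c: "((\<lambda>l. cmod (c l)) has_sum s) UNIV" "s \<le> C"
    "\<And>z. cmod z = 1 \<Longrightarrow> ((\<lambda>l. c l * z powi l) has_sum g z) UNIV" using wienerE[OF assms(1)] by metis
  define d where "d l = (if int n dvd l then c (l div int n) else 0)" for l
  have n: "0 < int n" using assms(2) by simp
  show ?thesis
  proof (rule wienerI[where c = d and s = s])
    show "((\<lambda>l. cmod (d l)) has_sum s) UNIV"
      by (rule has_sum_multiples[OF n]) (use c(1) assms(2) in \<open>auto simp: d_def\<close>)
    fix z :: complex assume "cmod z = 1"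
    then have *: "((\<lambda>l. c l * (z ^ n) powi l) has_sum g (z ^ n)) UNIV" by (intro c(3)) (simp add: norm_power)
    show "((\<lambda>l. d l * z powi l) has_sum g (z ^ n)) UNIV"
    proof (rule has_sum_multiples[OF n])
      show "((\<lambda>l. d (int n * l) * z powi (int n * l)) has_sum g (z ^ n)) UNIV"
        using * assms(2) by (simp add: d_def power_int_power)
    qed (simp add: d_def)
  qed (rule c)
qed

subsection \<open>A Fourier series with plateaus\<close>

text \<open>The dilogarithm on the closed disc. The term n = 0 vanishes because 1 / 0 = 0.\<close>

definition dilog :: "complex \<Rightarrow> complex"
  where "dilog z = (\<Sum>n. 1 / of_nat n ^ 2 * z ^ n)"

lemma summable_inverse_squares': "summable (\<lambda>n. 1 / of_nat n ^ 2 :: 'a::{real_normed_field,banach})"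
  using inverse_power_summable[of 2, where 'a = 'a] by (simp add: divide_inverse)

lemma continuous_dilog: "continuous_on (cball 0 1) dilog"
proof -
  have ul: "uniform_limit (cball 0 1) (\<lambda>k z. \<Sum>n<k. 1 / of_nat n ^ 2 * z ^ n) dilog sequentially"
    unfolding dilog_def
  proof (rule Weierstrass_m_test)
    show "summable (\<lambda>n. 1 / real n ^ 2)" by (rule summable_inverse_squares')
    fix n :: nat and z :: complex assume "z \<in> cball 0 1"
    then have "norm z ^ n \<le> 1" by (simp add: power_le_one)
    then show "norm (1 / of_nat n ^ 2 * z ^ n) \<le> 1 / real n ^ 2"
      by (simp add: norm_mult norm_divide norm_power divide_right_mono)
  qed
  have "continuous_on (cball 0 1) (\<lambda>z. \<Sum>n<k. 1 / of_nat n ^ 2 * z ^ n :: complex)" for k :: nat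
    by (intro continuous_on_sum continuous_on_mult continuous_on_const continuous_on_power continuous_on_id)
  then show ?thesis
    by (intro uniform_limit_theorem[OF _ ul sequentially_bot] always_eventually allI)
qed

text \<open>The product z D avoids a division at z = 0 and is what appears when differentiating
  along circles around 0.\<close>

lemma dilog_deriv:
  assumes "cmod z < 1"
  obtains D where "(dilog has_field_derivative D) (at z)" "z * D = - Ln (1 - z)"
proof -
  define D where "D = (\<Sum>n. diffs (\<lambda>n. 1 / of_nat n ^ 2) n * z ^ n)"
  have d: "diffs (\<lambda>n. 1 / of_nat n ^ 2 :: complex) n = 1 / of_nat (Suc n)" for n
    unfolding diffs_def by (simp add: power2_eq_square del: of_nat_Suc)
  have "(dilog has_field_derivative D) (at z)"
    unfolding dilog_def[abs_def] D_def
    by (rule termdiffs_strong[where K = 1]) (use summable_inverse_squares' assms in auto)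
  moreover have "z * D = - Ln (1 - z)"
  proof -
    have "(\<lambda>n. - (z ^ n) / of_nat n) sums ln (1 - z)"
      using Ln_series'[of "- z"] assms by simp
    then have "(\<lambda>n. - (z ^ Suc n) / of_nat (Suc n)) sums ln (1 - z)"
      by (subst sums_Suc_iff) simp
    then have s: "(\<lambda>n. z ^ Suc n / of_nat (Suc n)) sums - ln (1 - z)"
      using sums_minus by fastforce
    have "summable (\<lambda>n. 1 / of_nat (Suc n) * z ^ n)"
      by (rule summable_comparison_test[OF _ summable_geometric[of "cmod z"]])
        (use assms in \<open>auto intro!: exI[of _ 0] simp: norm_mult norm_divide norm_power divide_le_eq mult_le_cancel_left1 simp del: of_nat_Suc\<close>)
    then have "z * D = (\<Sum>n. z * (1 / of_nat (Suc n) * z ^ n))"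
      unfolding D_def d by (rule suminf_mult[symmetric])
    also have "\<dots> = - Ln (1 - z)" using s by (simp add: sums_iff)
    finally show ?thesis .
  qed
  ultimately show ?thesis by (rule that)
qed

lemma Im_Ln_one_minus_cis:
  assumes "0 < t" "t < 2 * pi"
  shows "Im (Ln (1 - cis t)) = (t - pi) / 2"
proof -
  have s: "0 < sin (t / 2)" using assms by (intro sin_gt_zero) auto
  have c: "cos t = 1 - 2 * (sin (t / 2))\<^sup>2" "sin t = 2 * sin (t / 2) * cos (t / 2)"
    using cos_double_sin[of "t / 2"] sin_double[of "t / 2"] by simp_all
  have eq: "1 - cis t = rcis (2 * sin (t / 2)) ((t - pi) / 2)"
    by (simp add: complex_eq_iff diff_divide_distrib cos_diff sin_diff c power2_eq_square)
  have "Arg (1 - cis t) = (t - pi) / 2"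
    using s assms eq by (intro Arg_unique'[of "2 * sin (t / 2)"]) auto
  moreover have "1 - cis t \<noteq> 0" using s by (simp add: eq)
  ultimately show ?thesis using Arg_eq_Im_Ln by simp
qed

definition cos_series :: "real \<Rightarrow> real"
  where "cos_series t = Re (dilog (cis t))"

text \<open>Abel summation: for r < 1 the angular derivative of Re Li_2(r cis t) is Im Ln(1 - r cis
  t). Subtracting the parabola leaves a function whose derivative \<open>q\<close> is continuous up
  to r = 1 and vanishes there by \<open>Im_Ln_one_minus_cis\<close>; by the mean value theorem its
  increments tend to 0 as r tends to 1. The interval [a, b] avoids t = 0 and t = 2 pi, where the
  logarithm is singular.\<close>

lemma cos_series_diff:
  assumes "0 < a" "a < b" "b < 2 * pi"
  shows "cos_series b - cos_series a = (b - pi)\<^sup>2 / 4 - (a - pi)\<^sup>2 / 4"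
proof -
  define q where "q = (\<lambda>(r, t). Im (Ln (1 - of_real r * cis t)) - (t - pi) / 2)"
  have cos: "cos t < 1" if "t \<in> {a..b}" for t
  proof -
    have "sin (t / 2) > 0" using that assms by (intro sin_gt_zero) auto
    then show ?thesis using cos_double_sin[of "t / 2"] by simp
  qed
  \<comment> \<open>The real part of 1 - r cis t is positive, so the branch cut of Ln is
    avoided.\<close>
  have nz: "1 - of_real r * cis t \<notin> \<real>\<^sub>\<le>\<^sub>0" if "r \<in> {0..1}" "t \<in> {a..b}" for r t
  proof -
    have "r * cos t < 1"
    proof (cases "0 \<le> cos t")
      case True
      then have "r * cos t \<le> 1 * cos t" using that by (intro mult_right_mono) auto
      then show ?thesis using cos[OF that(2)] by simp
    next
      case False
      then have "r * cos t \<le> 0" using that by (intro mult_nonneg_nonpos) auto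
      then show ?thesis by simp
    qed
    then show ?thesis by (simp add: complex_nonpos_Reals_iff)
  qed
  have "continuous_on ({0..1} \<times> {a..b}) q"
    unfolding q_def case_prod_unfold using nz by (intro continuous_intros) auto
  then have uc: "uniformly_continuous_on ({0..1} \<times> {a..b}) q"
    by (intro compact_uniformly_continuous compact_Times) auto
  have q1: "q (1, t) = 0" if "t \<in> {a..b}" for t
    using Im_Ln_one_minus_cis[of t] that assms by (simp add: q_def)
  define \<phi> where "\<phi> r t = Re (dilog (of_real r * cis t)) - (t - pi)\<^sup>2 / 4" for r t
  have d\<phi>: "((\<phi> r) has_real_derivative q (r, t)) (at t)" if r: "0 \<le> r" "r < 1" for r t
  proof -
    let ?z = "of_real r * cis t"
    have "cmod ?z < 1" using r by (simp add: norm_mult)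
    then obtain D where D: "(dilog has_field_derivative D) (at ?z)" "?z * D = - Ln (1 - ?z)"
      by (rule dilog_deriv)
    have "((\<lambda>t. of_real r * cis t) has_vector_derivative (\<i> * ?z)) (at t)"
      unfolding has_vector_derivative_def by (auto intro!: derivative_eq_intros simp: fun_eq_iff scaleR_conv_of_real)
    from field_vector_diff_chain_at[OF this D(1)]
    have "((\<lambda>t. dilog (of_real r * cis t)) has_vector_derivative (\<i> * (?z * D))) (at t)"
      by (simp add: o_def mult.assoc)
    then have "((\<lambda>t. Re (dilog (of_real r * cis t))) has_vector_derivative Re (\<i> * (?z * D))) (at t)"
      by (rule bounded_linear.has_vector_derivative[OF bounded_linear_Re])
    then have "((\<lambda>t. Re (dilog (of_real r * cis t))) has_real_derivative Im (Ln (1 - ?z))) (at t)"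
      by (simp add: D(2) has_real_derivative_iff_has_vector_derivative)
    moreover have "((\<lambda>t. (t - pi)\<^sup>2 / 4) has_real_derivative (t - pi) / 2) (at t)"
      by (auto intro!: derivative_eq_intros)
    ultimately show ?thesis
      unfolding \<phi>_def[abs_def] q_def prod.case by (rule DERIV_diff)
  qed
  have lim: "((\<lambda>r. \<phi> r t) \<longlongrightarrow> \<phi> 1 t) (at_left 1)" for t
  proof -
    have "continuous_on {0..1} (\<lambda>r. dilog (of_real r * cis t))"
      by (rule continuous_on_compose2[OF continuous_dilog]) (auto intro!: continuous_intros simp: norm_mult)
    then have "continuous_on {0..1} (\<lambda>r. \<phi> r t)" unfolding \<phi>_def by (intro continuous_intros)
    then have "((\<lambda>r. \<phi> r t) \<longlongrightarrow> \<phi> 1 t) (at 1 within {0..1})" by (simp add: continuous_on_def)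
    then show ?thesis by (simp add: at_within_Icc_at_left)
  qed
  have "\<bar>\<phi> 1 b - \<phi> 1 a\<bar> \<le> e * (b - a)" if e: "0 < e" for e
  proof (rule tendsto_upperbound)
    show "((\<lambda>r. \<bar>\<phi> r b - \<phi> r a\<bar>) \<longlongrightarrow> \<bar>\<phi> 1 b - \<phi> 1 a\<bar>) (at_left 1)"
      by (intro tendsto_intros lim)
    obtain d where d: "0 < d" "\<And>u v. u \<in> {0..1} \<times> {a..b} \<Longrightarrow> v \<in> {0..1} \<times> {a..b} \<Longrightarrow> dist u v < d \<Longrightarrow> dist (q u) (q v) < e"
      using uc e unfolding uniformly_continuous_on_def by metis
    have "\<bar>\<phi> r b - \<phi> r a\<bar> \<le> e * (b - a)" if r: "max 0 (1 - d) < r" "r < 1" for r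
    proof -
      obtain t where t: "a < t" "t < b" "\<phi> r b - \<phi> r a = (b - a) * q (r, t)"
        using MVT2[OF assms(2), of "\<phi> r" "\<lambda>t. q (r, t)"] d\<phi> r by auto
      have "dist (q (r, t)) (q (1, t)) < e"
        using r t by (intro d(2)) (auto simp: dist_Pair_Pair dist_real_def)
      then have "\<bar>q (r, t)\<bar> \<le> e" using q1[of t] t by (simp add: dist_real_def)
      then show ?thesis using t assms(2) by (simp add: abs_mult mult.commute mult_right_mono)
    qed
    then show "\<forall>\<^sub>F r in at_left 1. \<bar>\<phi> r b - \<phi> r a\<bar> \<le> e * (b - a)"
      using d(1) unfolding eventually_at_left_field by (intro exI[of _ "max 0 (1 - d)"]) auto
  qed simp
  then have "\<bar>\<phi> 1 b - \<phi> 1 a\<bar> \<le> 0 + e" if "0 < e" for e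
    using that assms(2) by (metis add_0 diff_gt_0_iff_gt divide_pos_pos nonzero_eq_divide_eq order_less_irrefl)
  then have "\<bar>\<phi> 1 b - \<phi> 1 a\<bar> \<le> 0" by (rule field_le_epsilon)
  then show ?thesis by (simp add: \<phi>_def cos_series_def)
qed

text \<open>Up to a constant, x^2 - x is the second Bernoulli polynomial. The value \<kappa> is left
  unevaluated since it cancels in the second difference formed in \<open>plateau\<close>.\<close>

lemma cos_series_bernoulli:
  obtains \<kappa> where "\<And>x. 0 < x \<Longrightarrow> x < 1 \<Longrightarrow> cos_series (2 * pi * x) = \<kappa> + pi\<^sup>2 * (x\<^sup>2 - x)"
proof -
  define \<kappa> where "\<kappa> = cos_series pi + pi\<^sup>2 / 4"
  have "cos_series (2 * pi * x) = \<kappa> + pi\<^sup>2 * (x\<^sup>2 - x)" if x: "0 < x" "x < 1" for x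
  proof -
    consider "2 * pi * x < pi" | "2 * pi * x = pi" | "pi < 2 * pi * x" by linarith
    then have "cos_series (2 * pi * x) - cos_series pi = (2 * pi * x - pi)\<^sup>2 / 4"
    proof cases
      case 2
      show ?thesis unfolding 2 by simp
    qed (use cos_series_diff[of "2 * pi * x" pi] cos_series_diff[of pi "2 * pi * x"] x in auto)
    also have "\<dots> = pi\<^sup>2 / 4 + pi\<^sup>2 * (x\<^sup>2 - x)" by (simp add: power2_eq_square field_simps)
    finally show ?thesis by (simp add: \<kappa>_def)
  qed
  then show ?thesis by (rule that)
qed

lemma cos_series_periodic: "cos_series (t - 2 * pi) = cos_series t"
proof -
  have "cis (t - 2 * pi) = cis t" by (simp add: complex_eq_iff cos_diff sin_diff)
  then show ?thesis by (simp add: cos_series_def)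
qed

lemma wiener_cos_series: "\<exists>C g. wiener C g \<and> (\<forall>t. g (cis t) = of_real (cos_series t))"
proof -
  define g :: "nat \<Rightarrow> complex \<Rightarrow> complex"
    where "g n z = of_real (1 / (2 * real n ^ 2)) * (z powi int n + z powi (- int n))" for n z
  have "wiener (cmod (of_real (1 / (2 * real n ^ 2))) * (1 + 1)) (g n)" for n
    unfolding g_def by (intro wiener_scale wiener_add wiener_monomial)
  then have "wiener (1 / real n ^ 2) (g n)" for n by (simp add: norm_divide norm_mult norm_power)
  then have "wiener (\<Sum>n. 1 / real n ^ 2) (\<lambda>z. \<Sum>n. g n z)"
    using summable_inverse_squares' by (intro wiener_suminf)
  moreover have "(\<Sum>n. g n (cis t)) = of_real (cos_series t)" for t
  proof -
    have sm: "summable (\<lambda>n. 1 / of_nat n ^ 2 * cis t ^ n)"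
      by (rule summable_comparison_test[OF _ summable_inverse_squares'[where 'a = real]])
        (auto simp: norm_mult norm_divide norm_power)
    have gn: "g n (cis t) = of_real (Re (1 / of_nat n ^ 2 * cis t ^ n))" for n
    proof -
      have "Re (1 / of_nat n ^ 2 * cis t ^ n) = 1 / real n ^ 2 * cos (real n * t)"
      proof -
        have eq: "1 / of_nat n ^ 2 * cis t ^ n = complex_of_real (1 / real n ^ 2) * cis (real n * t)"
          unfolding Complex.DeMoivre by simp
        show ?thesis unfolding eq by simp
      qed
      moreover have "cis t powi int n + cis t powi (- int n) = of_real (2 * cos (real n * t))"
        by (simp add: cis_power_int Complex.DeMoivre power_int_minus complex_eq_iff)
      ultimately show ?thesis by (auto simp add: g_def)
    qed
    have cs: "(\<lambda>n. Re (1 / of_nat n ^ 2 * cis t ^ n)) sums cos_series t"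
      unfolding cos_series_def dilog_def by (rule sums_Re[OF summable_sums[OF sm]])
    have "(\<lambda>n. g n (cis t)) sums of_real (cos_series t)"
      unfolding gn by (rule sums_of_real[OF cs])
    then show ?thesis by (simp add: sums_iff)
  qed
  ultimately show ?thesis by blast
qed

text \<open>A trapezoid: second differences of the parabola above are constant as long as no node is crossed.\<close>

lemma plateau:
  obtains C \<psi> where "wiener C \<psi>" "\<And>x. 0 \<le> x \<Longrightarrow> x < 3 / 16 \<Longrightarrow> \<psi> (cis (2 * pi * x)) = 0"
    "\<And>x. 7 / 32 < x \<Longrightarrow> x < 5 / 16 \<Longrightarrow> \<psi> (cis (2 * pi * x)) = 1"
proof -
  obtain C0 P where P: "wiener C0 P" "\<And>t. P (cis t) = of_real (cos_series t)" using wiener_cos_series by blast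
  obtain \<kappa> where \<kappa>: "\<And>x. 0 < x \<Longrightarrow> x < 1 \<Longrightarrow> cos_series (2 * pi * x) = \<kappa> + pi\<^sup>2 * (x\<^sup>2 - x)"
    using cos_series_bernoulli by blast
  have neg: "cos_series (2 * pi * x) = \<kappa> + pi\<^sup>2 * (x\<^sup>2 + x)" if "- 1 < x" "x < 0" for x
  proof -
    have "cos_series (2 * pi * x) = cos_series (2 * pi * (x + 1))"
      using cos_series_periodic[of "2 * pi * (x + 1)"] by (simp add: algebra_simps)
    then show ?thesis using \<kappa>[of "x + 1"] that by (simp add: power2_eq_square algebra_simps)
  qed
  define T where "T c z = P (z * cis (- (2 * pi * c)))" for c :: real and z
  have T: "wiener C0 (T c)" for c unfolding T_def by (rule wiener_rotate[OF P(1)]) simp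
  have Tx: "T c (cis (2 * pi * x)) = of_real (cos_series (2 * pi * (x - c)))" for c x
    by (simp add: T_def cis_mult P(2) algebra_simps)
  \<comment> \<open>The nodes carry the signs +, -, -, + and have signed sum 0, so the dependence on
    x cancels and \<pi>^2 v remains as long as x lies to the left of all nodes. Passing the first
    two nodes, at distance 1/32, changes the value by -\<pi>^2 / 16; this explains the factor -16 /
    \<pi>^2.\<close>
  define v :: real where "v = (3 / 16)\<^sup>2 - (7 / 32)\<^sup>2 - (5 / 16)\<^sup>2 + (11 / 32)\<^sup>2"
  define \<psi> where "\<psi> z = of_real (- 16 / pi\<^sup>2) * (T (3 / 16) z + - 1 * T (7 / 32) z + - 1 * T (5 / 16) z + T (11 / 32) z
    + of_real (- pi\<^sup>2 * v))" for z
  have "\<exists>C. wiener C \<psi>" unfolding \<psi>_def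
    using wiener_scale[OF wiener_add[OF wiener_add[OF wiener_add[OF wiener_add[OF T wiener_scale[OF T]]
      wiener_scale[OF T]] T] wiener_const]] by blast
  then obtain C where C: "wiener C \<psi>" by blast
  have \<psi>x: "\<psi> (cis (2 * pi * x)) = of_real (- 16 / pi\<^sup>2 * (cos_series (2 * pi * (x - 3 / 16)) - cos_series (2 * pi * (x - 7 / 32))
    - cos_series (2 * pi * (x - 5 / 16)) + cos_series (2 * pi * (x - 11 / 32)) - pi\<^sup>2 * v))" for x
    unfolding \<psi>_def Tx by simp
  show ?thesis
  proof (rule that[OF C])
    fix x :: real assume x: "0 \<le> x" "x < 3 / 16"
    have "cos_series (2 * pi * (x - 3 / 16)) - cos_series (2 * pi * (x - 7 / 32))
      - cos_series (2 * pi * (x - 5 / 16)) + cos_series (2 * pi * (x - 11 / 32)) = pi\<^sup>2 * v"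
      using neg[of "x - 3 / 16"] neg[of "x - 7 / 32"] neg[of "x - 5 / 16"] neg[of "x - 11 / 32"] x
      by (simp add: v_def power2_eq_square algebra_simps)
    then show "\<psi> (cis (2 * pi * x)) = 0" unfolding \<psi>x by simp
  next
    fix x :: real assume x: "7 / 32 < x" "x < 5 / 16"
    have "cos_series (2 * pi * (x - 3 / 16)) - cos_series (2 * pi * (x - 7 / 32))
      - cos_series (2 * pi * (x - 5 / 16)) + cos_series (2 * pi * (x - 11 / 32)) = pi\<^sup>2 * v - pi\<^sup>2 / 16"
      using \<kappa>[of "x - 3 / 16"] \<kappa>[of "x - 7 / 32"] neg[of "x - 5 / 16"] neg[of "x - 11 / 32"] x
      by (simp add: v_def power2_eq_square algebra_simps)
    then show "\<psi> (cis (2 * pi * x)) = 1" unfolding \<psi>x by simp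
  qed
qed

subsection \<open>Summation over boxes in the dual group\<close>

lemma sum_symmetric_Suc:
  fixes f :: "int \<Rightarrow> 'a::comm_monoid_add"
  assumes "0 < U"
  shows "sum f {- int (Suc U)<..<int (Suc U)} = sum f {- int U<..<int U} + (f (int U) + f (- int U))"
proof -
  have "{- int (Suc U)<..<int (Suc U)} = insert (int U) (insert (- int U) {- int U<..<int U})" by auto
  then show ?thesis using assms by (simp add: add_ac)
qed

lemma sum_symmetric_one:
  fixes f :: "int \<Rightarrow> 'a::comm_monoid_add"
  shows "sum f {- int (Suc 0)<..<int (Suc 0)} = f 0"
proof -
  have "{- int (Suc 0)<..<int (Suc 0)} = {0}" by auto
  then show ?thesis by simp
qed

text \<open>The cubic decay is dictated by \<open>box_sums\<close>: sums with weights |u| + |v| must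
  stay bounded, and boundary terms with factors of size U must vanish as U grows. The factor 64
  keeps the nonzero frequencies small against the value 1 at 0.\<close>

definition decay :: "int \<Rightarrow> real"
  where "decay u = (if u = 0 then 1 else 1 / (64 * \<bar>real_of_int u\<bar> ^ 3))"

lemma decay_nonneg: "0 \<le> decay u"
  by (simp add: decay_def)

lemma sum_inverse_squares_le:
  "(\<Sum>u\<in>{- int (Suc (Suc n))<..<int (Suc (Suc n))}. if u = 0 then 0 else 1 / (real_of_int u)\<^sup>2) \<le> 2 * (2 - 1 / real (Suc n))"
proof (induction n)
  case 0
  show ?case by (subst sum_symmetric_Suc) (simp_all add: sum_symmetric_one[simplified])
next
  case (Suc n)
  have "2 * (2 - 1 / real (Suc n)) + 2 / (real (Suc (Suc n)))\<^sup>2 \<le> 2 * (2 - 1 / real (Suc (Suc n)))"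
  proof -
    have "1 / (real (Suc (Suc n)))\<^sup>2 \<le> 1 / (real (Suc n) * real (Suc (Suc n)))"
      by (intro divide_left_mono) (auto simp: power2_eq_square)
    also have "\<dots> = 1 / real (Suc n) - 1 / real (Suc (Suc n))" by (simp add: field_simps)
    finally show ?thesis by simp
  qed
  moreover have "(- 2 - real n)\<^sup>2 = (2 + real n)\<^sup>2" by (simp add: power2_eq_square algebra_simps)
  ultimately show ?case using Suc by (subst sum_symmetric_Suc) simp_all
qed

lemma decay_sums:
  assumes "2 \<le> U"
  shows "(\<Sum>u\<in>{- int U<..<int U}. decay u) \<le> 17 / 16"
    and "(\<Sum>u\<in>{- int U<..<int U}. \<bar>real_of_int u\<bar> * decay u) \<le> 1 / 16"
proof -
  define n where "n = U - 2"
  have U: "U = Suc (Suc n)" using assms by (simp add: n_def)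
  let ?I = "{- int U<..<int U}"
  have S: "(\<Sum>u\<in>?I. if u = 0 then 0 else 1 / (real_of_int u)\<^sup>2) \<le> 4"
  proof -
    have *: "2 * (2 - t) \<le> 4" if "0 \<le> t" for t :: real using that by simp
    have "2 * (2 - 1 / real (Suc n)) \<le> 4" by (rule *) simp
    then show ?thesis unfolding U by (rule order_trans[OF sum_inverse_squares_le])
  qed
  have le: "\<bar>real_of_int u\<bar> * decay u \<le> 1 / 64 * (if u = 0 then 0 else 1 / (real_of_int u)\<^sup>2)" for u
    by (auto simp: decay_def power2_eq_square power3_eq_cube)
  have "(\<Sum>u\<in>?I. \<bar>real_of_int u\<bar> * decay u) \<le> 1 / 64 * (\<Sum>u\<in>?I. if u = 0 then 0 else 1 / (real_of_int u)\<^sup>2)"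
    unfolding sum_distrib_left by (rule sum_mono) (rule le)
  then show 1: "(\<Sum>u\<in>?I. \<bar>real_of_int u\<bar> * decay u) \<le> 1 / 16" using S by simp
  have "decay u \<le> (if u = 0 then 1 else 0) + \<bar>real_of_int u\<bar> * decay u" for u
  proof (cases "u = 0")
    case False
    then have "1 * decay u \<le> \<bar>real_of_int u\<bar> * decay u" by (intro mult_right_mono decay_nonneg) linarith
    then show ?thesis using False by simp
  qed (simp add: decay_def)
  then have "(\<Sum>u\<in>?I. decay u) \<le> (\<Sum>u\<in>?I. (if u = 0 then 1 else 0) + \<bar>real_of_int u\<bar> * decay u)"
    by (rule sum_mono)
  also have "\<dots> = 1 + (\<Sum>u\<in>?I. \<bar>real_of_int u\<bar> * decay u)" using assms by (simp add: sum.distrib)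
  finally show "(\<Sum>u\<in>?I. decay u) \<le> 17 / 16" using 1 by simp
qed

text \<open>Summation by parts: against a linear weight the difference c(u + 1) - c(u - 1) leaves -2
  times the plain sum. The constant b enters only the boundary terms; it will be i v or -i u, the
  part of the weight in the other variable.\<close>

lemma telescoping:
  fixes c :: "int \<Rightarrow> complex"
  assumes "0 < U"
  shows "(\<Sum>u\<in>{- int U<..<int U}. (of_int u + b) * (c (u + 1) - c (u - 1)))
    = - 2 * (\<Sum>u\<in>{- int U<..<int U}. c u)
      + ((of_nat U - 1 + b) * c (int U) + (of_nat U + b) * c (int U - 1)
        + (of_nat U - 1 - b) * c (- int U) + (of_nat U - b) * c (1 - int U))"
  using assms
proof (induction U rule: nat_induct_non_zero)
  case 1
  show ?case by (simp add: sum_symmetric_one[simplified] algebra_simps)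
next
  case (Suc U)
  show ?case
    unfolding sum_symmetric_Suc[OF Suc(1)] Suc(2)
    using arg_cong[of "- int U - 1" "- 1 - int U" c] by (simp add: algebra_simps)
qed

text \<open>Each of the four boundary indices has modulus U - 1 or U, where \<open>decay\<close> is
  at most 1 / (64 (U - 1)^3), and each factor in front is at most U + |t|.\<close>

lemma boundary_bound:
  fixes c :: "int \<Rightarrow> complex"
  assumes U: "2 \<le> U" and c: "\<And>u. \<bar>u\<bar> \<le> int U \<Longrightarrow> cmod (c u) \<le> decay u * d" and d: "0 \<le> d"
    and b: "cmod b = \<bar>t\<bar>"
  shows "cmod ((of_nat U - 1 + b) * c (int U) + (of_nat U + b) * c (int U - 1)
        + (of_nat U - 1 - b) * c (- int U) + (of_nat U - b) * c (1 - int U))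
    \<le> 4 / (64 * (real U - 1) ^ 3) * ((real U + \<bar>t\<bar>) * d)"
proof -
  define e where "e = 1 / (64 * (real U - 1) ^ 3)"
  have dec: "decay u \<le> e" if "int U - 1 \<le> \<bar>u\<bar>" for u
  proof -
    have "u \<noteq> 0" using that U by auto
    moreover have "(real U - 1) ^ 3 \<le> \<bar>real_of_int u\<bar> ^ 3" using that U by (intro power_mono) linarith+
    moreover have "0 < (real U - 1) ^ 3" using U by simp
    ultimately show ?thesis using U by (auto simp: decay_def e_def intro!: divide_left_mono)
  qed
  have cu: "cmod (c u) \<le> e * d" if "int U - 1 \<le> \<bar>u\<bar>" "\<bar>u\<bar> \<le> int U" for u
    using c[OF that(2)] mult_right_mono[OF dec[OF that(1)] d] by linarith
  have e0: "0 \<le> e * d" using d U by (simp add: e_def)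
  have U1: "cmod (of_nat U - 1) \<le> real U"
  proof -
    have "cmod (of_nat U - 1) = cmod (of_real (real U - 1))" by simp
    also have "\<dots> \<le> real U" using U by (simp only: norm_of_real)
    finally show ?thesis .
  qed
  have n1: "cmod (of_nat U - 1 + b) \<le> real U + \<bar>t\<bar>" "cmod (of_nat U - 1 - b) \<le> real U + \<bar>t\<bar>"
    using norm_triangle_ineq[of "of_nat U - 1" b] norm_triangle_ineq4[of "of_nat U - 1" b] U1 b by linarith+
  have n2: "cmod (of_nat U + b) \<le> real U + \<bar>t\<bar>" "cmod (of_nat U - b) \<le> real U + \<bar>t\<bar>"
    using norm_triangle_ineq[of "of_nat U" b] norm_triangle_ineq4[of "of_nat U" b] b by simp_all
  have m: "cmod (x * y) \<le> (real U + \<bar>t\<bar>) * (e * d)" if "cmod x \<le> real U + \<bar>t\<bar>" "cmod y \<le> e * d" for x y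
    unfolding norm_mult using that by (intro mult_mono) auto
  have "cmod ((of_nat U - 1 + b) * c (int U) + (of_nat U + b) * c (int U - 1)
        + (of_nat U - 1 - b) * c (- int U) + (of_nat U - b) * c (1 - int U))
    \<le> (real U + \<bar>t\<bar>) * (e * d) + (real U + \<bar>t\<bar>) * (e * d) + (real U + \<bar>t\<bar>) * (e * d) + (real U + \<bar>t\<bar>) * (e * d)"
    using U by (intro norm_add_rule_thm m n1 n2 cu) auto
  also have "\<dots> = 4 * e * ((real U + \<bar>t\<bar>) * d)" by (simp add: algebra_simps)
  finally show ?thesis by (simp add: e_def)
qed

lemma box_boundary_sum:
  assumes U: "2 \<le> U" and R: "\<And>t. t \<in> {- int U<..<int U} \<Longrightarrow>
    cmod (R t) \<le> 4 / (64 * (real U - 1) ^ 3) * ((real U + \<bar>real_of_int t\<bar>) * decay t)"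
  shows "cmod (\<Sum>t\<in>{- int U<..<int U}. R t) \<le> 1 / (4 * (real U - 1))"
proof -
  let ?I = "{- int U<..<int U}"
  have "cmod (\<Sum>t\<in>?I. R t) \<le> (\<Sum>t\<in>?I. 4 / (64 * (real U - 1) ^ 3) * ((real U + \<bar>real_of_int t\<bar>) * decay t))"
    by (rule sum_norm_le) (rule R)
  also have "\<dots> = 4 / (64 * (real U - 1) ^ 3) * (real U * (\<Sum>t\<in>?I. decay t) + (\<Sum>t\<in>?I. \<bar>real_of_int t\<bar> * decay t))"
    unfolding sum_distrib_left[symmetric] by (simp add: distrib_right sum.distrib sum_distrib_left)
  also have "\<dots> \<le> 4 / (64 * (real U - 1) ^ 3) * (real U * (17 / 16) + 1 / 16)"
    using U decay_sums[OF U] by (intro mult_left_mono add_mono) auto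
  also have "\<dots> \<le> 4 / (64 * (real U - 1) ^ 3) * (4 * (real U - 1))"
    using U by (intro mult_left_mono) auto
  also have "\<dots> = 1 / (4 * (real U - 1) * (real U - 1))"
  proof -
    have *: "4 / (64 * w ^ 3) * (4 * w) = 1 / (4 * w * w)" if "w \<noteq> 0" for w :: real
      using that by (simp add: power3_eq_cube field_simps)
    show ?thesis by (rule *) (use U in auto)
  qed
  also have "\<dots> \<le> 1 / (4 * (real U - 1))"
    using U by (intro divide_left_mono) (auto simp: mult_le_cancel_left1)
  finally show ?thesis .
qed

text \<open>In the application c u v is a Fourier coefficient of exp(i(u f_1 + v f_2)).
  Multiplication by sin f_1 turns it into \<open>X\<close>, by i sin f_2 into \<open>Y\<close>, so
  \<open>X + Y\<close> belongs to the generator of the ideal and \<open>X - Y\<close> to its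
  conjugate.\<close>

lemma box_sums:
  fixes c :: "int \<Rightarrow> int \<Rightarrow> complex"
  assumes U: "2 \<le> U"
    and c: "\<And>u v. \<bar>u\<bar> \<le> int U \<Longrightarrow> \<bar>v\<bar> \<le> int U \<Longrightarrow> cmod (c u v) \<le> decay u * decay v"
  defines "I \<equiv> {- int U<..<int U}"
  defines "X \<equiv> \<lambda>u v. - \<i> / 2 * (c (u + 1) v - c (u - 1) v)"
    and "Y \<equiv> \<lambda>u v. (c u (v + 1) - c u (v - 1)) / 2"
  shows "cmod (\<Sum>u\<in>I. \<Sum>v\<in>I. (of_int u + \<i> * of_int v) * c u v) \<le> 1"
    and "cmod (\<Sum>u\<in>I. \<Sum>v\<in>I. (of_int u + \<i> * of_int v) * (X u v + Y u v)) \<le> 1 / (real U - 1)"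
    and "c 0 0 = 1 \<Longrightarrow> 1 \<le> cmod (\<Sum>u\<in>I. \<Sum>v\<in>I. (of_int u + \<i> * of_int v) * (X u v - Y u v))"
proof -
  have cI: "cmod (c u v) \<le> decay u * decay v" if "u \<in> I" "v \<in> I" for u v
    using that by (intro c) (auto simp: I_def)
  note ds = decay_sums[OF U, folded I_def]
  have ds0: "0 \<le> (\<Sum>u\<in>I. decay u)" "0 \<le> (\<Sum>u\<in>I. \<bar>real_of_int u\<bar> * decay u)"
    by (auto intro!: sum_nonneg mult_nonneg_nonneg decay_nonneg)
  have "cmod (\<Sum>u\<in>I. \<Sum>v\<in>I. (of_int u + \<i> * of_int v) * c u v)
      \<le> (\<Sum>u\<in>I. \<Sum>v\<in>I. (\<bar>real_of_int u\<bar> + \<bar>real_of_int v\<bar>) * (decay u * decay v))"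
  proof (intro sum_norm_le)
    fix u v assume "u \<in> I" "v \<in> I"
    have "cmod (of_int u + \<i> * of_int v) \<le> cmod (of_int u) + cmod (\<i> * of_int v)" by (rule norm_triangle_ineq)
    also have "\<dots> = \<bar>real_of_int u\<bar> + \<bar>real_of_int v\<bar>" by (simp add: norm_mult)
    finally show "cmod ((of_int u + \<i> * of_int v) * c u v) \<le> (\<bar>real_of_int u\<bar> + \<bar>real_of_int v\<bar>) * (decay u * decay v)"
      unfolding norm_mult using cI[OF \<open>u \<in> I\<close> \<open>v \<in> I\<close>] by (intro mult_mono) auto
  qed
  also have "\<dots> = (\<Sum>u\<in>I. \<Sum>v\<in>I. (\<bar>real_of_int u\<bar> * decay u) * decay v) + (\<Sum>u\<in>I. \<Sum>v\<in>I. decay u * (\<bar>real_of_int v\<bar> * decay v))"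
    by (simp add: algebra_simps sum.distrib)
  also have "\<dots> = 2 * ((\<Sum>u\<in>I. \<bar>real_of_int u\<bar> * decay u) * (\<Sum>u\<in>I. decay u))"
    by (simp flip: sum_product)
  also have "\<dots> \<le> 2 * (1 / 16 * (17 / 16))" using ds ds0 by (intro mult_left_mono mult_mono) auto
  finally show "cmod (\<Sum>u\<in>I. \<Sum>v\<in>I. (of_int u + \<i> * of_int v) * c u v) \<le> 1" by simp
  define R1 where "R1 v = (of_nat U - 1 + \<i> * of_int v) * c (int U) v + (of_nat U + \<i> * of_int v) * c (int U - 1) v
        + (of_nat U - 1 - \<i> * of_int v) * c (- int U) v + (of_nat U - \<i> * of_int v) * c (1 - int U) v" for v
  define R2 where "R2 u = (of_nat U - 1 + - \<i> * of_int u) * c u (int U) + (of_nat U + - \<i> * of_int u) * c u (int U - 1)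
        + (of_nat U - 1 - - \<i> * of_int u) * c u (- int U) + (of_nat U - - \<i> * of_int u) * c u (1 - int U)" for u
  have R1: "cmod (\<Sum>v\<in>I. R1 v) \<le> 1 / (4 * (real U - 1))"
    unfolding I_def
  proof (rule box_boundary_sum[OF U])
    fix v assume "v \<in> {- int U<..<int U}"
    then show "cmod (R1 v) \<le> 4 / (64 * (real U - 1) ^ 3) * ((real U + \<bar>real_of_int v\<bar>) * decay v)"
      unfolding R1_def by (intro boundary_bound[OF U _ decay_nonneg] c) (auto simp: norm_mult)
  qed
  have R2: "cmod (\<Sum>u\<in>I. R2 u) \<le> 1 / (4 * (real U - 1))"
    unfolding I_def
  proof (rule box_boundary_sum[OF U])
    fix u assume u: "u \<in> {- int U<..<int U}"
    have "cmod (c u v) \<le> decay v * decay u" if "\<bar>v\<bar> \<le> int U" for v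
      using c[OF _ that, of u] u by (simp add: mult.commute abs_le_iff)
    then show "cmod (R2 u) \<le> 4 / (64 * (real U - 1) ^ 3) * ((real U + \<bar>real_of_int u\<bar>) * decay u)"
      unfolding R2_def by (intro boundary_bound[OF U _ decay_nonneg]) (auto simp: norm_mult)
  qed
  define T where "T = (\<Sum>u\<in>I. \<Sum>v\<in>I. c u v)"
  have T': "T = (\<Sum>v\<in>I. \<Sum>u\<in>I. c u v)" unfolding T_def by (rule sum.swap)
  have U0: "0 < U" using U by simp
  have "(\<Sum>u\<in>I. \<Sum>v\<in>I. (of_int u + \<i> * of_int v) * X u v)
      = - \<i> / 2 * (\<Sum>v\<in>I. \<Sum>u\<in>I. (of_int u + \<i> * of_int v) * (c (u + 1) v - c (u - 1) v))"
    unfolding X_def sum_distrib_left by (subst sum.swap) (simp add: mult_ac)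
  also have "\<dots> = - \<i> / 2 * (\<Sum>v\<in>I. - 2 * (\<Sum>u\<in>I. c u v) + R1 v)"
    unfolding R1_def I_def by (intro arg_cong2[where f = times] refl sum.cong telescoping[OF U0])
  also have "(\<Sum>v\<in>I. - 2 * (\<Sum>u\<in>I. c u v) + R1 v) = - 2 * T + (\<Sum>v\<in>I. R1 v)"
    by (simp only: T' sum.distrib sum_distrib_left)
  finally have SX: "(\<Sum>u\<in>I. \<Sum>v\<in>I. (of_int u + \<i> * of_int v) * X u v) = \<i> * T - \<i> / 2 * (\<Sum>v\<in>I. R1 v)"
    by (simp add: algebra_simps)
  have "(\<Sum>u\<in>I. \<Sum>v\<in>I. (of_int u + \<i> * of_int v) * Y u v)
      = \<i> / 2 * (\<Sum>u\<in>I. \<Sum>v\<in>I. (of_int v + - \<i> * of_int u) * (c u (v + 1) - c u (v - 1)))"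
    unfolding Y_def sum_distrib_left
  proof (intro sum.cong refl)
    fix u v
    have *: "of_int u + \<i> * of_int v = \<i> * (of_int v + - \<i> * of_int u)" by (simp add: algebra_simps)
    show "(of_int u + \<i> * of_int v) * ((c u (v + 1) - c u (v - 1)) / 2)
      = \<i> / 2 * ((of_int v + - \<i> * of_int u) * (c u (v + 1) - c u (v - 1)))" by (subst *) simp
  qed
  also have "\<dots> = \<i> / 2 * (\<Sum>u\<in>I. - 2 * (\<Sum>v\<in>I. c u v) + R2 u)"
    unfolding R2_def I_def by (intro arg_cong2[where f = times] refl sum.cong telescoping[OF U0])
  also have "(\<Sum>u\<in>I. - 2 * (\<Sum>v\<in>I. c u v) + R2 u) = - 2 * T + (\<Sum>u\<in>I. R2 u)"
    unfolding T_def by (simp only: sum.distrib sum_distrib_left)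
  finally have SY: "(\<Sum>u\<in>I. \<Sum>v\<in>I. (of_int u + \<i> * of_int v) * Y u v) = - \<i> * T + \<i> / 2 * (\<Sum>u\<in>I. R2 u)"
    by (simp add: algebra_simps)
  \<comment> \<open>The main terms i T and -i T cancel in the sum and reinforce each other in the
    difference: the discrete form of applying \<partial>_1 + i \<partial>_2 to s_1 + i s_2 and to
    s_1 - i s_2.\<close>
  have eq1: "(\<Sum>u\<in>I. \<Sum>v\<in>I. (of_int u + \<i> * of_int v) * (X u v + Y u v)) = \<i> / 2 * ((\<Sum>u\<in>I. R2 u) - (\<Sum>v\<in>I. R1 v))"
    by (simp add: distrib_left sum.distrib SX SY) (simp add: algebra_simps)
  have "cmod (\<Sum>u\<in>I. \<Sum>v\<in>I. (of_int u + \<i> * of_int v) * (X u v + Y u v)) = cmod ((\<Sum>u\<in>I. R2 u) - (\<Sum>v\<in>I. R1 v)) / 2"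
    unfolding eq1 by (simp add: norm_mult norm_divide)
  also have "\<dots> \<le> 1 / (4 * (real U - 1))"
    using norm_triangle_ineq4[of "\<Sum>u\<in>I. R2 u" "\<Sum>v\<in>I. R1 v"] R1 R2 by linarith
  also have "\<dots> \<le> 1 / (real U - 1)" using U by (intro divide_left_mono) auto
  finally show "cmod (\<Sum>u\<in>I. \<Sum>v\<in>I. (of_int u + \<i> * of_int v) * (X u v + Y u v)) \<le> 1 / (real U - 1)" .
  assume c00: "c 0 0 = 1"
  \<comment> \<open>The coefficient at the origin is 1, and all others add up to at most (17/16)^2 -
    1 < 1/4, so T stays away from 0.\<close>
  have "T = 1 + (\<Sum>u\<in>I. \<Sum>v\<in>I. if u = 0 \<and> v = 0 then 0 else c u v)"
  proof -
    have I0: "0 \<in> I" "finite I" using U by (auto simp: I_def)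
    have "T = (\<Sum>u\<in>I. \<Sum>v\<in>I. (if u = 0 \<and> v = 0 then 1 else 0) + (if u = 0 \<and> v = 0 then 0 else c u v))"
      unfolding T_def by (intro sum.cong refl) (auto simp: c00)
    also have "\<dots> = (\<Sum>u\<in>I. \<Sum>v\<in>I. (if u = 0 \<and> v = 0 then 1 else 0)) + (\<Sum>u\<in>I. \<Sum>v\<in>I. if u = 0 \<and> v = 0 then 0 else c u v)"
      by (simp only: sum.distrib)
    also have "(\<Sum>u\<in>I. \<Sum>v\<in>I. (if u = 0 \<and> v = 0 then 1 else 0 :: complex)) = (\<Sum>u\<in>I. if u = 0 then 1 else 0)"
      using I0 by (intro sum.cong refl) auto
    also have "\<dots> = 1" using I0 by simp
    finally show ?thesis .
  qed
  moreover have "cmod (\<Sum>u\<in>I. \<Sum>v\<in>I. if u = 0 \<and> v = 0 then 0 else c u v) \<le> (\<Sum>u\<in>I. \<Sum>v\<in>I. decay u * decay v - (if u = 0 \<and> v = 0 then 1 else 0))"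
    by (intro sum_norm_le) (auto simp: cI decay_def[of 0])
  moreover have "(\<Sum>u\<in>I. \<Sum>v\<in>I. decay u * decay v - (if u = 0 \<and> v = 0 then 1 else 0)) = (\<Sum>u\<in>I. decay u) * (\<Sum>v\<in>I. decay v) - 1"
  proof -
    have I0: "0 \<in> I" "finite I" using U by (auto simp: I_def)
    have "(\<Sum>u\<in>I. \<Sum>v\<in>I. (if u = 0 \<and> v = 0 then 1 else 0 :: real)) = (\<Sum>u\<in>I. if u = 0 then 1 else 0)"
      using I0 by (intro sum.cong refl) auto
    also have "\<dots> = 1" using I0 by simp
    finally show ?thesis by (simp add: sum_subtractf sum_product)
  qed
  moreover have "(\<Sum>u\<in>I. decay u) * (\<Sum>v\<in>I. decay v) \<le> 17 / 16 * (17 / 16)"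
    using ds ds0 by (intro mult_mono) auto
  ultimately have T: "cmod (T - 1) \<le> 1 / 4" by simp
  have eq2: "(\<Sum>u\<in>I. \<Sum>v\<in>I. (of_int u + \<i> * of_int v) * (X u v - Y u v)) = \<i> / 2 * (4 * T - ((\<Sum>u\<in>I. R2 u) + (\<Sum>v\<in>I. R1 v)))"
    by (simp add: right_diff_distrib sum_subtractf SX SY) (simp add: algebra_simps)
  have "cmod (\<Sum>u\<in>I. \<Sum>v\<in>I. (of_int u + \<i> * of_int v) * (X u v - Y u v))
      = cmod (4 * T - ((\<Sum>u\<in>I. R2 u) + (\<Sum>v\<in>I. R1 v))) / 2"
    unfolding eq2 by (simp add: norm_mult norm_divide)
  moreover have "cmod (4 * T) - cmod ((\<Sum>u\<in>I. R2 u) + (\<Sum>v\<in>I. R1 v)) \<le> cmod (4 * T - ((\<Sum>u\<in>I. R2 u) + (\<Sum>v\<in>I. R1 v)))"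
    by (rule norm_triangle_ineq2)
  moreover have "cmod ((\<Sum>u\<in>I. R2 u) + (\<Sum>v\<in>I. R1 v)) \<le> 1 / 4 + 1 / 4"
  proof -
    have "1 / (4 * (real U - 1)) \<le> 1 / 4" using U by (intro divide_left_mono) auto
    then show ?thesis using norm_triangle_ineq[of "\<Sum>u\<in>I. R2 u" "\<Sum>v\<in>I. R1 v"] R1 R2 by linarith
  qed
  moreover have "3 / 4 \<le> cmod T"
    using T norm_triangle_ineq2[of 1 T] by (simp add: norm_minus_commute)
  ultimately show "1 \<le> cmod (\<Sum>u\<in>I. \<Sum>v\<in>I. (of_int u + \<i> * of_int v) * (X u v - Y u v))"
    by (simp add: norm_mult)
qed

subsection \<open>Spectral synthesis fails on a Cantor set\<close>

text \<open>Each position used in \<open>decay_block\<close> will contribute a factor at most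
  sqrt(7/8), and (7/8)^16 \<le> 1/8. So 32 (k + 3) of them give at most 8^(-(k+3)) = 1 / (64
  (2^(k+1))^3), which suffices for |u| < 2^(k+1). The growth is linear in k, which leaves the
  weights summable.\<close>

definition copies :: "nat \<Rightarrow> nat"
  where "copies k = 32 * (k + 3)"

text \<open>The digit at position \<open>prod_encode (k, m)\<close> carries the weight \<open>\<pi>/2\<^sup>k\<^sup>+\<^sup>1\<close>, for even \<open>m\<close> in the first and
  for odd \<open>m\<close> in the second of two functions on the Cantor set of numbers with base 8 digits in
  \<open>{0, 1, 2}\<close>.\<close>

definition weight :: "nat \<Rightarrow> real"
  where "weight q = (case prod_decode q of (k, m) \<Rightarrow> if m < 2 * copies k then pi / 2 ^ (k + 1) else 0)"

definition first_kind :: "nat \<Rightarrow> bool"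
  where "first_kind q \<longleftrightarrow> even (snd (prod_decode q))"

definition phase :: "int \<Rightarrow> int \<Rightarrow> nat \<Rightarrow> real"
  where "phase u v q = real_of_int (if first_kind q then u else v) * weight q"

text \<open>Exactly the positions of nonzero weight at levels k < K.\<close>

definition positions :: "nat \<Rightarrow> nat set"
  where "positions K = prod_encode ` (SIGMA k:{..<K}. {..<2 * copies k})"

definition angle :: "nat set \<Rightarrow> (nat \<Rightarrow> nat) \<Rightarrow> real"
  where "angle Q y = (\<Sum>q\<in>Q. real (y q) / 8 ^ (q + 1))"

definition digits :: "nat set \<Rightarrow> (nat \<Rightarrow> nat) set"
  where "digits Q = PiE Q (\<lambda>_. {..<3})"

text \<open>The exponential exp(i(u f_1 + v f_2)) in product form (see \<open>chi_eq_cis\<close>),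
  so that sums over digit sequences factor position by position.\<close>

definition chi :: "nat set \<Rightarrow> int \<Rightarrow> int \<Rightarrow> (nat \<Rightarrow> nat) \<Rightarrow> complex"
  where "chi Q u v y = (\<Prod>q\<in>Q. if y q = 2 then cis (phase u v q) else 1)"

lemma finite_positions: "finite (positions K)"
  by (simp add: positions_def)

lemma finite_digits: "finite Q \<Longrightarrow> finite (digits Q)"
  unfolding digits_def by (rule finite_PiE) auto

lemma cis_sum: "finite Q \<Longrightarrow> cis (\<Sum>q\<in>Q. f q) = (\<Prod>q\<in>Q. cis (f q))"
  by (induction Q rule: finite_induct) (simp_all flip: cis_mult)

text \<open>For z = cis t the expression is cis t (1 + r cis (s/2)) with r = 2 cos (t + s/2): the
  outer digits 0 and 2 combine to a real multiple of cis (s/2), the middle digit contributes 1. The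
  resulting bound is free of t, that is, of the frequency, and lies below 9 unless cos (s/2) is
  \<plusminus>1.\<close>

lemma factor_bound:
  assumes "cmod z = 1"
  shows "(cmod (1 + z + z\<^sup>2 * cis s))\<^sup>2 \<le> 5 + 4 * \<bar>cos (s / 2)\<bar>"
proof -
  obtain t where z: "z = cis t" using assms by (metis cis_Arg norm_zero sgn_eq div_by_1 of_real_1 zero_neq_one)
  define r where "r = 2 * cos (t + s / 2)"
  have "1 + z + z\<^sup>2 * cis s = cis t * (1 + of_real r * cis (s / 2))"
  proof -
    have "of_real (2 * cos x) = cis x + cis (- x)" for x by (simp add: complex_eq_iff)
    then have "of_real r = cis (t + s / 2) + cis (- (t + s / 2))" unfolding r_def .
    then have "cis t * (1 + of_real r * cis (s / 2)) = cis t + cis (t + (t + s / 2) + s / 2) + cis (t + - (t + s / 2) + s / 2)"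
      by (simp only: cis_mult[symmetric]) (simp add: algebra_simps)
    moreover have "t + (t + s / 2) + s / 2 = t + t + s" "t + - (t + s / 2) + s / 2 = 0" by simp_all
    ultimately show ?thesis by (simp add: z power2_eq_square cis_mult add_ac)
  qed
  then have "(cmod (1 + z + z\<^sup>2 * cis s))\<^sup>2 = (cmod (1 + of_real r * cis (s / 2)))\<^sup>2" by (simp add: norm_mult)
  also have "\<dots> = (1 + r * cos (s / 2))\<^sup>2 + (r * sin (s / 2))\<^sup>2" by (simp add: cmod_power2)
  also have "\<dots> = 1 + 2 * (r * cos (s / 2)) + r\<^sup>2 * ((cos (s / 2))\<^sup>2 + (sin (s / 2))\<^sup>2)"
    by algebra
  also have "\<dots> = 1 + 2 * (r * cos (s / 2)) + r\<^sup>2" by simp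
  also have "\<dots> \<le> 1 + 4 * \<bar>cos (s / 2)\<bar> + 4"
  proof -
    have r2: "\<bar>r\<bar> \<le> 2" by (simp add: r_def abs_mult)
    have "r * cos (s / 2) \<le> \<bar>r\<bar> * \<bar>cos (s / 2)\<bar>" by (metis abs_ge_self abs_mult)
    also have "\<dots> \<le> 2 * \<bar>cos (s / 2)\<bar>" using r2 by (intro mult_right_mono) auto
    finally have 1: "2 * (r * cos (s / 2)) \<le> 4 * \<bar>cos (s / 2)\<bar>" by simp
    have "r\<^sup>2 \<le> 2\<^sup>2" using abs_le_square_iff[of r 2] r2 by simp
    then show ?thesis using 1 by simp
  qed
  finally show ?thesis by simp
qed

section \<open>Decay of the Fourier coefficients, uniformly in the frequency\<close>

lemma character_sum:
  assumes "finite Q"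
  shows "(\<Sum>y\<in>digits Q. cis (2 * pi * angle Q y) powi l * chi Q u v y)
    = (\<Prod>q\<in>Q. 1 + cis (2 * pi * real_of_int l / 8 ^ (q + 1)) + (cis (2 * pi * real_of_int l / 8 ^ (q + 1)))\<^sup>2 * cis (phase u v q))"
proof -
  define \<zeta> where "\<zeta> q = cis (2 * pi * real_of_int l / 8 ^ (q + 1))" for q
  have "cis (2 * pi * angle Q y) powi l = (\<Prod>q\<in>Q. \<zeta> q ^ y q)" for y
  proof -
    have "cis (2 * pi * angle Q y) powi l = cis (\<Sum>q\<in>Q. real (y q) * (2 * pi * real_of_int l / 8 ^ (q + 1)))"
      unfolding cis_power_int angle_def by (simp add: sum_distrib_left mult_ac)
    also have "\<dots> = (\<Prod>q\<in>Q. \<zeta> q ^ y q)"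
      unfolding cis_sum[OF assms] \<zeta>_def Complex.DeMoivre ..
    finally show ?thesis .
  qed
  then have "(\<Sum>y\<in>digits Q. cis (2 * pi * angle Q y) powi l * chi Q u v y)
      = (\<Sum>y\<in>digits Q. \<Prod>q\<in>Q. \<zeta> q ^ y q * (if y q = 2 then cis (phase u v q) else 1))"
    by (simp add: chi_def prod.distrib)
  also have "\<dots> = (\<Prod>q\<in>Q. \<Sum>d<3. \<zeta> q ^ d * (if d = 2 then cis (phase u v q) else 1))"
    unfolding digits_def by (rule prod_sum_PiE[symmetric]) (use assms in auto)
  also have "\<dots> = (\<Prod>q\<in>Q. 1 + \<zeta> q + (\<zeta> q)\<^sup>2 * cis (phase u v q))"
    by (simp add: numeral_3_eq_3 numeral_2_eq_2)
  finally show ?thesis by (simp add: \<zeta>_def)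
qed

text \<open>For 2^k \<le> |w| < 2^(k+1) the weight \<pi> / 2^(k+1) turns w into a half phase of
  modulus between \<pi>/4 and \<pi>/2. So all \<open>copies k\<close> positions of level k and of
  the kind selected by r have a cosine bounded away from 1.\<close>

lemma decay_block:
  assumes "\<bar>w\<bar> < 2 ^ K" "r < (2 :: nat)"
  shows "\<exists>B\<subseteq>positions K. (\<forall>q\<in>B. (first_kind q \<longleftrightarrow> r = 0) \<and> \<bar>cos (real_of_int w * weight q / 2)\<bar> \<le> 23 / 32) \<and>
    sqrt (7 / 8) ^ card B \<le> decay w"
proof (cases "w = 0")
  case True
  then show ?thesis by (intro exI[of _ "{}"]) (simp add: decay_def)
next
  case False
  then have "1 \<le> nat \<bar>w\<bar>" by simp
  then obtain k where k: "2 ^ k \<le> nat \<bar>w\<bar>" "nat \<bar>w\<bar> < 2 ^ (k + 1)"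
    using ex_power_ivl1[of 2 "nat \<bar>w\<bar>", OF order_refl] by blast
  have wr: "2 ^ k \<le> \<bar>real_of_int w\<bar>" "\<bar>real_of_int w\<bar> < 2 ^ (k + 1)"
  proof -
    have "real (2 ^ k) \<le> real (nat \<bar>w\<bar>)" "real (nat \<bar>w\<bar>) < real (2 ^ (k + 1))"
      using k by (simp_all only: of_nat_le_iff of_nat_less_iff)
    then show "2 ^ k \<le> \<bar>real_of_int w\<bar>" "\<bar>real_of_int w\<bar> < 2 ^ (k + 1)" by simp_all
  qed
  have "(2 :: int) ^ k < 2 ^ K"
  proof -
    have "int (2 ^ k) \<le> int (nat \<bar>w\<bar>)" using k(1) by (simp only: of_nat_le_iff)
    then have "(2 :: int) ^ k \<le> \<bar>w\<bar>" by simp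
    then show ?thesis using assms(1) by (rule order_le_less_trans)
  qed
  then have kK: "k < K" by simp
  define B where "B = (\<lambda>i. prod_encode (k, 2 * i + r)) ` {..<copies k}"
  have "inj_on (\<lambda>i. prod_encode (k, 2 * i + r)) {..<copies k}" by (auto simp: inj_on_def)
  then have cB: "card B = copies k" by (simp add: B_def card_image)
  have "B \<subseteq> positions K"
    using kK assms(2) by (auto simp: B_def positions_def intro!: imageI)
  moreover have "(first_kind q \<longleftrightarrow> r = 0) \<and> \<bar>cos (real_of_int w * weight q / 2)\<bar> \<le> 23 / 32" if q: "q \<in> B" for q
  proof
    obtain i where i: "i < copies k" "q = prod_encode (k, 2 * i + r)" using q by (auto simp: B_def)
    show "first_kind q \<longleftrightarrow> r = 0" using assms(2) by (auto simp: i first_kind_def less_2_cases_iff)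
    have wq: "weight q = pi / 2 ^ (k + 1)" using i assms(2) by (simp add: weight_def)
    define t where "t = \<bar>real_of_int w\<bar> * pi / 2 ^ (k + 2)"
    have t1: "pi / 4 \<le> t"
      using mult_right_mono[OF wr(1), of pi] by (simp add: t_def field_simps)
    have t2: "t \<le> pi / 2"
      using mult_right_mono[OF less_imp_le[OF wr(2)], of pi] by (simp add: t_def field_simps)
    have "real_of_int w * weight q / 2 = t \<or> real_of_int w * weight q / 2 = - t"
      by (auto simp: wq t_def abs_if)
    then have "\<bar>cos (real_of_int w * weight q / 2)\<bar> = \<bar>cos t\<bar>" by auto
    also have "\<dots> = cos t" using t1 t2 by (intro abs_of_nonneg cos_ge_zero) (use pi_ge_zero in linarith)+
    also have "\<dots> \<le> cos (pi / 4)" using t1 t2 by (intro cos_monotone_0_pi_le) (use pi_ge_zero in linarith)+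
    \<comment> \<open>1 / sqrt 2 is rounded up to 23/32, the value for which (5 + 4 t) / 9 is
      exactly 7/8.\<close>
    also have "\<dots> \<le> 23 / 32"
    proof -
      have "sqrt 2 \<le> 23 / 16" by (rule real_le_lsqrt) (simp_all add: power2_eq_square)
      then show ?thesis by (simp add: cos_45)
    qed
    finally show "\<bar>cos (real_of_int w * weight q / 2)\<bar> \<le> 23 / 32" .
  qed
  moreover have "sqrt (7 / 8) ^ card B \<le> decay w"
  proof -
    have "sqrt (7 / 8) ^ copies k = ((sqrt (7 / 8))\<^sup>2) ^ (16 * (k + 3))"
    proof -
      have "copies k = 2 * (16 * (k + 3))" by (simp add: copies_def)
      then show ?thesis by (simp only: power_mult)
    qed
    also have "\<dots> = ((7 / 8) ^ 16) ^ (k + 3)" by (simp only: power_mult) simp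
    also have "\<dots> \<le> (1 / 8) ^ (k + 3)" by (intro power_mono) (simp_all add: power_divide)
    also have "\<dots> = 1 / (64 * (2 ^ (k + 1)) ^ 3)"
    proof -
      have "(2 ^ (k + 1)) ^ 3 = ((2 :: real) ^ 3) ^ (k + 1)" by (simp only: power_mult[symmetric] mult.commute)
      then show ?thesis by (simp add: power_add power_divide)
    qed
    also have "\<dots> \<le> 1 / (64 * \<bar>real_of_int w\<bar> ^ 3)"
      using wr False by (intro divide_left_mono mult_left_mono power_mono mult_pos_pos) auto
    finally show ?thesis using False by (simp add: cB decay_def)
  qed
  ultimately show ?thesis by blast
qed

text \<open>The phase at a position involves only u or only v, according to its kind. Hence the
  blocks found for u and for v are disjoint and their gains multiply; all other factors are at most
  1.\<close>

lemma character_bound: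
  assumes u: "\<bar>u\<bar> < 2 ^ K" and v: "\<bar>v\<bar> < 2 ^ K"
  shows "cmod ((\<Sum>y\<in>digits (positions K). cis (2 * pi * angle (positions K) y) powi l * chi (positions K) u v y)
    / 3 ^ card (positions K)) \<le> decay u * decay v"
proof -
  let ?Q = "positions K"
  define \<zeta> where "\<zeta> q = cis (2 * pi * real_of_int l / 8 ^ (q + 1))" for q
  define f where "f q = cmod (1 + \<zeta> q + (\<zeta> q)\<^sup>2 * cis (phase u v q)) / 3" for q
  have f0: "0 \<le> f q" for q by (simp add: f_def)
  have f1: "f q \<le> 1" for q
  proof -
    have "cmod (1 + \<zeta> q + (\<zeta> q)\<^sup>2 * cis (phase u v q)) \<le> 1 + 1 + 1"
      by (intro norm_add_rule_thm) (simp_all add: \<zeta>_def norm_mult norm_power)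
    then show ?thesis by (simp add: f_def)
  qed
  have f2: "f q \<le> sqrt (7 / 8)" if "\<bar>cos (phase u v q / 2)\<bar> \<le> 23 / 32" for q
  proof (rule real_le_rsqrt)
    have "(f q)\<^sup>2 = (cmod (1 + \<zeta> q + (\<zeta> q)\<^sup>2 * cis (phase u v q)))\<^sup>2 / 9" by (simp add: f_def power_divide)
    also have "\<dots> \<le> (5 + 4 * \<bar>cos (phase u v q / 2)\<bar>) / 9"
      by (intro divide_right_mono factor_bound) (simp_all add: \<zeta>_def)
    also have "\<dots> \<le> 7 / 8" using that by simp
    finally show "(f q)\<^sup>2 \<le> 7 / 8" .
  qed
  obtain B where B: "B \<subseteq> ?Q" "\<And>q. q \<in> B \<Longrightarrow> first_kind q" "\<And>q. q \<in> B \<Longrightarrow> \<bar>cos (real_of_int u * weight q / 2)\<bar> \<le> 23 / 32"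
    "sqrt (7 / 8) ^ card B \<le> decay u"
    using decay_block[OF u, of 0] by auto
  obtain B' where B': "B' \<subseteq> ?Q" "\<And>q. q \<in> B' \<Longrightarrow> \<not> first_kind q" "\<And>q. q \<in> B' \<Longrightarrow> \<bar>cos (real_of_int v * weight q / 2)\<bar> \<le> 23 / 32"
    "sqrt (7 / 8) ^ card B' \<le> decay v"
    using decay_block[OF v, of 1] by auto
  have fin: "finite B" "finite B'" using B(1) B'(1) finite_positions finite_subset by blast+
  have fB: "f q \<le> sqrt (7 / 8)" if "q \<in> B \<union> B'" for q
    using that B B' by (intro f2) (auto simp: phase_def)
  have "cmod ((\<Sum>y\<in>digits ?Q. cis (2 * pi * angle ?Q y) powi l * chi ?Q u v y) / 3 ^ card ?Q) = (\<Prod>q\<in>?Q. f q)"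
    unfolding character_sum[OF finite_positions] f_def \<zeta>_def
    by (simp add: norm_divide norm_power prod_dividef flip: prod_norm)
  also have "\<dots> = (\<Prod>q\<in>?Q - (B \<union> B'). f q) * (\<Prod>q\<in>B \<union> B'. f q)"
    using B(1) B'(1) finite_positions by (intro prod.subset_diff) auto
  also have "\<dots> \<le> 1 * (\<Prod>q\<in>B \<union> B'. sqrt (7 / 8))"
    by (intro mult_mono prod_le_1 prod_mono prod_nonneg) (auto simp: f0 f1 fB)
  also have "\<dots> = sqrt (7 / 8) ^ card B * sqrt (7 / 8) ^ card B'"
    using fin B(2) B'(2) by (subst prod.union_disjoint) auto
  also have "\<dots> \<le> decay u * decay v"
    using B(4) B'(4) by (intro mult_mono decay_nonneg) auto
  finally show ?thesis .
qed

section \<open>Functions on the circle that read base 8 digits\<close>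

lemma base8_tail:
  assumes "finite T" "\<And>p. p \<in> T \<Longrightarrow> q < p" "\<And>p. p \<in> T \<Longrightarrow> y p \<le> (2 :: nat)"
  shows "(\<Sum>p\<in>T. real (y p) * 8 ^ q / 8 ^ (p + 1)) \<le> 1 / 28"
proof -
  define m where "m = Suc (Max (insert 0 T))"
  have T: "T \<subseteq> (\<lambda>j. q + 1 + j) ` {..<m}"
  proof
    fix p assume p: "p \<in> T"
    then have "p \<le> Max (insert 0 T)" using assms(1) by (intro Max_ge) auto
    then show "p \<in> (\<lambda>j. q + 1 + j) ` {..<m}"
      using assms(2)[OF p] by (intro image_eqI[of _ _ "p - q - 1"]) (auto simp: m_def)
  qed
  have "(\<Sum>p\<in>T. real (y p) * 8 ^ q / 8 ^ (p + 1)) \<le> (\<Sum>p\<in>T. 2 * 8 ^ q / 8 ^ (p + 1))"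
  proof (rule sum_mono)
    fix p assume "p \<in> T"
    then have "real (y p) \<le> 2" using assms(3) by fastforce
    then show "real (y p) * 8 ^ q / 8 ^ (p + 1) \<le> 2 * 8 ^ q / 8 ^ (p + 1)"
      by (intro divide_right_mono mult_right_mono) auto
  qed
  also have "\<dots> \<le> (\<Sum>p\<in>(\<lambda>j. q + 1 + j) ` {..<m}. 2 * 8 ^ q / 8 ^ (p + 1))"
    by (rule sum_mono2[OF _ T]) auto
  also have "\<dots> = (\<Sum>j<m. 2 * 8 ^ q / 8 ^ (q + 1 + j + 1))"
    by (subst sum.reindex) (auto simp: inj_on_def)
  \<comment> \<open>The geometric series 2/8^2 + 2/8^3 + ... has sum 1/28.\<close>
  also have "\<dots> = (\<Sum>j<m. 1 / 32 * (1 / 8) ^ j)"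
    by (intro sum.cong refl) (simp add: power_add power_divide)
  also have "\<dots> = 1 / 32 * ((1 - (1 / 8) ^ m) * (8 / 7))"
    unfolding sum_distrib_left[symmetric] using sum_gp_strict[of "1 / 8 :: real" m] by simp
  also have "\<dots> \<le> 1 / 28" by simp
  finally show ?thesis .
qed

text \<open>Raising to the power 8^q shifts the base 8 expansion: earlier digits become an integer
  and disappear, leaving digit q divided by 8 and a tail in [0, 1/28]. Digits 0 and 1 land in
  [0, 9/56], below 3/16; digit 2 lands in [1/4, 2/7], inside (7/32, 5/16). Positions outside Q act
  as digit 0.\<close>

lemma plateau_reads_digit:
  assumes Q: "finite Q" and y: "y \<in> digits Q"
    and \<psi>0: "\<And>x. 0 \<le> x \<Longrightarrow> x < 3 / 16 \<Longrightarrow> \<psi> (cis (2 * pi * x)) = (0 :: complex)"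
    and \<psi>1: "\<And>x. 7 / 32 < x \<Longrightarrow> x < 5 / 16 \<Longrightarrow> \<psi> (cis (2 * pi * x)) = 1"
  shows "\<psi> (cis (2 * pi * angle Q y) ^ 8 ^ q) = (if q \<in> Q \<and> y q = 2 then 1 else 0)"
proof -
  have y2: "y p \<le> 2" if "p \<in> Q" for p
  proof -
    have "y p \<in> {..<3}" using y that unfolding digits_def by (rule PiE_mem)
    then show ?thesis by simp
  qed
  define t where "t p = real (y p) * 8 ^ q / 8 ^ (p + 1)" for p
  define d where "d = (if q \<in> Q then y q else 0)"
  define x where "x = real d / 8 + (\<Sum>p\<in>{p\<in>Q. q < p}. t p)"
  define n where "n = (\<Sum>p\<in>{p\<in>Q. p < q}. y p * 8 ^ (q - p - 1))"
  have "8 ^ q * angle Q y = (\<Sum>p\<in>Q. t p)"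
    unfolding angle_def sum_distrib_left t_def by (simp add: mult_ac)
  also have "\<dots> = (\<Sum>p\<in>{p\<in>Q. p < q}. t p) + (\<Sum>p\<in>{p\<in>Q. p = q}. t p) + (\<Sum>p\<in>{p\<in>Q. q < p}. t p)"
  proof -
    have "Q = ({p\<in>Q. p < q} \<union> {p\<in>Q. p = q}) \<union> {p\<in>Q. q < p}" by auto
    then have "(\<Sum>p\<in>Q. t p) = (\<Sum>p\<in>({p\<in>Q. p < q} \<union> {p\<in>Q. p = q}) \<union> {p\<in>Q. q < p}. t p)" by simp
    also have "\<dots> = (\<Sum>p\<in>{p\<in>Q. p < q} \<union> {p\<in>Q. p = q}. t p) + (\<Sum>p\<in>{p\<in>Q. q < p}. t p)"
      using Q by (intro sum.union_disjoint) auto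
    also have "(\<Sum>p\<in>{p\<in>Q. p < q} \<union> {p\<in>Q. p = q}. t p) = (\<Sum>p\<in>{p\<in>Q. p < q}. t p) + (\<Sum>p\<in>{p\<in>Q. p = q}. t p)"
      using Q by (intro sum.union_disjoint) auto
    finally show ?thesis .
  qed
  also have "(\<Sum>p\<in>{p\<in>Q. p < q}. t p) = real n"
    unfolding n_def of_nat_sum
  proof (rule sum.cong)
    fix p assume "p \<in> {p\<in>Q. p < q}"
    then have "q = (q - p - 1) + (p + 1)" by simp
    then have "(8 :: real) ^ q = 8 ^ (q - p - 1) * 8 ^ (p + 1)" by (metis power_add)
    then show "t p = real (y p * 8 ^ (q - p - 1))" by (simp add: t_def)
  qed simp
  also have "(\<Sum>p\<in>{p\<in>Q. p = q}. t p) = real d / 8"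
  proof (cases "q \<in> Q")
    case True
    then have *: "{p\<in>Q. p = q} = {q}" by auto
    show ?thesis unfolding * using True by (simp add: d_def t_def)
  next
    case False
    then have *: "{p\<in>Q. p = q} = {}" by auto
    show ?thesis unfolding * using False by (simp add: d_def)
  qed
  finally have *: "8 ^ q * angle Q y = real n + x" by (simp add: x_def)
  have "2 * pi * angle Q y * 8 ^ q = 2 * pi * (8 ^ q * angle Q y)" by (simp only: mult_ac)
  then have "2 * pi * angle Q y * 8 ^ q = 2 * pi * x + 2 * pi * real n" unfolding * by (simp add: distrib_left)
  then have "cis (2 * pi * angle Q y) ^ 8 ^ q = cis (2 * pi * x + 2 * pi * real n)"
    unfolding Complex.DeMoivre by (simp add: mult.commute)
  also have "\<dots> = cis (2 * pi * x)" by (simp flip: cis_mult)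
  finally have eq: "cis (2 * pi * angle Q y) ^ 8 ^ q = cis (2 * pi * x)" .
  have tail: "0 \<le> (\<Sum>p\<in>{p\<in>Q. q < p}. t p)" "(\<Sum>p\<in>{p\<in>Q. q < p}. t p) \<le> 1 / 28"
  proof -
    show "0 \<le> (\<Sum>p\<in>{p\<in>Q. q < p}. t p)" unfolding t_def by (intro sum_nonneg) simp
    show "(\<Sum>p\<in>{p\<in>Q. q < p}. t p) \<le> 1 / 28" unfolding t_def by (rule base8_tail) (use Q y2 in auto)
  qed
  show ?thesis
  proof (cases "q \<in> Q \<and> y q = 2")
    case True
    then have "d = 2" by (simp add: d_def)
    then show ?thesis unfolding eq using True tail by (subst \<psi>1) (auto simp: x_def)
  next
    case False
    then have "d \<le> 1" using y2[of q] by (auto simp: d_def)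
    then have "real d \<le> 1" by simp
    then show ?thesis unfolding eq using False tail by (subst \<psi>0) (auto simp: x_def)
  qed
qed

lemma weight_nonneg: "0 \<le> weight q"
  by (auto simp: weight_def split: prod.split)

lemma summable_weight: "summable weight"
proof -
  have row: "((\<lambda>m. weight (prod_encode (k, m))) has_sum real (2 * copies k) * (pi / 2 ^ (k + 1))) UNIV" for k
    by (rule has_sum_finite_neutralI[where B = "{..<2 * copies k}"]) (auto simp: weight_def)
  have le: "real (k + 3) \<le> 4 * (3 / 2) ^ k" for k
  proof (induction k)
    case (Suc k)
    have "1 \<le> (3 / 2 :: real) ^ k" by (rule one_le_power) simp
    then show ?case using Suc by simp
  qed simp
  have "summable (\<lambda>k. real (2 * copies k) * (pi / 2 ^ (k + 1)))"
  proof (rule summable_comparison_test[OF exI[of _ 0]])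
    show "summable (\<lambda>k. 128 * pi * (3 / 4) ^ k)" by (intro summable_mult summable_geometric) simp
    show "\<forall>k\<ge>0. norm (real (2 * copies k) * (pi / 2 ^ (k + 1))) \<le> 128 * pi * (3 / 4) ^ k"
    proof (intro allI impI)
      fix k :: nat
      have "norm (real (2 * copies k) * (pi / 2 ^ (k + 1))) = 32 * pi * (real (k + 3) / 2 ^ k)"
        by (simp add: copies_def field_simps)
      also have "\<dots> \<le> 32 * pi * (4 * (3 / 2) ^ k / 2 ^ k)"
        by (intro mult_left_mono divide_right_mono le) auto
      also have "\<dots> = 128 * pi * (3 / 4) ^ k" by (simp add: power_divide flip: power_mult_distrib)
      finally show "norm (real (2 * copies k) * (pi / 2 ^ (k + 1))) \<le> 128 * pi * (3 / 4) ^ k" .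
    qed
  qed
  then have rows: "(\<lambda>k. real (2 * copies k) * (pi / 2 ^ (k + 1))) summable_on UNIV"
    by (rule summable_nonneg_imp_summable_on) simp
  have "(\<lambda>p. weight (prod_encode p)) summable_on (UNIV \<times> UNIV)"
    by (rule summable_on_SigmaI[OF row rows]) (rule weight_nonneg)
  then have "weight summable_on UNIV"
    using summable_on_reindex_bij_betw[OF bij_prod_encode, of weight] by simp
  then show ?thesis by (rule summable_on_imp_summable)
qed

text \<open>For \<open>True\<close> and \<open>False\<close> these are the two real functions f_1
  and f_2, evaluated at digit sequences on Q.\<close>

definition phase_sum :: "nat set \<Rightarrow> (nat \<Rightarrow> nat) \<Rightarrow> bool \<Rightarrow> real"
  where "phase_sum Q y b = (\<Sum>q\<in>Q. if y q = 2 \<and> first_kind q = b then weight q else 0)"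

lemma chi_eq_cis:
  assumes "finite Q"
  shows "chi Q u v y = cis (real_of_int u * phase_sum Q y True + real_of_int v * phase_sum Q y False)"
proof -
  have "chi Q u v y = cis (\<Sum>q\<in>Q. if y q = 2 then phase u v q else 0)"
    unfolding cis_sum[OF assms] chi_def by (intro prod.cong) auto
  also have "(\<Sum>q\<in>Q. if y q = 2 then phase u v q else 0)
      = real_of_int u * phase_sum Q y True + real_of_int v * phase_sum Q y False"
    unfolding phase_sum_def sum_distrib_left sum.distrib[symmetric]
    by (intro sum.cong) (auto simp: phase_def)
  finally show ?thesis .
qed

text \<open>G is chosen before Q: since positions outside Q read as digit 0, one function on the
  circle represents the phase sums for all finite Q. At scale 8^q the plateau function enters with
  the weight of q and unchanged norm, so summability of the weights suffices.\<close>

lemma wiener_phase: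
  obtains C G where "wiener C G"
    "\<And>Q y. finite Q \<Longrightarrow> y \<in> digits Q \<Longrightarrow> G (cis (2 * pi * angle Q y)) = of_real (phase_sum Q y b)"
proof -
  obtain C \<psi> where \<psi>: "wiener C \<psi>" "\<And>x. 0 \<le> x \<Longrightarrow> x < 3 / 16 \<Longrightarrow> \<psi> (cis (2 * pi * x)) = 0"
    "\<And>x. 7 / 32 < x \<Longrightarrow> x < 5 / 16 \<Longrightarrow> \<psi> (cis (2 * pi * x)) = 1"
    using plateau by metis
  define w where "w q = (if first_kind q = b then weight q else 0)" for q
  have w0: "0 \<le> w q" for q by (simp add: w_def weight_nonneg)
  have "summable w"
    by (rule summable_comparison_test[OF _ summable_weight]) (auto simp: w_def weight_nonneg)
  define G where "G z = (\<Sum>q. of_real (w q) * \<psi> (z ^ 8 ^ q))" for z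
  have "wiener (cmod (of_real (w q)) * C) (\<lambda>z. of_real (w q) * \<psi> (z ^ 8 ^ q))" for q
    by (intro wiener_scale wiener_power_arg \<psi>) simp
  then have "wiener (w q * C) (\<lambda>z. of_real (w q) * \<psi> (z ^ 8 ^ q))" for q
    unfolding norm_of_real abs_of_nonneg[OF w0] .
  then have G: "wiener (\<Sum>q. w q * C) G"
    unfolding G_def using \<open>summable w\<close> by (intro wiener_suminf summable_mult2)
  moreover have "G (cis (2 * pi * angle Q y)) = of_real (phase_sum Q y b)" if Q: "finite Q" and y: "y \<in> digits Q" for Q y
  proof -
    have r: "of_real (w q) * \<psi> (cis (2 * pi * angle Q y) ^ 8 ^ q) = (if q \<in> Q \<and> y q = 2 then of_real (w q) else 0)" for q
      using plateau_reads_digit[of Q y \<psi>, OF Q y \<psi>(2,3)] by simp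
    have "G (cis (2 * pi * angle Q y)) = (\<Sum>q\<in>Q. if q \<in> Q \<and> y q = 2 then of_real (w q) else 0)"
      unfolding G_def r by (rule suminf_finite[OF Q]) auto
    also have "\<dots> = of_real (phase_sum Q y b)"
      unfolding phase_sum_def of_real_sum by (rule sum.cong) (auto simp: w_def)
    finally show ?thesis .
  qed
  ultimately show ?thesis by (rule that)
qed

text \<open>The finitely supported weights \<open>w K\<close> replace a limit functional. At the
  points \<open>lam K y\<close> the function h equals sin f_1 + i sin f_2, written with exponentials
  to stay in the Wiener algebra. The bounds for all l control the functionals on all absolutely
  convergent Fourier series and on all multiples of h.\<close>

lemma nonsynthesis:
  "\<exists>C h w lam. \<exists>Y :: nat \<Rightarrow> (nat \<Rightarrow> nat) set. wiener C h \<and> (\<forall>K. finite (Y K)) \<and> (\<forall>K y. cmod (lam K y) = 1) \<and>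
    (\<forall>K l. cmod (\<Sum>y\<in>Y K. w K y * lam K y powi l) \<le> 1) \<and>
    (\<forall>K l. cmod (\<Sum>y\<in>Y K. w K y * (h (lam K y) * lam K y powi l)) \<le> 1 / real (Suc K)) \<and>
    (\<forall>K. 1 \<le> cmod (\<Sum>y\<in>Y K. w K y * cnj (h (lam K y))))"
proof -
  obtain C1 G1 where G1: "wiener C1 G1"
    "\<And>Q y. finite Q \<Longrightarrow> y \<in> digits Q \<Longrightarrow> G1 (cis (2 * pi * angle Q y)) = of_real (phase_sum Q y True)"
    using wiener_phase by blast
  obtain C2 G2 where G2: "wiener C2 G2"
    "\<And>Q y. finite Q \<Longrightarrow> y \<in> digits Q \<Longrightarrow> G2 (cis (2 * pi * angle Q y)) = of_real (phase_sum Q y False)"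
    using wiener_phase by blast
  define h where "h z = - \<i> / 2 * (exp (\<i> * G1 z) + - 1 * exp (- \<i> * G1 z)) + 1 / 2 * (exp (\<i> * G2 z) + - 1 * exp (- \<i> * G2 z))" for z
  have "\<exists>C. wiener C h"
    unfolding h_def
    using wiener_add[OF wiener_scale[OF wiener_add[OF wiener_exp[OF wiener_scale[OF G1(1)]] wiener_scale[OF wiener_exp[OF wiener_scale[OF G1(1)]]]]]
      wiener_scale[OF wiener_add[OF wiener_exp[OF wiener_scale[OF G2(1)]] wiener_scale[OF wiener_exp[OF wiener_scale[OF G2(1)]]]]]]
    by blast
  then obtain C where C: "wiener C h" by blast
  define Q where "Q K = positions (K + 2)" for K
  have Q: "finite (Q K)" for K by (simp add: Q_def finite_positions)
  define lam where "lam K y = cis (2 * pi * angle (Q K) y)" for K y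
  \<comment> \<open>\<open>character_bound\<close> at level K + 2 requires frequencies of modulus
    below 2^(K+2), and \<open>U K\<close> is the largest such integer. The shift by 2 ensures U
    \<ge> 2 and U - 1 \<ge> K + 1.\<close>
  define U :: "nat \<Rightarrow> nat" where "U K = 2 ^ (K + 2) - 1" for K
  define I where "I K = {- int (U K)<..<int (U K)}" for K
  define w where "w K y = (\<Sum>u\<in>I K. \<Sum>v\<in>I K. (of_int u + \<i> * of_int v) * chi (Q K) u v y) / 3 ^ card (Q K)" for K y
  define c where "c K l u v = (\<Sum>y\<in>digits (Q K). lam K y powi l * chi (Q K) u v y) / 3 ^ card (Q K)" for K l u v
  have U: "2 \<le> U K" "K + 1 \<le> U K - 1" for K
  proof -
    have "K + 2 < 2 ^ (K + 2)" by (rule less_exp)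
    moreover have "(2::nat) ^ 2 \<le> 2 ^ (K + 2)" by (rule power_increasing) auto
    ultimately show "2 \<le> U K" "K + 1 \<le> U K - 1" by (auto simp: U_def)
  qed
  have cb: "cmod (c K l u v) \<le> decay u * decay v" if "\<bar>u\<bar> \<le> int (U K)" "\<bar>v\<bar> \<le> int (U K)" for K l u v
  proof -
    have "int (U K) < 2 ^ (K + 2)" by (simp add: U_def of_nat_diff)
    then show ?thesis
      unfolding c_def lam_def Q_def using that by (intro character_bound) linarith+
  qed
  have chi_mult: "chi (Q K) u v y * chi (Q K) u' v' y = chi (Q K) (u + u') (v + v') y" for K u v u' v' y
    by (simp add: chi_eq_cis[OF Q] cis_mult algebra_simps)
  have hl: "h (lam K y) = - \<i> / 2 * (chi (Q K) 1 0 y - chi (Q K) (- 1) 0 y) + (chi (Q K) 0 1 y - chi (Q K) 0 (- 1) y) / 2"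
    if "y \<in> digits (Q K)" for K y
    using G1(2)[OF Q that] G2(2)[OF Q that]
    by (simp add: h_def lam_def chi_eq_cis[OF Q] cis_conv_exp field_simps)
  have cnj_chi: "cnj (chi (Q K) u v y) = chi (Q K) (- u) (- v) y" for K u v y
    by (simp add: chi_eq_cis[OF Q] cis_cnj algebra_simps)
  have hc: "cnj (h (lam K y)) = - \<i> / 2 * (chi (Q K) 1 0 y - chi (Q K) (- 1) 0 y) - (chi (Q K) 0 1 y - chi (Q K) 0 (- 1) y) / 2"
    if "y \<in> digits (Q K)" for K y
    unfolding hl[OF that] by (simp add: cnj_chi field_simps)
  have swap: "(\<Sum>y\<in>digits (Q K). w K y * g y)
      = (\<Sum>u\<in>I K. \<Sum>v\<in>I K. (of_int u + \<i> * of_int v) * ((\<Sum>y\<in>digits (Q K). chi (Q K) u v y * g y) / 3 ^ card (Q K)))" for K g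
  proof -
    have "(\<Sum>y\<in>digits (Q K). w K y * g y)
        = (\<Sum>y\<in>digits (Q K). \<Sum>u\<in>I K. \<Sum>v\<in>I K. (of_int u + \<i> * of_int v) * (chi (Q K) u v y * g y / 3 ^ card (Q K)))"
      unfolding w_def sum_divide_distrib sum_distrib_right by (simp add: mult.assoc)
    also have "\<dots> = (\<Sum>u\<in>I K. \<Sum>v\<in>I K. \<Sum>y\<in>digits (Q K). (of_int u + \<i> * of_int v) * (chi (Q K) u v y * g y / 3 ^ card (Q K)))"
      by (subst sum.swap) (intro sum.cong refl sum.swap)
    finally show ?thesis by (simp only: sum_divide_distrib sum_distrib_left)
  qed
  have shift: "(\<Sum>y\<in>digits (Q K). chi (Q K) u v y * (chi (Q K) u' v' y * lam K y powi l)) / 3 ^ card (Q K) = c K l (u + u') (v + v')"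
    for K u v u' v' l
  proof -
    have *: "chi (Q K) u v y * (chi (Q K) u' v' y * lam K y powi l) = lam K y powi l * chi (Q K) (u + u') (v + v') y" for y
      by (metis chi_mult mult.assoc mult.commute)
    show ?thesis unfolding c_def * ..
  qed
  have lin: "(\<Sum>y\<in>D. k * (a y - b y) + (e y - f y) / 2) / n = k * ((\<Sum>y\<in>D. a y) / n - (\<Sum>y\<in>D. b y) / n) + ((\<Sum>y\<in>D. e y) / n - (\<Sum>y\<in>D. f y) / n) / 2"
    "(\<Sum>y\<in>D. k * (a y - b y) - (e y - f y) / 2) / n = k * ((\<Sum>y\<in>D. a y) / n - (\<Sum>y\<in>D. b y) / n) - ((\<Sum>y\<in>D. e y) / n - (\<Sum>y\<in>D. f y) / n) / 2"
    for D :: "(nat \<Rightarrow> nat) set" and a b e f and k n :: complex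
    unfolding sum.distrib sum_subtractf sum_divide_distrib[symmetric] sum_distrib_left[symmetric]
    by (simp_all add: add_divide_distrib diff_divide_distrib right_diff_distrib mult.commute)
  show ?thesis
  proof (rule exI[of _ C], rule exI[of _ h], rule exI[of _ w], rule exI[of _ lam],
      rule exI[of _ "\<lambda>K. digits (Q K)"], intro conjI allI)
    show "wiener C h" by (rule C)
    show "finite (digits (Q K))" for K by (rule finite_digits[OF Q])
    show "cmod (lam K y) = 1" for K y by (simp add: lam_def)
    show "cmod (\<Sum>y\<in>digits (Q K). w K y * lam K y powi l) \<le> 1" for K l
    proof -
      have "(\<Sum>y\<in>digits (Q K). w K y * lam K y powi l) = (\<Sum>u\<in>I K. \<Sum>v\<in>I K. (of_int u + \<i> * of_int v) * c K l u v)"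
        unfolding swap c_def by (simp add: mult.commute)
      then show ?thesis using box_sums(1)[of "U K" "c K l", OF U(1) cb] by (simp add: I_def)
    qed
    show "cmod (\<Sum>y\<in>digits (Q K). w K y * (h (lam K y) * lam K y powi l)) \<le> 1 / real (Suc K)" for K l
    proof -
      have "(\<Sum>y\<in>digits (Q K). chi (Q K) u v y * (h (lam K y) * lam K y powi l)) / 3 ^ card (Q K)
          = - \<i> / 2 * (c K l (u + 1) v - c K l (u - 1) v) + (c K l u (v + 1) - c K l u (v - 1)) / 2" for u v
      proof -
        have "(\<Sum>y\<in>digits (Q K). chi (Q K) u v y * (h (lam K y) * lam K y powi l))
          = (\<Sum>y\<in>digits (Q K). - \<i> / 2 * (chi (Q K) u v y * (chi (Q K) 1 0 y * lam K y powi l) - chi (Q K) u v y * (chi (Q K) (- 1) 0 y * lam K y powi l))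
            + (chi (Q K) u v y * (chi (Q K) 0 1 y * lam K y powi l) - chi (Q K) u v y * (chi (Q K) 0 (- 1) y * lam K y powi l)) / 2)"
          by (intro sum.cong refl) (simp add: hl algebra_simps)
        then show ?thesis by (simp only: lin(1) shift) simp
      qed
      then have "(\<Sum>y\<in>digits (Q K). w K y * (h (lam K y) * lam K y powi l))
          = (\<Sum>u\<in>I K. \<Sum>v\<in>I K. (of_int u + \<i> * of_int v) *
            (- \<i> / 2 * (c K l (u + 1) v - c K l (u - 1) v) + (c K l u (v + 1) - c K l u (v - 1)) / 2))"
        unfolding swap by simp
      then have "cmod (\<Sum>y\<in>digits (Q K). w K y * (h (lam K y) * lam K y powi l)) \<le> 1 / (real (U K) - 1)"
        using box_sums(2)[of "U K" "c K l", OF U(1) cb] by (simp only: I_def)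
      also have "\<dots> \<le> 1 / real (Suc K)"
      proof -
        have "real (Suc K) \<le> real (U K - 1)" using U(2)[of K] by (simp only: of_nat_le_iff)
        also have "\<dots> = real (U K) - 1" using U(1)[of K] by (simp add: of_nat_diff)
        finally show ?thesis by (intro divide_left_mono) auto
      qed
      finally show ?thesis .
    qed
    show "1 \<le> cmod (\<Sum>y\<in>digits (Q K). w K y * cnj (h (lam K y)))" for K
    proof -
      have "(\<Sum>y\<in>digits (Q K). chi (Q K) u v y * cnj (h (lam K y))) / 3 ^ card (Q K)
          = - \<i> / 2 * (c K 0 (u + 1) v - c K 0 (u - 1) v) - (c K 0 u (v + 1) - c K 0 u (v - 1)) / 2" for u v
      proof -
        have "(\<Sum>y\<in>digits (Q K). chi (Q K) u v y * cnj (h (lam K y)))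
          = (\<Sum>y\<in>digits (Q K). - \<i> / 2 * (chi (Q K) u v y * (chi (Q K) 1 0 y * lam K y powi 0) - chi (Q K) u v y * (chi (Q K) (- 1) 0 y * lam K y powi 0))
            - (chi (Q K) u v y * (chi (Q K) 0 1 y * lam K y powi 0) - chi (Q K) u v y * (chi (Q K) 0 (- 1) y * lam K y powi 0)) / 2)"
          by (intro sum.cong refl) (simp add: hc algebra_simps)
        then show ?thesis by (simp only: lin(2) shift) simp
      qed
      then have "(\<Sum>y\<in>digits (Q K). w K y * cnj (h (lam K y)))
          = (\<Sum>u\<in>I K. \<Sum>v\<in>I K. (of_int u + \<i> * of_int v) *
            (- \<i> / 2 * (c K 0 (u + 1) v - c K 0 (u - 1) v) - (c K 0 u (v + 1) - c K 0 u (v - 1)) / 2))"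
        unfolding swap by simp
      moreover have "c K 0 0 0 = 1"
        by (simp add: c_def chi_eq_cis[OF Q] digits_def card_PiE Q)
      ultimately show ?thesis
        using box_sums(3)[of "U K" "c K 0", OF U(1) cb] by (simp only: I_def)
    qed
  qed
qed

subsection \<open>A closed ideal that is not self-adjoint\<close>

lemma norm_has_sum_le:
  fixes f :: "'a \<Rightarrow> 'b::banach"
  assumes "(f has_sum S) A" "(g has_sum G) A" "\<And>x. x \<in> A \<Longrightarrow> norm (f x) \<le> g x"
  shows "norm S \<le> G"
proof -
  have s: "(\<lambda>x. norm (f x)) summable_on A"
    using assms(2) by (intro Infinite_Sum.abs_summable_on_comparison_test'[of g]) (auto simp: summable_on_def assms(3))
  show ?thesis
    using norm_infsum_bound[OF s] has_sum_mono[OF has_sum_infsum[OF s] assms(2,3)] infsumI[OF assms(1)] by simp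
qed

lemma (in homeo_system) ell1_one_mult [simp]: "ell1_mult \<sigma> ell1_one a = a"
  by (intro ell1_eqI bcontfun_eqI) (simp add: ell1_one_def ell1_of_C_def coeff_mult_single_left)

context periodic_point
begin

text \<open>On these bounded sequences \<delta>^p acts as multiplication by z. Coordinate 0 of the
  image under a is the sum of the coefficients of a at p l, evaluated at x, times z^l: a Fourier
  series in z.\<close>

definition quasi :: "complex \<Rightarrow> int \<Rightarrow> complex"
  where "quasi z m = (if p dvd m then z powi (- (m div p)) else 0)"

lemma cmod_quasi_le: "cmod z = 1 \<Longrightarrow> cmod (quasi z m) \<le> 1"
  by (simp add: quasi_def norm_power_int)

lemma quasi_shift:
  assumes "cmod z = 1"
  shows "quasi z (m + p) = inverse z * quasi z m"
proof -
  have "z \<noteq> 0" using assms by auto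
  moreover have "(m + p) div p = m div p + 1" using p_pos by simp
  ultimately have *: "z powi (- ((m + p) div p)) = inverse z * z powi (- (m div p))"
    using power_int_add[of z "- (m div p)" "- 1"] by (simp add: power_int_minus mult.commute)
  show ?thesis unfolding quasi_def * by simp
qed

lemma quasi_periodic_shift:
  fixes \<eta> :: "int \<Rightarrow> complex"
  assumes "z \<noteq> 0" "\<And>m. \<eta> (m + p) = inverse z * \<eta> m"
  shows "\<eta> (m - p * l) = z powi l * \<eta> m"
proof (induction l rule: int_induct[of _ 0])
  case (step1 i)
  have "\<eta> (m - p * i) = inverse z * \<eta> (m - p * (i + 1))"
    using assms(2)[of "m - p * (i + 1)"] by (simp add: algebra_simps)
  then show ?case using step1 assms(1) by (simp add: power_int_add field_simps)
next
  case (step2 i)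
  have "\<eta> (m - p * (i - 1)) = inverse z * \<eta> (m - p * i)"
    using assms(2)[of "m - p * i"] by (simp add: algebra_simps)
  then show ?case using step2 assms(1) power_int_add[of z "i - 1" 1] by (simp add: field_simps)
qed simp

text \<open>Constant coefficients at multiples of p involve only the shift by p, of which \<eta> is
  an eigenvector. Such an e need not be central in the algebra, but here it acts as a scalar, which
  is enough to treat a two-sided ideal.\<close>

lemma orbit_rep_scalar:
  assumes z: "cmod z = 1" and \<eta>: "\<And>m. \<eta> (m + p) = inverse z * \<eta> m" "\<And>m. cmod (\<eta> m) \<le> D"
    and e: "\<And>n x'. ell1_coeff e n x' = (if p dvd n then d (n div p) else 0)"
    and s: "((\<lambda>l. d l * z powi l) has_sum s) UNIV"
  shows "orbit_rep \<sigma> x e \<eta> = (\<lambda>m. s * \<eta> m)"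
proof
  fix m
  have z0: "z \<noteq> 0" using z by auto
  have "((\<lambda>n. ell1_coeff e n (int_iter \<sigma> m x) * \<eta> (m - n)) has_sum s * \<eta> m) UNIV"
  proof (rule has_sum_multiples[OF p_pos])
    show "((\<lambda>l. ell1_coeff e (p * l) (int_iter \<sigma> m x) * \<eta> (m - p * l)) has_sum s * \<eta> m) UNIV"
      using has_sum_cmult_left[OF s, of "\<eta> m"] p_pos
      by (simp add: e quasi_periodic_shift[OF z0, of \<eta>, OF \<eta>(1)] mult.assoc)
  qed (simp add: e)
  then show "orbit_rep \<sigma> x e \<eta> m = s * \<eta> m"
    by (rule has_sum_unique[OF orbit_rep_has_sum[of \<eta>, OF \<eta>(2)]])
qed

text \<open>The duality of \<ell>^1 with bounded sequences: summing over y before n leaves the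
  transform of the weights at n / p if p divides n, and 0 otherwise.\<close>

lemma functional_bound:
  assumes "finite Y" "\<And>y. cmod (lam y) = 1" "\<And>l. cmod (\<Sum>y\<in>Y. w y * lam y powi l) \<le> B"
  shows "cmod (\<Sum>y\<in>Y. w y * orbit_rep \<sigma> x a (quasi (lam y)) 0) \<le> B * norm a"
proof (rule norm_has_sum_le)
  have B: "0 \<le> B" using assms(3)[of 0] norm_ge_zero order_trans by blast
  have "((\<lambda>n. ell1_coeff a n x * quasi (lam y) (- n)) has_sum orbit_rep \<sigma> x a (quasi (lam y)) 0) UNIV" for y
    using orbit_rep_has_sum[of "quasi (lam y)" 1 a 0 x, OF cmod_quasi_le[OF assms(2)]] by simp
  then show "((\<lambda>n. \<Sum>y\<in>Y. w y * (ell1_coeff a n x * quasi (lam y) (- n))) has_sum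
      (\<Sum>y\<in>Y. w y * orbit_rep \<sigma> x a (quasi (lam y)) 0)) UNIV"
    by (intro has_sum_finite_sum has_sum_cmult_right)
  show "((\<lambda>n. B * norm (ell1_coeff a n)) has_sum B * norm a) UNIV"
    by (rule has_sum_cmult_right[OF norm_ell1_has_sum])
  fix n
  have "cmod (\<Sum>y\<in>Y. w y * quasi (lam y) (- n)) \<le> B"
  proof (cases "p dvd n")
    case True
    then have "- (- n div p) = n div p" by (simp add: dvd_neg_div)
    then show ?thesis using assms(3)[of "n div p"] True by (simp add: quasi_def)
  qed (simp add: quasi_def B)
  then have "cmod (ell1_coeff a n x) * cmod (\<Sum>y\<in>Y. w y * quasi (lam y) (- n)) \<le> norm (ell1_coeff a n) * B"
    by (intro mult_mono cmod_ell1_coeff_le) auto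
  moreover have "(\<Sum>y\<in>Y. w y * (ell1_coeff a n x * quasi (lam y) (- n))) = ell1_coeff a n x * (\<Sum>y\<in>Y. w y * quasi (lam y) (- n))"
    by (simp add: sum_distrib_left mult.left_commute)
  ultimately show "cmod (\<Sum>y\<in>Y. w y * (ell1_coeff a n x * quasi (lam y) (- n))) \<le> B * norm (ell1_coeff a n)"
    by (simp add: norm_mult mult.commute)
qed

text \<open>The functionals \<open>\<Phi> K\<close> are uniformly bounded, asymptotically annihilate the two-sided ideal generated
  by the element \<open>e\<close> with transform \<open>h\<close>, but stay away from \<open>0\<close> on \<open>e\<^sup>*\<close>.\<close>

lemma closed_ideal_not_self_adjoint: "\<exists>I. closed_ideal \<sigma> I \<and> \<not> self_adjoint_ideal \<sigma> I"
proof -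
  obtain C h w lam and Y :: "nat \<Rightarrow> (nat \<Rightarrow> nat) set" where
    "wiener C h \<and> (\<forall>K. finite (Y K)) \<and> (\<forall>K y. cmod (lam K y) = 1) \<and>
    (\<forall>K l. cmod (\<Sum>y\<in>Y K. w K y * lam K y powi l) \<le> 1) \<and>
    (\<forall>K l. cmod (\<Sum>y\<in>Y K. w K y * (h (lam K y) * lam K y powi l)) \<le> 1 / real (Suc K)) \<and>
    (\<forall>K. 1 \<le> cmod (\<Sum>y\<in>Y K. w K y * cnj (h (lam K y))))"
    using nonsynthesis by (elim exE)
  then have h: "wiener C h" and Y: "finite (Y K)" and lam: "cmod (lam K y) = 1"
    and w1: "cmod (\<Sum>y\<in>Y K. w K y * lam K y powi l) \<le> 1"
    and w2: "cmod (\<Sum>y\<in>Y K. w K y * (h (lam K y) * lam K y powi l)) \<le> 1 / real (Suc K)"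
    and w3: "1 \<le> cmod (\<Sum>y\<in>Y K. w K y * cnj (h (lam K y)))" for K l y
    by simp_all
  define \<Phi> where "\<Phi> K a = (\<Sum>y\<in>Y K. w K y * orbit_rep \<sigma> x a (quasi (lam K y)) 0)" for K a
  have \<Phi>: "cmod (\<Phi> K a) \<le> norm a" for K a
    unfolding \<Phi>_def using functional_bound[of "Y K" "lam K" "w K" 1 a, OF Y lam w1] by simp
  note q = cmod_quasi_le[OF lam]
  have \<Phi>_add: "\<Phi> K (a + b) = \<Phi> K a + \<Phi> K b" and \<Phi>_diff: "\<Phi> K (a - b) = \<Phi> K a - \<Phi> K b"
    and \<Phi>_scale: "\<Phi> K (ell1_scaleC r a) = r * \<Phi> K a" for K a b r
    unfolding \<Phi>_def
    by (simp_all add: orbit_rep_linear(1-3)[of "quasi (lam K _)", OF q q] distrib_left sum.distrib right_diff_distrib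
        sum_subtractf sum_distrib_left mult.left_commute)
  \<comment> \<open>The largest two-sided ideal on whose elements the \<Phi> K tend to 0; the
    uniform bound on the \<Phi> K makes it closed.\<close>
  define I where "I = {a. \<forall>b c. (\<lambda>K. \<Phi> K (ell1_mult \<sigma> b (ell1_mult \<sigma> a c))) \<longlonglongrightarrow> 0}"
  interpret m: bounded_bilinear "ell1_mult \<sigma>" by (rule bounded_bilinear_ell1_mult)
  have "closed_ideal \<sigma> I"
    unfolding closed_ideal_def ell1_ideal_def
  proof (intro conjI ballI allI)
    have "\<Phi> K 0 = 0" for K using \<Phi>[of K 0] by simp
    then show "0 \<in> I" by (simp add: I_def m.zero_left m.zero_right)
    show "a + b \<in> I" if "a \<in> I" "b \<in> I" for a b
      using that tendsto_add[of _ 0 _ _ 0] by (fastforce simp: I_def m.add_left m.add_right \<Phi>_add)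
    show "ell1_scaleC r a \<in> I" if "a \<in> I" for r a
      using that tendsto_mult_right_zero by (fastforce simp: I_def ell1_mult_scaleC \<Phi>_scale)
    show "ell1_mult \<sigma> d a \<in> I" if "a \<in> I" for d a
      unfolding I_def
    proof (intro CollectI allI)
      fix b c
      have "ell1_mult \<sigma> b (ell1_mult \<sigma> (ell1_mult \<sigma> d a) c) = ell1_mult \<sigma> (ell1_mult \<sigma> b d) (ell1_mult \<sigma> a c)"
        by (simp add: ell1_mult_assoc)
      then show "(\<lambda>K. \<Phi> K (ell1_mult \<sigma> b (ell1_mult \<sigma> (ell1_mult \<sigma> d a) c))) \<longlonglongrightarrow> 0"
        using that by (simp add: I_def)
    qed
    show "ell1_mult \<sigma> a d \<in> I" if "a \<in> I" for d a
      using that by (simp add: I_def ell1_mult_assoc)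
    show "closed I"
      unfolding closed_sequential_limits
    proof (intro allI impI)
      fix s a assume s: "(\<forall>n. s n \<in> I) \<and> s \<longlonglongrightarrow> a"
      show "a \<in> I"
        unfolding I_def
      proof (intro CollectI allI)
        fix b c
        let ?g = "\<lambda>d. ell1_mult \<sigma> b (ell1_mult \<sigma> d c)"
        have "(\<lambda>n. ?g (s n)) \<longlonglongrightarrow> ?g a"
          using s by (intro m.tendsto tendsto_const) simp
        show "(\<lambda>K. \<Phi> K (?g a)) \<longlonglongrightarrow> 0"
        proof (rule LIMSEQ_I)
          fix e :: real assume "0 < e"
          then obtain n where n: "norm (?g (s n) - ?g a) < e / 2"
            using LIMSEQ_D[OF \<open>(\<lambda>n. ?g (s n)) \<longlonglongrightarrow> ?g a\<close>, of "e / 2"] by auto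
          have "(\<lambda>K. \<Phi> K (?g (s n))) \<longlonglongrightarrow> 0" using s by (simp add: I_def)
          then obtain M where M: "\<And>K. K \<ge> M \<Longrightarrow> cmod (\<Phi> K (?g (s n))) < e / 2"
            using LIMSEQ_D[of _ 0 "e / 2"] \<open>0 < e\<close> by fastforce
          have "norm (\<Phi> K (?g a) - 0) < e" if "K \<ge> M" for K
          proof -
            have "\<Phi> K (?g a) = \<Phi> K (?g (s n)) - \<Phi> K (?g (s n) - ?g a)" by (simp add: \<Phi>_diff)
            then have "cmod (\<Phi> K (?g a)) \<le> cmod (\<Phi> K (?g (s n))) + cmod (\<Phi> K (?g (s n) - ?g a))"
              by (metis norm_triangle_ineq4)
            then show ?thesis using M[OF that] \<Phi>[of K "?g (s n) - ?g a"] n by simp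
          qed
          then show "\<exists>M. \<forall>K\<ge>M. norm (\<Phi> K (?g a) - 0) < e" by blast
        qed
      qed
    qed
  qed
  obtain c t where c: "((\<lambda>l. cmod (c l)) has_sum t) UNIV"
    "\<And>z. cmod z = 1 \<Longrightarrow> ((\<lambda>l. c l * z powi l) has_sum h z) UNIV"
    using wienerE[OF h] by metis
  define e :: "'x ell1" where "e = Abs_ell1 (\<lambda>n. if p dvd n then const_bcontfun (c (n div p)) else 0)"
  have "((\<lambda>n. if p dvd n then cmod (c (n div p)) else 0) has_sum t) UNIV"
    by (rule has_sum_multiples[OF p_pos]) (use c(1) p_pos in auto)
  then have "(\<lambda>n. norm (if p dvd n then const_bcontfun (c (n div p)) else 0 :: 'x \<Rightarrow>\<^sub>C complex)) summable_on UNIV"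
    by (intro Infinite_Sum.abs_summable_on_comparison_test'[of "\<lambda>n. if p dvd n then cmod (c (n div p)) else 0"])
      (auto simp: summable_on_def intro!: norm_bound)
  then have e: "ell1_coeff e n x' = (if p dvd n then c (n div p) else 0)" for n x'
    by (simp add: e_def Abs_ell1_inverse)
  have "e \<in> I"
    unfolding I_def
  proof (intro CollectI allI)
    fix b d
    \<comment> \<open>The scalar action of e pulls h out from between b and d. What remains is the
      functional with weights w h applied to the product of b and d, which \<open>w2\<close> makes
      small.\<close>
    have "\<Phi> K (ell1_mult \<sigma> b (ell1_mult \<sigma> e d)) = (\<Sum>y\<in>Y K. (w K y * h (lam K y)) * orbit_rep \<sigma> x (ell1_mult \<sigma> b d) (quasi (lam K y)) 0)" for K
      unfolding \<Phi>_def
    proof (rule sum.cong[OF refl])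
      fix y
      let ?\<xi> = "quasi (lam K y)"
      let ?\<eta> = "orbit_rep \<sigma> x d ?\<xi>"
      note b1 = cmod_quasi_le[OF lam, of K y] and b2 = cmod_orbit_rep_le[of ?\<xi>, OF cmod_quasi_le[OF lam, of K y]]
      have \<eta>: "?\<eta> (m + p) = inverse (lam K y) * ?\<eta> m" for m
        by (rule orbit_rep_quasi_periodic[OF period]) (rule quasi_shift[OF lam])
      have "orbit_rep \<sigma> x (ell1_mult \<sigma> b (ell1_mult \<sigma> e d)) ?\<xi> = orbit_rep \<sigma> x b (orbit_rep \<sigma> x e ?\<eta>)"
        by (simp only: orbit_rep_mult[of ?\<xi>, OF b1])
      also have "orbit_rep \<sigma> x e ?\<eta> = (\<lambda>m. h (lam K y) * ?\<eta> m)"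
        by (rule orbit_rep_scalar[of "lam K y" ?\<eta> "norm d * 1" e c "h (lam K y)", OF lam \<eta> b2 e c(2)[OF lam]])
      also have "orbit_rep \<sigma> x b (\<lambda>m. h (lam K y) * ?\<eta> m) = (\<lambda>m. h (lam K y) * orbit_rep \<sigma> x b ?\<eta> m)"
        by (rule orbit_rep_linear(5)[of ?\<eta>, OF b2 b2])
      also have "orbit_rep \<sigma> x b ?\<eta> = orbit_rep \<sigma> x (ell1_mult \<sigma> b d) ?\<xi>"
        by (simp only: orbit_rep_mult[of ?\<xi>, OF b1])
      finally show "w K y * orbit_rep \<sigma> x (ell1_mult \<sigma> b (ell1_mult \<sigma> e d)) ?\<xi> 0
          = (w K y * h (lam K y)) * orbit_rep \<sigma> x (ell1_mult \<sigma> b d) ?\<xi> 0" by (simp add: mult.assoc)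
    qed
    moreover have "cmod (\<Sum>y\<in>Y K. (w K y * h (lam K y)) * orbit_rep \<sigma> x (ell1_mult \<sigma> b d) (quasi (lam K y)) 0)
        \<le> 1 / real (Suc K) * norm (ell1_mult \<sigma> b d)" for K
      by (rule functional_bound[OF Y lam]) (use w2[of K] in \<open>simp add: mult.assoc\<close>)
    ultimately have le: "cmod (\<Phi> K (ell1_mult \<sigma> b (ell1_mult \<sigma> e d))) \<le> 1 / real (Suc K) * norm (ell1_mult \<sigma> b d)" for K
      by simp
    have "(\<lambda>K. 1 / real (Suc K) * norm (ell1_mult \<sigma> b d)) \<longlonglongrightarrow> 0"
      using LIMSEQ_inverse_real_of_nat by (intro tendsto_mult_left_zero) (simp add: inverse_eq_divide)
    then show "(\<lambda>K. \<Phi> K (ell1_mult \<sigma> b (ell1_mult \<sigma> e d))) \<longlonglongrightarrow> 0"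
      by (rule Lim_null_comparison[rotated]) (use le in simp)
  qed
  moreover have "ell1_star \<sigma> e \<notin> I"
  proof
    assume "ell1_star \<sigma> e \<in> I"
    then have "(\<lambda>K. \<Phi> K (ell1_mult \<sigma> ell1_one (ell1_mult \<sigma> (ell1_star \<sigma> e) ell1_one))) \<longlonglongrightarrow> 0"
      unfolding I_def by blast
    then have lim: "(\<lambda>K. \<Phi> K (ell1_star \<sigma> e)) \<longlonglongrightarrow> 0" by simp
    have "\<Phi> K (ell1_star \<sigma> e) = (\<Sum>y\<in>Y K. w K y * cnj (h (lam K y)))" for K
      unfolding \<Phi>_def
    proof (rule sum.cong[OF refl])
      fix y
      let ?z = "lam K y"
      have z0: "?z \<noteq> 0" using lam[of K y] by auto
      \<comment> \<open>On the unit circle conjugation is inversion, so replacing l by -l shows that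
        the transform of \<open>ell1_star \<sigma> e\<close> is the conjugate of h.\<close>
      have "?z * cnj ?z = 1" using complex_norm_square[of ?z] lam[of K y] by simp
      then have cz: "cnj ?z = inverse ?z" by (rule inverse_unique[symmetric])
      have "((\<lambda>l. cnj (c l * ?z powi l)) has_sum cnj (h ?z)) UNIV"
        unfolding has_sum_cnj_iff by (rule c(2)[OF lam])
      then have "((\<lambda>l. cnj (c (- l) * ?z powi (- l))) has_sum cnj (h ?z)) UNIV"
        using has_sum_reindex_bij_betw[OF bij_uminus, of "\<lambda>l. cnj (c l * ?z powi l)"] by simp
      then have s: "((\<lambda>l. cnj (c (- l)) * ?z powi l) has_sum cnj (h ?z)) UNIV"
        by (simp add: cz power_int_minus power_int_inverse)
      have es: "ell1_coeff (ell1_star \<sigma> e) n x' = (if p dvd n then cnj (c (- (n div p))) else 0)" for n x'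
        by (simp add: coeff_star_apply e dvd_neg_div)
      have "orbit_rep \<sigma> x (ell1_star \<sigma> e) (quasi ?z) = (\<lambda>m. cnj (h ?z) * quasi ?z m)"
        by (rule orbit_rep_scalar[of ?z "quasi ?z" 1 "ell1_star \<sigma> e" "\<lambda>l. cnj (c (- l))" "cnj (h ?z)",
            OF lam quasi_shift[OF lam] cmod_quasi_le[OF lam] es s])
      then show "w K y * orbit_rep \<sigma> x (ell1_star \<sigma> e) (quasi ?z) 0 = w K y * cnj (h ?z)"
        by (simp add: quasi_def)
    qed
    then have "1 \<le> cmod (\<Phi> K (ell1_star \<sigma> e))" for K using w3[of K] by simp
    then have "1 \<le> cmod 0" by (intro LIMSEQ_le_const[OF tendsto_norm[OF lim]]) auto
    then show False by simp
  qed
  ultimately have "\<not> self_adjoint_ideal \<sigma> I" using self_adjointD by blast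
  then show ?thesis using \<open>closed_ideal \<sigma> I\<close> by blast
qed

end

subsection \<open>The equivalences\<close>

context compact_system
begin

lemma not_free_periodic_point:
  assumes "\<not> free_system \<sigma>"
  obtains x p where "periodic_point \<sigma> x p"
proof -
  obtain x n where x: "0 < n" "(\<sigma> ^^ n) x = x" using assms by (auto simp: free_system_def)
  define q where "q = (LEAST n. 0 < n \<and> (\<sigma> ^^ n) x = x)"
  have q: "0 < q \<and> (\<sigma> ^^ q) x = x" unfolding q_def by (rule LeastI[of _ n]) (use x in simp)
  have min: "(\<sigma> ^^ k) x \<noteq> x" if "0 < k" "k < q" for k
    using not_less_Least[of k "\<lambda>n. 0 < n \<and> (\<sigma> ^^ n) x = x"] that by (simp add: q_def)
  have "periodic_point \<sigma> x (int q)"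
  proof
    show "0 < int q" "int_iter \<sigma> (int q) x = x" using q by (simp_all add: int_iter_def)
    show "int_iter \<sigma> k x \<noteq> x" if "0 < k" "k < int q" for k
      using min[of "nat k"] that by (simp add: int_iter_def)
  qed
  then show ?thesis by (rule that)
qed

text \<open>Coefficients are continuous, so vanishing on the union of the orbits is vanishing on its
  closure, the hull of I; \<open>kernel_hull\<close> then recovers I.\<close>

lemma free_ideal_eq_Inter:
  assumes free: "free_system \<sigma>" and I: "closed_ideal \<sigma> I"
    and S: "C_hull (ell1_E ` I) = closure (\<Union>x\<in>S. int_orbit \<sigma> x)"
  shows "I = (\<Inter>x\<in>S. orbit_ideal \<sigma> x)"
proof -
  let ?U = "\<Union>x\<in>S. int_orbit \<sigma> x"
  have "ell1_kernel (closure ?U) = ell1_kernel ?U"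
  proof (intro subset_antisym subsetI)
    show "a \<in> ell1_kernel ?U" if "a \<in> ell1_kernel (closure ?U)" for a
      using that closure_subset[of ?U] unfolding ell1_kernel_def by blast
    show "a \<in> ell1_kernel (closure ?U)" if a: "a \<in> ell1_kernel ?U" for a
    proof -
      have "closure ?U \<subseteq> {x. ell1_coeff a n x = 0}" for n
      proof (rule closure_minimal)
        show "closed {x. ell1_coeff a n x = 0}" by (intro closed_Collect_eq continuous_intros)
      qed (use a in \<open>auto simp: ell1_kernel_def\<close>)
      then show ?thesis by (auto simp: ell1_kernel_def)
    qed
  qed
  moreover have "ell1_kernel ?U = (\<Inter>x\<in>S. ell1_kernel (int_orbit \<sigma> x))" by (auto simp: ell1_kernel_def)
  ultimately show ?thesis
    using kernel_hull[OF I free_imp_well_behaved[OF free I]] S by (simp add: C_hull_E[OF I] orbit_ideal_eq_kernel)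
qed

lemma free_orbit_ideal:
  "free_system \<sigma> \<Longrightarrow> primitive_ideal \<sigma> (orbit_ideal \<sigma> x) \<and> well_behaved (orbit_ideal \<sigma> x)"
  using primitive_orbit_ideal free_int_iter_neq by (simp add: orbit_ideal_eq_kernel well_behaved_kernel)

lemma free_ideal_Inter_primitive:
  assumes free: "free_system \<sigma>" and I: "closed_ideal \<sigma> I"
  shows "\<exists>\<P>. (\<forall>P\<in>\<P>. primitive_ideal \<sigma> P \<and> well_behaved P) \<and> I = \<Inter>\<P>"
proof (intro exI conjI ballI)
  let ?S = "ell1_hull I"
  have inv: "invariant_closed \<sigma> ?S" by (rule invariant_hull[OF I])
  have "(\<Union>x\<in>?S. int_orbit \<sigma> x) = ?S"
  proof (intro subset_antisym subsetI)
    show "y \<in> ?S" if "y \<in> (\<Union>x\<in>?S. int_orbit \<sigma> x)" for y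
      using that invariant_closed_iter[OF inv] by (auto simp: int_orbit_def)
    show "y \<in> (\<Union>x\<in>?S. int_orbit \<sigma> x)" if "y \<in> ?S" for y
    proof (rule UN_I[OF that])
      show "y \<in> int_orbit \<sigma> y" unfolding int_orbit_def by (rule range_eqI[of _ _ 0]) simp
    qed
  qed
  then have "C_hull (ell1_E ` I) = closure (\<Union>x\<in>?S. int_orbit \<sigma> x)"
    using inv by (simp add: C_hull_E[OF I] invariant_closed_def)
  \<comment> \<open>If the hull is empty, so is the family, and the empty intersection is the whole
    algebra.\<close>
  then show "I = \<Inter> (orbit_ideal \<sigma> ` ?S)" by (rule free_ideal_eq_Inter[OF free I])
  show "primitive_ideal \<sigma> P" "well_behaved P" if "P \<in> orbit_ideal \<sigma> ` ?S" for P
    using that free_orbit_ideal[OF free] by auto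
qed

text \<open>Self-adjointness is the common way back to freeness: kernels of invariant sets and
  intersections of primitive ideals are self-adjoint, so the other conditions on closed ideals
  reduce to this one.\<close>

lemma self_adjoint_imp_free:
  assumes "\<forall>I. closed_ideal \<sigma> I \<longrightarrow> self_adjoint_ideal \<sigma> I"
  shows "free_system \<sigma>"
proof (rule ccontr)
  assume "\<not> free_system \<sigma>"
  then obtain x p where "periodic_point \<sigma> x p" by (rule not_free_periodic_point)
  then interpret periodic_point \<sigma> x p .
  show False using closed_ideal_not_self_adjoint assms by blast
qed

lemma kernel_hull_imp_free:
  assumes "\<forall>I. closed_ideal \<sigma> I \<longrightarrow> ell1_kernel (ell1_hull I) = I"
  shows "free_system \<sigma>"
proof (rule self_adjoint_imp_free, intro allI impI)
  fix I assume "closed_ideal \<sigma> I"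
  then show "self_adjoint_ideal \<sigma> I"
    using self_adjoint_kernel[of "ell1_hull I"] invariant_closed_iter[OF invariant_hull] assms by metis
qed

lemma Inter_primitive_imp_free:
  assumes "\<forall>I. closed_ideal \<sigma> I \<longrightarrow> (\<exists>\<P>. (\<forall>P\<in>\<P>. primitive_ideal \<sigma> P) \<and> I = \<Inter>\<P>)"
  shows "free_system \<sigma>"
proof (rule self_adjoint_imp_free, intro allI impI)
  fix I assume "closed_ideal \<sigma> I"
  then obtain \<P> where P: "\<forall>P\<in>\<P>. primitive_ideal \<sigma> P" "I = \<Inter>\<P>" using assms by blast
  show "self_adjoint_ideal \<sigma> I"
    by (rule self_adjointI) (use P star_primitive in auto)
qed

lemma primitive_well_behaved_imp_free:
  assumes "\<forall>P. primitive_ideal \<sigma> P \<longrightarrow> well_behaved P"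
  shows "free_system \<sigma>"
proof (rule ccontr)
  assume "\<not> free_system \<sigma>"
  then obtain x p where "periodic_point \<sigma> x p" by (rule not_free_periodic_point)
  then interpret periodic_point \<sigma> x p .
  show False using primitive_not_well_behaved assms by blast
qed

end

theorem theorem3p13:
  fixes \<sigma> :: "'x::t2_space \<Rightarrow> 'x"
  assumes "compact (UNIV :: 'x set)"
    and "homeomorphism UNIV UNIV \<sigma> (inv \<sigma>)"
  shows
    "((bij_betw ell1_hull {I. closed_ideal \<sigma> I} {S. invariant_closed \<sigma> S} \<and>
       bij_betw ell1_kernel {S. invariant_closed \<sigma> S} {I. closed_ideal \<sigma> I} \<and>
       (\<forall>I. closed_ideal \<sigma> I \<longrightarrow> ell1_kernel (ell1_hull I) = I) \<and>
       (\<forall>S. invariant_closed \<sigma> S \<longrightarrow> ell1_hull (ell1_kernel S) = S))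
      \<longleftrightarrow> free_system \<sigma>) \<and>
     ((\<forall>I. closed_ideal \<sigma> I \<longrightarrow> well_behaved I) \<longleftrightarrow> free_system \<sigma>) \<and>
     ((\<forall>I. closed_ideal \<sigma> I \<longrightarrow> self_adjoint_ideal \<sigma> I) \<longleftrightarrow> free_system \<sigma>) \<and>
     ((\<forall>P. primitive_ideal \<sigma> P \<longrightarrow> well_behaved P) \<longleftrightarrow> free_system \<sigma>) \<and>
     ((\<forall>I. closed_ideal \<sigma> I \<longrightarrow>
         (\<exists>\<P>. (\<forall>P\<in>\<P>. primitive_ideal \<sigma> P \<and> well_behaved P) \<and> I = \<Inter>\<P>))
      \<longleftrightarrow> free_system \<sigma>) \<and>
     ((\<forall>I. closed_ideal \<sigma> I \<longrightarrow> (\<exists>\<P>. (\<forall>P\<in>\<P>. primitive_ideal \<sigma> P) \<and> I = \<Inter>\<P>))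
      \<longleftrightarrow> free_system \<sigma>) \<and>
     (free_system \<sigma> \<longrightarrow>
       (\<forall>I S. closed_ideal \<sigma> I \<and> C_hull (ell1_E ` I) = closure (\<Union>x\<in>S. int_orbit \<sigma> x) \<longrightarrow>
         I = (\<Inter>x\<in>S. orbit_ideal \<sigma> x) \<and>
         (\<forall>x\<in>S. primitive_ideal \<sigma> (orbit_ideal \<sigma> x) \<and> well_behaved (orbit_ideal \<sigma> x))))"
    (is "(?B \<longleftrightarrow> ?F) \<and> (?W \<longleftrightarrow> ?F) \<and> (?A \<longleftrightarrow> ?F) \<and> (?P \<longleftrightarrow> ?F) \<and> (?J \<longleftrightarrow> ?F) \<and> (?K \<longleftrightarrow> ?F) \<and> ?E")
proof -
  interpret compact_system \<sigma> using assms by unfold_locales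
  have FW: ?W if ?F using free_imp_well_behaved[OF that] by blast
  have WB: ?B if ?W using well_behaved_imp_inverse_bijections[OF that] .
  have BF: ?F if ?B using kernel_hull_imp_free that by blast
  have BA: ?A if ?B
    using that self_adjoint_kernel invariant_closed_iter[OF invariant_hull] by metis
  have AF: ?F if ?A using self_adjoint_imp_free[OF that] .
  \<comment> \<open>Automatic continuity enters here: primitive ideals are closed, hence covered by
    the statement on closed ideals.\<close>
  have FP: ?P if ?F using FW[OF that] closed_ideal_primitive by blast
  have PF: ?F if ?P using primitive_well_behaved_imp_free[OF that] .
  have FJ: ?J if ?F using free_ideal_Inter_primitive[OF that] by blast
  have JK: ?K if ?J using that by (meson)
  have KF: ?F if ?K using Inter_primitive_imp_free[OF that] .
  have FE: ?E using free_ideal_eq_Inter free_orbit_ideal by blast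
  show ?thesis
  proof (intro conjI)
    show "?B \<longleftrightarrow> ?F" using FW WB BF by argo
    show "?W \<longleftrightarrow> ?F" using FW WB BF by argo
    show "?A \<longleftrightarrow> ?F" using FW WB BA AF by argo
    show "?P \<longleftrightarrow> ?F" using FP PF by argo
    show "?J \<longleftrightarrow> ?F" using FJ JK KF by argo
    show "?K \<longleftrightarrow> ?F" using FJ JK KF by argo
    show ?E by (rule FE)
  qed
qed

end
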